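(* There are absolute constants $c, C>0$ such that for all positive integers $n, d$ with $C\le d\le cn/\ln^2 n$ one has $$p_{n,d}:=\mathbb{P}\big(\{M\in\mathcal{M}_{n,d}\,:\,M \text{ is singular}\}\big)\le \frac{C\ln^3 d}{\sqrt d}.$$
   Context: For $1\le d\le n$, $\mathcal{M}_{n,d}$ denotes the set of all $n\times n$ matrices with entries in $\{0,1\}$ such that every row and every column contains exactly $d$ ones (equivalently, adjacency matrices of $d$-regular directed graphs on $n$ labeled vertices, with loops and anti-parallel edges allowed but no multiple edges). $\mathbb{P}$ is the normalized counting measure on $\mathcal{M}_{n,d}$. "Absolute constant" means independent of all parameters. Singular means not invertible over $\mathbb{R}$. *)

theory Defs
  imports
    "HOL-Probability.Probability_Measure"
    "Jordan_Normal_Form.Matrix"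
begin

definition regular_digraph_matrices :: "nat \<Rightarrow> nat \<Rightarrow> real mat set" where
  "regular_digraph_matrices n d = {M \<in> carrier_mat n n.
     (\<forall>i<n. \<forall>j<n. M $$ (i, j) \<in> {0, 1}) \<and>
     (\<forall>i<n. card {j. j < n \<and> M $$ (i, j) = 1} = d) \<and>
     (\<forall>j<n. card {i. i < n \<and> M $$ (i, j) = 1} = d)}"

definition singular_mat :: "real mat \<Rightarrow> bool" where
  "singular_mat M \<longleftrightarrow> \<not> invertible_mat M"

definition singular_prob :: "nat \<Rightarrow> nat \<Rightarrow> real" where
  "singular_prob n d = measure (uniform_count_measure (regular_digraph_matrices n d))
     {M \<in> regular_digraph_matrices n d. singular_mat M}"

lemma finite_regular_digraph_matrices: "finite (regular_digraph_matrices n d)"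
proof (rule finite_subset)
  let ?F = "({..<n} \<times> {..<n}) \<rightarrow>\<^sub>E {0, 1 :: real}"
  show "regular_digraph_matrices n d \<subseteq> (\<lambda>f. mat n n f) ` ?F"
  proof
    fix M assume M: "M \<in> regular_digraph_matrices n d"
    have "M = mat n n (restrict (\<lambda>p. M $$ p) ({..<n} \<times> {..<n}))"
    proof (rule eq_matI)
      fix i j assume "i < dim_row (mat n n (restrict (\<lambda>p. M $$ p) ({..<n} \<times> {..<n})))"
        and "j < dim_col (mat n n (restrict (\<lambda>p. M $$ p) ({..<n} \<times> {..<n})))"
      then show "M $$ (i, j) = mat n n (restrict (\<lambda>p. M $$ p) ({..<n} \<times> {..<n})) $$ (i, j)"
        by simp
    next
      have "M \<in> carrier_mat n n"
        using M unfolding regular_digraph_matrices_def by blast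
      then show "dim_row M = dim_row (mat n n (restrict (\<lambda>p. M $$ p) ({..<n} \<times> {..<n})))"
        and "dim_col M = dim_col (mat n n (restrict (\<lambda>p. M $$ p) ({..<n} \<times> {..<n})))"
        by simp_all
    qed
    moreover have "restrict (\<lambda>p. M $$ p) ({..<n} \<times> {..<n}) \<in> ?F"
    proof (rule restrict_PiE_iff[THEN iffD2], rule ballI)
      fix p assume "p \<in> {..<n} \<times> {..<n}"
      then obtain i j where p: "p = (i, j)" and "i < n" "j < n" by blast
      moreover have "\<forall>i<n. \<forall>j<n. M $$ (i, j) \<in> {0, 1}"
        using M unfolding regular_digraph_matrices_def by blast
      ultimately show "M $$ p \<in> {0, 1}" by blast
    qed
    ultimately show "M \<in> (\<lambda>f. mat n n f) ` ?F" by blast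
  qed
  show "finite ((\<lambda>f. mat n n f) ` ?F)"
    by (intro finite_imageI finite_PiE) auto
qed

lemma singular_prob_eq_card:
  "singular_prob n d = real (card {M \<in> regular_digraph_matrices n d. singular_mat M})
     / real (card (regular_digraph_matrices n d))"
  unfolding singular_prob_def
  by (rule measure_uniform_count_measure) (auto simp: finite_regular_digraph_matrices)

end

theory Submission
  imports
    Defs
    "HOL-Analysis.Kronecker_Approximation_Theorem"
    "HOL-Combinatorics.Multiset_Permutations"
    "HOL-Real_Asymp.Real_Asymp"
    "Jordan_Normal_Form.Determinant"
begin

text \<open>
  Identify a matrix with its edge set and call $x$ flat if all but $n / \ln^2 d$ of its entries agree.

  A flat real null vector yields, by Diophantine approximation, a flat integer one that does not
  vanish modulo $d + 1$. Modulo $d + 1$ there are so few flat vectors that a union bound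
  works: for supports of size at most $n / d^2$ because of expansion (a row meeting the support
  once), for larger ones because, conditionally on the sums of the pairs of rows $2p, 2p+1$, the pairs
  are independent and each annihilates a fixed vector with probability at most $3/4$. Row sums equal
  $d \equiv -1$, so constant vectors cause no trouble. Expansion comes from switchings, which show
  that a set $F$ of positions is occupied with probability at most $(2d/n)^{|F|}$.

  If the null vectors $x$ (right) and $y$ (left) are not flat, then at least the proportion
  $1 / (2 \ln^2 d)$ of the pairs of rows $i, j$ satisfy $y_i \neq y_j$ and see order $d / \ln^2 d$
  coordinates on both sides of a threshold for $x$. For such a pair the kernel is determined
  by the other rows and the sum of the two, while row $i$ is still a uniformly random choice of half of
  the symmetric difference; by a Littlewood--Offord argument it annihilates $x$ with
  probability $O(\ln d / \sqrt d)$. Double counting gives $\ln^2 d \cdot \ln d / \sqrt d$.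
\<close>


text \<open>A union bound over real vectors is impossible, since each support carries infinitely
  many. Modulo d + 1 a support of size s carries at most d^s, so for s > n / d^2 the entropy,
  including the choice of support, is exp (O (s ln d)). It is beaten by (3/4)^K, where K of order s
  ln d counts pairs of rows that see the support unequally. Only n / 2 pairs exist, so s ln d must
  be small against n; bounding s by n / ln^2 d ensures this with room for constants. Below n / d^2
  the number of supports is too large, hence the separate argument there.

  The assumption on d enters mainly through codegrees: two rows typically share about d^2 / n
  columns, which must be small against d / ln^2 d, the number of coordinates a typical row has on
  either side of the threshold. The two null vectors have different tasks: x is tested against the
  random split of two rows, while y certifies that x does not depend on that split.\<close>

section \<open>Edge sets with prescribed degrees and edge counts in rectangles\<close>

definition outs :: "(nat \<times> nat) set \<Rightarrow> nat \<Rightarrow> nat set" where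
  "outs E i = {j. (i, j) \<in> E}"

definition ins :: "(nat \<times> nat) set \<Rightarrow> nat \<Rightarrow> nat set" where
  "ins E j = {i. (i, j) \<in> E}"

definition digraphs :: "nat \<Rightarrow> nat \<Rightarrow> (nat \<times> nat) set set" where
  "digraphs n d = {E. E \<subseteq> {..<n} \<times> {..<n} \<and> (\<forall>i<n. card (outs E i) = d) \<and> (\<forall>j<n. card (ins E j) = d)}"

text \<open>If no such digraph exists, the quotient is 0 by the convention \<open>x / 0 = 0\<close>,
  so upper bounds hold without an existence proof.\<close>

definition pr :: "nat \<Rightarrow> nat \<Rightarrow> ((nat \<times> nat) set \<Rightarrow> bool) \<Rightarrow> real" where
  "pr n d P = real (card {E \<in> digraphs n d. P E}) / real (card (digraphs n d))"

lemma mem_outs [simp]: "j \<in> outs E i \<longleftrightarrow> (i, j) \<in> E"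
  by (simp add: outs_def)

lemma mem_ins [simp]: "i \<in> ins E j \<longleftrightarrow> (i, j) \<in> E"
  by (simp add: ins_def)

lemma finite_digraphs [simp]: "finite (digraphs n d)"
  by (rule finite_subset[of _ "Pow ({..<n} \<times> {..<n})"]) (auto simp: digraphs_def)

lemma digraphs_subset: "E \<in> digraphs n d \<Longrightarrow> E \<subseteq> {..<n} \<times> {..<n}"
  by (simp add: digraphs_def)

lemma digraphs_lt: "E \<in> digraphs n d \<Longrightarrow> (i, j) \<in> E \<Longrightarrow> i < n \<and> j < n"
  by (auto simp: digraphs_def)

lemma finite_digraph: "E \<in> digraphs n d \<Longrightarrow> finite E"
  by (rule finite_subset[OF digraphs_subset]) auto

lemma outs_subset: "E \<in> digraphs n d \<Longrightarrow> outs E i \<subseteq> {..<n}"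
  by (auto dest: digraphs_lt)

lemma ins_subset: "E \<in> digraphs n d \<Longrightarrow> ins E i \<subseteq> {..<n}"
  by (auto dest: digraphs_lt)

lemma finite_outs: "E \<in> digraphs n d \<Longrightarrow> finite (outs E i)"
  by (rule finite_subset[OF outs_subset]) auto

lemma finite_ins: "E \<in> digraphs n d \<Longrightarrow> finite (ins E i)"
  by (rule finite_subset[OF ins_subset]) auto

lemma card_outs: "E \<in> digraphs n d \<Longrightarrow> i < n \<Longrightarrow> card (outs E i) = d"
  by (simp add: digraphs_def)

lemma card_ins: "E \<in> digraphs n d \<Longrightarrow> i < n \<Longrightarrow> card (ins E i) = d"
  by (simp add: digraphs_def)

lemma card_outs_le: "E \<in> digraphs n d \<Longrightarrow> card (outs E i) \<le> d"
proof (cases "i < n")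
  case False
  assume "E \<in> digraphs n d"
  then have "outs E i = {}" using False by (auto dest: digraphs_lt)
  then show ?thesis by simp
qed (simp add: card_outs)

lemma card_ins_le: "E \<in> digraphs n d \<Longrightarrow> card (ins E i) \<le> d"
proof (cases "i < n")
  case False
  assume "E \<in> digraphs n d"
  then have "ins E i = {}" using False by (auto dest: digraphs_lt)
  then show ?thesis by simp
qed (simp add: card_ins)

lemma converse_digraphs_iff [simp]: "E\<inverse> \<in> digraphs n d \<longleftrightarrow> E \<in> digraphs n d"
  by (auto simp: digraphs_def outs_def ins_def)

lemma card_edges_rows:
  assumes "finite I" "finite E"
  shows "card (E \<inter> (I \<times> A)) = (\<Sum>i\<in>I. card (outs E i \<inter> A))"
proof -
  have "E \<inter> (I \<times> A) = (SIGMA i:I. outs E i \<inter> A)" by auto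
  moreover have "finite (outs E i \<inter> A)" for i
    by (rule finite_subset[of _ "snd ` E"]) (use assms in force)+
  ultimately show ?thesis using assms by simp
qed

lemma card_edges_cols:
  assumes "finite A" "finite E"
  shows "card (E \<inter> (I \<times> A)) = (\<Sum>j\<in>A. card (ins E j \<inter> I))"
proof -
  have "card (E \<inter> (I \<times> A)) = card ((E \<inter> (I \<times> A))\<inverse>)" by simp
  also have "(E \<inter> (I \<times> A))\<inverse> = E\<inverse> \<inter> (A \<times> I)" by auto
  also have "card \<dots> = (\<Sum>j\<in>A. card (outs (E\<inverse>) j \<inter> I))"
    by (rule card_edges_rows) (use assms in auto)
  also have "\<dots> = (\<Sum>j\<in>A. card (ins E j \<inter> I))"
    by (intro sum.cong arg_cong[where f = card]) auto
  finally show ?thesis .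
qed

lemma card_edges_all_rows:
  assumes "E \<in> digraphs n d" "A \<subseteq> {..<n}"
  shows "card (E \<inter> ({..<n} \<times> A)) = d * card A"
proof -
  have "finite A" using assms(2) finite_subset by blast
  then have "card (E \<inter> ({..<n} \<times> A)) = (\<Sum>j\<in>A. card (ins E j \<inter> {..<n}))"
    by (rule card_edges_cols) (rule finite_digraph[OF assms(1)])
  also have "\<dots> = (\<Sum>j\<in>A. d)"
    using assms by (intro sum.cong) (auto simp: Int_absorb2[OF ins_subset] card_ins)
  finally show ?thesis by simp
qed

lemma card_edges_all_cols:
  assumes "E \<in> digraphs n d" "I \<subseteq> {..<n}"
  shows "card (E \<inter> (I \<times> {..<n})) = d * card I"
proof -
  have "finite I" using assms(2) finite_subset by blast
  then have "card (E \<inter> (I \<times> {..<n})) = (\<Sum>j\<in>I. card (outs E j \<inter> {..<n}))"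
    by (rule card_edges_rows) (rule finite_digraph[OF assms(1)])
  also have "\<dots> = (\<Sum>j\<in>I. d)"
    using assms by (intro sum.cong) (auto simp: Int_absorb2[OF outs_subset] card_outs)
  finally show ?thesis by simp
qed

lemma card_digraph: "E \<in> digraphs n d \<Longrightarrow> card E = d * n"
  using card_edges_all_cols[of E n d "{..<n}"] digraphs_subset[of E n d] by (simp add: Int_absorb2)

subsection \<open>Probabilities\<close>

lemma pr_nonneg [simp]: "0 \<le> pr n d P"
  by (simp add: pr_def)

lemma pr_mono: "(\<And>E. E \<in> digraphs n d \<Longrightarrow> P E \<Longrightarrow> Q E) \<Longrightarrow> pr n d P \<le> pr n d Q"
  unfolding pr_def by (intro divide_right_mono) (auto intro!: card_mono)

lemma pr_disj: "pr n d (\<lambda>E. P E \<or> Q E) \<le> pr n d P + pr n d Q"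
proof -
  have "card {E \<in> digraphs n d. P E \<or> Q E} \<le> card {E \<in> digraphs n d. P E} + card {E \<in> digraphs n d. Q E}"
    by (rule order_trans[OF _ card_Un_le]) (auto intro!: card_mono)
  then show ?thesis
    unfolding pr_def add_divide_distrib[symmetric]
    by (intro divide_right_mono) (simp_all flip: of_nat_add)
qed

lemma pr_Bex:
  assumes "finite I"
  shows "pr n d (\<lambda>E. \<exists>i\<in>I. P i E) \<le> (\<Sum>i\<in>I. pr n d (P i))"
proof -
  have "{E \<in> digraphs n d. \<exists>i\<in>I. P i E} = (\<Union>i\<in>I. {E \<in> digraphs n d. P i E})" by auto
  then have "card {E \<in> digraphs n d. \<exists>i\<in>I. P i E} \<le> (\<Sum>i\<in>I. card {E \<in> digraphs n d. P i E})"
    by (simp add: card_UN_le assms)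
  then show ?thesis
    unfolding pr_def sum_divide_distrib[symmetric]
    by (intro divide_right_mono) (simp_all flip: of_nat_sum)
qed

lemma pr_leI:
  assumes "real (card {E \<in> digraphs n d. P E}) \<le> p * real (card (digraphs n d))" "0 \<le> p"
  shows "pr n d P \<le> p"
  using assms by (cases "digraphs n d = {}") (auto simp: pr_def divide_le_eq card_gt_0_iff)

text \<open>Transposition permutes the model; this carries bounds on right null vectors over to left
  ones.\<close>

lemma pr_converse: "pr n d (\<lambda>E. P (E\<inverse>)) = pr n d P"
proof -
  have "bij_betw converse {E \<in> digraphs n d. P (E\<inverse>)} {E \<in> digraphs n d. P E}"
    by (rule bij_betwI[where g = converse]) auto
  then show ?thesis by (simp add: pr_def bij_betw_same_card)
qed

lemma pr_markov:
  assumes "finite I" "0 < a"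
  shows "pr n d (\<lambda>E. a \<le> real (card {i \<in> I. P i E})) \<le> (\<Sum>i\<in>I. pr n d (P i)) / a"
proof -
  let ?G = "digraphs n d" and ?B = "{E \<in> digraphs n d. a \<le> real (card {i \<in> I. P i E})}"
  have "a * real (card ?B) = (\<Sum>E\<in>?B. a)" by simp
  also have "\<dots> \<le> (\<Sum>E\<in>?B. real (card {i \<in> I. P i E}))" by (rule sum_mono) simp
  also have "\<dots> \<le> (\<Sum>E\<in>?G. real (card {i \<in> I. P i E}))" by (rule sum_mono2) auto
  also have "\<dots> = (\<Sum>E\<in>?G. \<Sum>i\<in>I. if P i E then 1 else 0)"
    using assms by (simp add: sum.If_cases Int_def)
  also have "\<dots> = (\<Sum>i\<in>I. \<Sum>E\<in>?G. if P i E then 1 else 0)" by (rule sum.swap)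
  also have "\<dots> = (\<Sum>i\<in>I. real (card {E \<in> ?G. P i E}))"
    by (simp add: sum.If_cases Int_def)
  finally have "real (card ?B) \<le> (\<Sum>i\<in>I. real (card {E \<in> ?G. P i E})) / a"
    using assms by (simp add: field_simps)
  then have "real (card ?B) / real (card ?G) \<le> (\<Sum>i\<in>I. real (card {E \<in> ?G. P i E})) / a / real (card ?G)"
    by (rule divide_right_mono) simp
  then show ?thesis by (simp add: pr_def sum_divide_distrib[symmetric] divide_divide_eq_left mult.commute)
qed

subsection \<open>Switchings\<close>

text \<open>The simple switching: two edges exchange their heads, all degrees being kept. The four
  indices suffice to undo it (\<open>switch_switch\<close>), which makes the double counts below
  injective.\<close>

definition switch :: "(nat \<times> nat) set \<Rightarrow> nat \<Rightarrow> nat \<Rightarrow> nat \<Rightarrow> nat \<Rightarrow> (nat \<times> nat) set" where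
  "switch E i j i' j' = E - {(i, j), (i', j')} \<union> {(i, j'), (i', j)}"

lemma switch_switch:
  assumes "(i, j) \<in> E" "(i', j') \<in> E" "(i, j') \<notin> E" "(i', j) \<notin> E"
  shows "switch (switch E i j i' j') i j' i' j = E"
  using assms unfolding switch_def by auto

lemma card_exchange: "finite A \<Longrightarrow> x \<in> A \<Longrightarrow> y \<notin> A \<Longrightarrow> card (insert y (A - {x})) = card A"
  by (metis Diff_iff card.remove card_insert_disjoint finite_Diff)

lemma switch_in_digraphs:
  assumes E: "E \<in> digraphs n d"
    and sw: "(i, j) \<in> E" "(i', j') \<in> E" "(i, j') \<notin> E" "(i', j) \<notin> E"
  shows "switch E i j i' j' \<in> digraphs n d"
proof -
  have ne: "i \<noteq> i'" "j \<noteq> j'" using sw by auto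
  have lt: "i < n" "j < n" "i' < n" "j' < n" using digraphs_lt[OF E] sw by auto
  have "card (outs (switch E i j i' j') k) = d" if "k < n" for k
  proof -
    have "outs (switch E i j i' j') k =
      (if k = i then insert j' (outs E i - {j}) else if k = i' then insert j (outs E i' - {j'}) else outs E k)"
      using ne by (auto simp: switch_def)
    moreover have "card (insert j' (outs E i - {j})) = card (outs E i)"
      "card (insert j (outs E i' - {j'})) = card (outs E i')"
      by (rule card_exchange; use sw finite_outs[OF E] in simp)+
    ultimately show ?thesis using that lt card_outs[OF E] by simp
  qed
  moreover have "card (ins (switch E i j i' j') k) = d" if "k < n" for k
  proof -
    have "ins (switch E i j i' j') k =
      (if k = j then insert i' (ins E j - {i}) else if k = j' then insert i (ins E j' - {i'}) else ins E k)"
      using ne by (auto simp: switch_def)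
    moreover have "card (insert i' (ins E j - {i})) = card (ins E j)"
      "card (insert i (ins E j' - {i'})) = card (ins E j')"
      by (rule card_exchange; use sw finite_ins[OF E] in simp)+
    ultimately show ?thesis using that lt card_ins[OF E] by simp
  qed
  ultimately show ?thesis
    using digraphs_subset[OF E] lt by (auto simp: digraphs_def switch_def)
qed

text \<open>Double counting: \<open>f\<close> embeds the switchings leaving \<open>X\<close> into
  those arriving in \<open>Y\<close>. \<open>D' y\<close> may be any superset of the labels that
  arrive at y.\<close>

lemma switching_count:
  fixes a b :: real
  assumes fin: "finite X" "finite Y"
    and D: "\<And>x. x \<in> X \<Longrightarrow> finite (D x) \<and> a \<le> real (card (D x))"
    and D': "\<And>y. y \<in> Y \<Longrightarrow> finite (D' y) \<and> real (card (D' y)) \<le> b"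
    and inj: "inj_on f (Sigma X D)" and sub: "f ` Sigma X D \<subseteq> Sigma Y D'"
  shows "a * real (card X) \<le> b * real (card Y)"
proof -
  have "a * real (card X) \<le> (\<Sum>x\<in>X. real (card (D x)))"
    using sum_mono[of X "\<lambda>_. a" "\<lambda>x. real (card (D x))"] D by (simp add: mult.commute)
  also have "\<dots> = real (card (Sigma X D))" using fin D by simp
  also have "card (Sigma X D) \<le> card (Sigma Y D')"
    by (rule card_inj_on_le[OF inj sub]) (use fin D' in auto)
  also have "real (card (Sigma Y D')) = (\<Sum>y\<in>Y. real (card (D' y)))" using fin D' by simp
  also have "\<dots> \<le> b * real (card Y)"
    using sum_mono[of Y "\<lambda>x. real (card (D' x))" "\<lambda>_. b"] D' by (simp add: mult.commute)
  finally show ?thesis by simp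
qed

text \<open>Remove \<open>e = (i, j)\<close> by switching it with an edge (i', j'). Forbidden are
  the edges of \<open>insert e F\<close>, those leaving an in-neighbour of j and those entering an
  out-neighbour of i: at most n d / 4 + 2 d^2 <= n d / 2. Backwards, i' is an in-neighbour of j and
  j' an out-neighbour of i, so there are at most d^2 choices and the ratio is 2 d / n.\<close>

lemma inclusion_step:
  assumes d: "0 < d" "8 * d \<le> n" and F: "finite F" "e \<notin> F" "4 * Suc (card F) \<le> n * d"
  shows "real n * real (card {E \<in> digraphs n d. insert e F \<subseteq> E})
    \<le> 2 * real d * real (card {E \<in> digraphs n d. F \<subseteq> E})"
proof -
  obtain i j where e: "e = (i, j)" by (cases e)
  define D where "D E = E - insert e F - E \<inter> (ins E j \<times> {..<n}) - E \<inter> ({..<n} \<times> outs E i)" for E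
  define f where "f = (\<lambda>(E, i', j'). (switch E i j i' j', i', j'))"
  have "real n * real d / 2 * real (card {E \<in> digraphs n d. insert e F \<subseteq> E})
    \<le> real d * real d * real (card {E \<in> digraphs n d. F \<subseteq> E})"
  proof (rule switching_count[where D = D and D' = "\<lambda>E. ins E j \<times> outs E i" and f = f])
    fix E assume "E \<in> {E \<in> digraphs n d. insert e F \<subseteq> E}"
    then have E: "E \<in> digraphs n d" "insert e F \<subseteq> E" by auto
    have "card E \<le> card (D E) + card (E \<inter> ({..<n} \<times> outs E i))
        + card (E \<inter> (ins E j \<times> {..<n})) + card (insert e F)"
    proof -
      have "E = D E \<union> E \<inter> ({..<n} \<times> outs E i) \<union> E \<inter> (ins E j \<times> {..<n}) \<union> insert e F"
        using E(2) unfolding D_def by blast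
      then have "card E \<le> card (D E \<union> E \<inter> ({..<n} \<times> outs E i) \<union> E \<inter> (ins E j \<times> {..<n})) + card (insert e F)"
        by (metis card_Un_le)
      also have "card (D E \<union> E \<inter> ({..<n} \<times> outs E i) \<union> E \<inter> (ins E j \<times> {..<n}))
        \<le> card (D E \<union> E \<inter> ({..<n} \<times> outs E i)) + card (E \<inter> (ins E j \<times> {..<n}))"
        by (rule card_Un_le)
      also have "card (D E \<union> E \<inter> ({..<n} \<times> outs E i)) \<le> card (D E) + card (E \<inter> ({..<n} \<times> outs E i))"
        by (rule card_Un_le)
      finally show ?thesis by simp
    qed
    moreover have "card (E \<inter> ({..<n} \<times> outs E i)) \<le> d * d"
      using card_edges_all_rows[OF E(1) outs_subset[OF E(1)]] card_outs_le[OF E(1)] by simp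
    moreover have "card (E \<inter> (ins E j \<times> {..<n})) \<le> d * d"
      using card_edges_all_cols[OF E(1) ins_subset[OF E(1)]] card_ins_le[OF E(1)] by simp
    moreover have "8 * (d * d) \<le> n * d" using d by simp
    moreover have "card E = n * d" "card (insert e F) = Suc (card F)"
      using F card_digraph[OF E(1)] by simp_all
    moreover have "x \<le> 2 * a" if "x \<le> a + p + q + f" "p \<le> y" "q \<le> y" "8 * y \<le> x" "4 * f \<le> x"
      for a f p q x y :: nat using that by linarith
    ultimately have "n * d \<le> 2 * card (D E)" using F(3) by metis
    then have "real n * real d \<le> 2 * real (card (D E))"
      by (metis of_nat_le_iff of_nat_mult of_nat_numeral)
    moreover have "finite (D E)" using finite_digraph[OF E(1)] by (simp add: D_def)
    ultimately show "finite (D E) \<and> real n * real d / 2 \<le> real (card (D E))" by simp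
  next
    fix E assume "E \<in> {E \<in> digraphs n d. F \<subseteq> E}"
    then have E: "E \<in> digraphs n d" by simp
    have "card (ins E j \<times> outs E i) \<le> d * d"
      using card_outs_le[OF E] card_ins_le[OF E] by (simp add: card_cartesian_product mult_mono)
    then show "finite (ins E j \<times> outs E i) \<and> real (card (ins E j \<times> outs E i)) \<le> real d * real d"
      using finite_outs[OF E] finite_ins[OF E] by (metis finite_cartesian_product of_nat_le_iff of_nat_mult)
  next
    let ?S = "Sigma {E \<in> digraphs n d. insert e F \<subseteq> E} D"
    have sw: "(i, j) \<in> E" "(i', j') \<in> E" "(i, j') \<notin> E" "(i', j) \<notin> E" "(i', j') \<notin> F"
      if "E \<in> digraphs n d" "insert e F \<subseteq> E" "(i', j') \<in> D E" for E i' j'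
      using that digraphs_lt[OF that(1)] unfolding D_def e by auto
    show "inj_on f ?S"
    proof (rule inj_on_inverseI)
      fix x assume "x \<in> ?S"
      then show "(\<lambda>(E, i', j'). (switch E i j' i' j, i', j')) (f x) = x"
        by (auto simp: f_def switch_switch[OF sw(1-4)])
    qed
    show "f ` ?S \<subseteq> (SIGMA E:{E \<in> digraphs n d. F \<subseteq> E}. ins E j \<times> outs E i)"
    proof
      fix y assume "y \<in> f ` ?S"
      then obtain E i' j' where y: "y = (switch E i j i' j', i', j')"
        and E: "E \<in> digraphs n d" "insert e F \<subseteq> E" "(i', j') \<in> D E"
        by (auto simp: f_def)
      note s = sw[OF E]
      have "F \<subseteq> switch E i j i' j'" using E(2) s(5) F(2) e by (auto simp: switch_def)
      then show "y \<in> (SIGMA E:{E \<in> digraphs n d. F \<subseteq> E}. ins E j \<times> outs E i)"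
        using switch_in_digraphs[OF E(1) s(1-4)] y by (auto simp: switch_def)
    qed
  qed auto
  then have "real d * (real n * real (card {E \<in> digraphs n d. insert e F \<subseteq> E}))
    \<le> real d * (2 * real d * real (card {E \<in> digraphs n d. F \<subseteq> E}))"
    by (simp add: field_simps)
  then show ?thesis using d by simp
qed

text \<open>Up to the factor 2 this is the bound for independent entries of density d / n; it
  replaces independence in the union bounds on expansion.\<close>

lemma pr_inclusion:
  assumes "0 < d" "8 * d \<le> n" and "finite F" "4 * card F \<le> n * d"
  shows "pr n d (\<lambda>E. F \<subseteq> E) \<le> (2 * real d / real n) ^ card F"
  using assms(3,4)
proof (induction F rule: finite_induct)
  case empty
  then show ?case by (simp add: pr_def divide_le_eq)
next
  case (insert e F)
  have n: "0 < n" using assms by auto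
  have "real n * real (card {E \<in> digraphs n d. insert e F \<subseteq> E})
    \<le> 2 * real d * real (card {E \<in> digraphs n d. F \<subseteq> E})"
    by (rule inclusion_step) (use insert assms in auto)
  then have "real (card {E \<in> digraphs n d. insert e F \<subseteq> E})
    \<le> 2 * real d / real n * real (card {E \<in> digraphs n d. F \<subseteq> E})"
    using n by (simp add: field_simps)
  then have "pr n d (\<lambda>E. insert e F \<subseteq> E) \<le> 2 * real d / real n * pr n d (\<lambda>E. F \<subseteq> E)"
    unfolding pr_def times_divide_eq_right by (rule divide_right_mono) simp
  also have "\<dots> \<le> 2 * real d / real n * (2 * real d / real n) ^ card F"
    by (rule mult_left_mono) (use insert in auto)
  finally show ?case using insert by simp
qed

section \<open>Binomial estimates and union bounds over blocks of positions\<close>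

text \<open>k^k / k! is a single term of the series of exp k, and exp 1 <= 3.\<close>

lemma power_le_fact: "real k ^ k \<le> 3 ^ k * fact k"
proof -
  have "real k ^ k / fact k \<le> exp (real k)"
  proof -
    have "(\<Sum>i\<in>{k}. inverse (fact i) * real k ^ i) \<le> (\<Sum>i. inverse (fact i) * real k ^ i)"
      by (rule sum_le_suminf) (auto intro: summable_exp)
    then show ?thesis by (simp add: exp_def scaleR_conv_of_real field_simps)
  qed
  also have "\<dots> = exp 1 ^ k" by (simp flip: exp_of_nat_mult)
  also have "\<dots> \<le> 3 ^ k" by (rule power_mono) (use exp_le in auto)
  finally show ?thesis by (simp add: field_simps)
qed

lemma binomial_le_power:
  assumes "real n \<le> N" "0 < k"
  shows "real (n choose k) \<le> (3 * N / real k) ^ k"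
proof -
  have "real (n choose k) * (real k ^ k) \<le> real (n choose k) * (3 ^ k * fact k)"
    by (rule mult_left_mono[OF power_le_fact]) simp
  also have "\<dots> = 3 ^ k * real ((n choose k) * fact k)" by simp
  also have "\<dots> \<le> 3 ^ k * real (n ^ k)"
    by (intro mult_left_mono of_nat_mono binomial_fact_pow) auto
  also have "\<dots> \<le> 3 ^ k * N ^ k" using assms by (auto intro!: power_mono)
  finally show ?thesis using assms(2) by (simp add: power_divide power_mult_distrib field_simps)
qed

text \<open>Union bound over the \<open>t\<close>-subsets of \<open>I\<close>; disjointness gives
  each union exactly \<open>r * t\<close> positions. Used with \<open>r = 1\<close> for edges in a
  rectangle and with \<open>r = 2\<close> for columns shared by two rows.\<close>

lemma pr_many_blocks:
  assumes d: "0 < d" "8 * d \<le> n" and I: "finite I" "real (card I) \<le> N" and t: "0 < t" "4 * (r * t) \<le> n * d"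
    and B: "disjoint_family_on B I" "\<And>i. i \<in> I \<Longrightarrow> finite (B i) \<and> card (B i) = r"
  shows "pr n d (\<lambda>E. t \<le> card {i \<in> I. B i \<subseteq> E}) \<le> (3 * N / real t * (2 * real d / real n) ^ r) ^ t"
proof -
  let ?T = "{T. T \<subseteq> I \<and> card T = t}"
  have finT: "finite ?T" by (rule finite_subset[of _ "Pow I"]) (use I in auto)
  have "pr n d (\<lambda>E. t \<le> card {i \<in> I. B i \<subseteq> E}) \<le> pr n d (\<lambda>E. \<exists>T\<in>?T. \<Union> (B ` T) \<subseteq> E)"
  proof (rule pr_mono)
    fix E assume "t \<le> card {i \<in> I. B i \<subseteq> E}"
    then obtain T where "T \<subseteq> {i \<in> I. B i \<subseteq> E}" "card T = t"
      by (rule obtain_subset_with_card_n) blast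
    then show "\<exists>T\<in>?T. \<Union> (B ` T) \<subseteq> E" by (intro bexI[of _ T]) auto
  qed
  also have "\<dots> \<le> (\<Sum>T\<in>?T. pr n d (\<lambda>E. \<Union> (B ` T) \<subseteq> E))" by (rule pr_Bex[OF finT])
  also have "\<dots> \<le> (\<Sum>T\<in>?T. (2 * real d / real n) ^ (r * t))"
  proof (rule sum_mono)
    fix T assume T: "T \<in> ?T"
    have fin: "finite T" using T I finite_subset by blast
    have "card (\<Union> (B ` T)) = (\<Sum>i\<in>T. card (B i))"
      by (rule card_UN_disjoint) (use T B fin in \<open>auto simp: disjoint_family_on_def subset_iff\<close>)
    also have "\<dots> = (\<Sum>i\<in>T. r)" by (rule sum.cong) (use T B in auto)
    finally have c: "card (\<Union> (B ` T)) = r * t" using T by simp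
    then show "pr n d (\<lambda>E. \<Union> (B ` T) \<subseteq> E) \<le> (2 * real d / real n) ^ (r * t)"
      using pr_inclusion[OF d, of "\<Union> (B ` T)"] t fin T B by (auto simp: subset_iff)
  qed
  also have "\<dots> = real (card I choose t) * (2 * real d / real n) ^ (r * t)"
    using n_subsets[OF I(1), of t] by simp
  also have "\<dots> \<le> (3 * N / real t) ^ t * (2 * real d / real n) ^ (r * t)"
    by (intro mult_right_mono binomial_le_power) (use I t in auto)
  finally show ?thesis by (simp only: power_mult power_mult_distrib)
qed

lemma pr_many_edges:
  assumes d: "0 < d" "8 * d \<le> n" and Z: "finite Z" "real (card Z) \<le> N" and t: "0 < t" "4 * t \<le> n * d"
  shows "pr n d (\<lambda>E. t \<le> card (E \<inter> Z)) \<le> (6 * N * real d / (real t * real n)) ^ t"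
proof -
  have "pr n d (\<lambda>E. t \<le> card {e \<in> Z. {e} \<subseteq> E}) \<le> (3 * N / real t * (2 * real d / real n) ^ 1) ^ t"
    by (rule pr_many_blocks) (use assms in \<open>auto simp: disjoint_family_on_def\<close>)
  moreover have "{e \<in> Z. {e} \<subseteq> E} = E \<inter> Z" for E by auto
  ultimately show ?thesis by (simp add: mult.commute mult.left_commute)
qed

text \<open>Switching one edge into $I \times A$ shows that the levels of the edge count of $I \times A$
  grow geometrically below its mean.\<close>

lemma edge_count_step:
  assumes n: "0 < n" and I: "I \<subseteq> {..<n}" and A: "A \<subseteq> {..<n}" "16 * d \<le> card A"
    and t: "5 * Suc t * n \<le> d * card I * card A"
  shows "2 * real (card {E \<in> digraphs n d. card (E \<inter> (I \<times> A)) = t})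
    \<le> real (card {E \<in> digraphs n d. card (E \<inter> (I \<times> A)) = Suc t})"
proof (cases "d = 0 \<or> I = {} \<or> A = {}")
  case True
  then have "d * card I * card A = 0" by auto
  with t have "5 * Suc t * n \<le> 0" by (simp only:)
  then have False using n by simp
  then show ?thesis ..
next
  case False
  let ?N = "\<lambda>t. {E \<in> digraphs n d. card (E \<inter> (I \<times> A)) = t}"
  let ?I' = "{..<n} - I" and ?A' = "{..<n} - A"
  have fin: "finite I" "finite A" using I A finite_subset by blast+
  have cI: "card I \<le> n" and cA: "card A \<le> n" using card_mono[OF _ I] card_mono[OF _ A(1)] by auto
  \<comment> \<open>One edge leaves \<open>I\<close> outside \<open>A\<close>, one enters
    \<open>A\<close> from outside \<open>I\<close>; switching them puts exactly one new edge into
    the rectangle. Backwards, \<open>D'\<close> pairs an edge of the rectangle with an arbitrary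
    edge.\<close>
  define D where "D E = {(i, j', i', j). (i, j') \<in> E \<inter> (I \<times> ?A') \<and> (i', j) \<in> E \<inter> (?I' \<times> A)
    \<and> (i, j) \<notin> E \<and> (i', j') \<notin> E}" for E
  define D' where "D' E = {(i, j', i', j). (i, j) \<in> E \<inter> (I \<times> A) \<and> (i', j') \<in> E}" for E
  define f where "f = (\<lambda>(E, i, j', i', j). (switch E i j' i' j, i, j', i', j))"
  have tI: "5 * Suc t \<le> d * card I"
  proof -
    have "5 * Suc t * n \<le> d * card I * n" using t cA by (meson le_trans mult_le_mono2)
    then show ?thesis using n by simp
  qed
  have tA: "5 * Suc t \<le> d * card A"
  proof -
    have "5 * Suc t * n \<le> d * card A * card I" using t by (simp only: mult_ac)
    also have "\<dots> \<le> d * card A * n" using cI by (rule mult_le_mono2)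
    finally have "5 * Suc t * n \<le> d * card A * n" .
    then show ?thesis using n by simp
  qed
  \<comment> \<open>27/50 = 4/5 * 27/40: at least 4/5 of the edges leaving \<open>I\<close> avoid
    \<open>A\<close>, and each has at least (1 - 1/5 - 1/8) d |A| partners. The backward count is at
    most a fifth of d |I| * d |A|, so the growth factor is 27/10.\<close>
  have "real (d * card I) * real (d * card A) * (27 / 50) * real (card (?N t))
    \<le> real (Suc t) * real (d * n) * real (card (?N (Suc t)))"
  proof (rule switching_count[where D = D and D' = D' and f = f])
    fix E assume "E \<in> ?N t"
    then have E: "E \<in> digraphs n d" and et: "card (E \<inter> (I \<times> A)) = t" by auto
    have finE: "finite E" by (rule finite_digraph[OF E])
    let ?P = "E \<inter> (I \<times> ?A')" and ?Q = "E \<inter> (?I' \<times> A)"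
    have P: "card ?P + t = d * card I"
    proof -
      have "card ?P + card (E \<inter> (I \<times> A)) = card (?P \<union> E \<inter> (I \<times> A))"
        by (rule card_Un_disjoint[symmetric]) (use finE in auto)
      also have "?P \<union> E \<inter> (I \<times> A) = E \<inter> (I \<times> {..<n})" using A by auto
      finally show ?thesis using card_edges_all_cols[OF E I] et by simp
    qed
    have Q: "card ?Q + t = d * card A"
    proof -
      have "card ?Q + card (E \<inter> (I \<times> A)) = card (?Q \<union> E \<inter> (I \<times> A))"
        by (rule card_Un_disjoint[symmetric]) (use finE in auto)
      also have "?Q \<union> E \<inter> (I \<times> A) = E \<inter> ({..<n} \<times> A)" using I by auto
      finally show ?thesis using card_edges_all_rows[OF E A(1)] et by simp
    qed
    define R where "R p = {q \<in> ?Q. (fst p, snd q) \<notin> E \<and> (fst q, snd p) \<notin> E}" for p :: "nat \<times> nat"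
    have R: "card ?Q \<le> card (R p) + 2 * (d * d)" for p
    proof -
      have "?Q \<subseteq> R p \<union> (E \<inter> ({..<n} \<times> outs E (fst p)) \<union> E \<inter> (ins E (snd p) \<times> {..<n}))"
        using A I by (auto simp: R_def)
      then have "card ?Q \<le> card (R p \<union> (E \<inter> ({..<n} \<times> outs E (fst p)) \<union> E \<inter> (ins E (snd p) \<times> {..<n})))"
        by (rule card_mono[rotated]) (use finE in \<open>auto simp: R_def\<close>)
      also have "\<dots> \<le> card (R p) + card (E \<inter> ({..<n} \<times> outs E (fst p)) \<union> E \<inter> (ins E (snd p) \<times> {..<n}))"
        by (rule card_Un_le)
      also have "card (E \<inter> ({..<n} \<times> outs E (fst p)) \<union> E \<inter> (ins E (snd p) \<times> {..<n}))
        \<le> card (E \<inter> ({..<n} \<times> outs E (fst p))) + card (E \<inter> (ins E (snd p) \<times> {..<n}))"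
        by (rule card_Un_le)
      also have "card (E \<inter> ({..<n} \<times> outs E (fst p))) \<le> d * d"
        using card_edges_all_rows[OF E outs_subset[OF E]] card_outs_le[OF E] by simp
      also have "card (E \<inter> (ins E (snd p) \<times> {..<n})) \<le> d * d"
        using card_edges_all_cols[OF E ins_subset[OF E]] card_ins_le[OF E] by simp
      finally show ?thesis by simp
    qed
    have "D E = (\<lambda>((i, j'), (i', j)). (i, j', i', j)) ` (SIGMA p:?P. R p)"
      by (force simp: D_def R_def)
    moreover have "inj_on (\<lambda>((i, j'), (i', j)). (i, j', i', j)) (SIGMA p:?P. R p)"
      by (auto simp: inj_on_def)
    moreover have finR: "finite (R p)" for p using finE by (simp add: R_def)
    ultimately have cD: "finite (D E)" "card (D E) = (\<Sum>p\<in>?P. card (R p))"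
      using finE by (auto simp: card_image)
    have Rbig: "27 * (d * card A) \<le> 40 * card (R p)" for p
    proof -
      have "16 * (d * d) \<le> d * card A" using A(2) by simp
      moreover have "27 * x \<le> 40 * r" if "16 * y \<le> x" "q \<le> r + 2 * y" "q + t = x" "5 * t + 5 \<le> x"
        for x y q r :: nat using that by linarith
      moreover have "5 * t + 5 \<le> d * card A" using tA by simp
      ultimately show ?thesis using R[of p] Q by metis
    qed
    have "real (d * card I) * real (d * card A) * (27 / 50) = (4/5) * real (d * card I) * (27 / 40 * real (d * card A))"
      by simp
    also have "\<dots> \<le> real (card ?P) * (27 / 40 * real (d * card A))"
    proof (rule mult_right_mono)
      have "4 * x \<le> 5 * q" if "q + t = x" "5 * t + 5 \<le> x" for x q :: nat using that by linarith
      moreover have "5 * t + 5 \<le> d * card I" using tI by simp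
      ultimately have "4 * (d * card I) \<le> 5 * card ?P" using P by metis
      then show "4 / 5 * real (d * card I) \<le> real (card ?P)"
        using of_nat_mono[of "4 * (d * card I)" "5 * card ?P", where 'a = real] by simp
    qed simp
    also have "\<dots> = (\<Sum>p\<in>?P. 27 / 40 * real (d * card A))" by simp
    also have "\<dots> \<le> (\<Sum>p\<in>?P. real (card (R p)))"
    proof (rule sum_mono)
      show "27 / 40 * real (d * card A) \<le> real (card (R p))" for p
        using of_nat_mono[OF Rbig[of p], where 'a = real] by simp
    qed
    also have "\<dots> = real (card (D E))" using cD by simp
    finally show "finite (D E) \<and> real (d * card I) * real (d * card A) * (27 / 50) \<le> real (card (D E))"
      using cD by simp
  next
    fix E assume "E \<in> ?N (Suc t)"
    then have E: "E \<in> digraphs n d" and et: "card (E \<inter> (I \<times> A)) = Suc t" by auto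
    have finE: "finite E" by (rule finite_digraph[OF E])
    have "D' E = (\<lambda>((i, j), (i', j')). (i, j', i', j)) ` ((E \<inter> (I \<times> A)) \<times> E)"
      by (force simp: D'_def)
    moreover have "inj_on (\<lambda>((i, j), (i', j')). (i, j', i', j)) ((E \<inter> (I \<times> A)) \<times> E)"
      by (auto simp: inj_on_def)
    ultimately have "finite (D' E)" "card (D' E) = Suc t * (d * n)"
      using finE et card_digraph[OF E] by (auto simp: card_image card_cartesian_product)
    then show "finite (D' E) \<and> real (card (D' E)) \<le> real (Suc t) * real (d * n)"
      by (metis of_nat_mult order_refl)
  next
    have sw: "(i, j') \<in> E" "(i', j) \<in> E" "(i, j) \<notin> E" "(i', j') \<notin> E"
      if "(i, j', i', j) \<in> D E" for E i j i' j'
      using that by (auto simp: D_def)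
    show "inj_on f (Sigma (?N t) D)"
    proof (rule inj_on_inverseI)
      fix x assume "x \<in> Sigma (?N t) D"
      then show "(\<lambda>(E, i, j', i', j). (switch E i j i' j', i, j', i', j)) (f x) = x"
        by (auto simp: f_def switch_switch[OF sw])
    qed
    show "f ` Sigma (?N t) D \<subseteq> Sigma (?N (Suc t)) D'"
    proof
      fix y assume "y \<in> f ` Sigma (?N t) D"
      then obtain E i j i' j' where y: "y = (switch E i j' i' j, i, j', i', j)"
        and E: "E \<in> digraphs n d" "card (E \<inter> (I \<times> A)) = t" and m: "(i, j', i', j) \<in> D E"
        by (auto simp: f_def)
      note s = sw[OF m]
      have ij: "i \<in> I" "j \<in> A" "i' \<notin> I" "j' \<notin> A" using m by (auto simp: D_def)
      have "switch E i j' i' j \<inter> (I \<times> A) = insert (i, j) (E \<inter> (I \<times> A))"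
        using ij by (auto simp: switch_def)
      then have "card (switch E i j' i' j \<inter> (I \<times> A)) = Suc t"
        using E s finite_digraph[OF E(1)] by simp
      moreover have "(i, j', i', j) \<in> D' (switch E i j' i' j)"
        using ij by (auto simp: D'_def switch_def)
      ultimately show "y \<in> Sigma (?N (Suc t)) D'"
        using switch_in_digraphs[OF E(1) s] y by simp
    qed
  qed auto
  also have "\<dots> \<le> (real (d * card I) * real (d * card A) / 5) * real (card (?N (Suc t)))"
  proof (rule mult_right_mono)
    have "5 * (Suc t * (d * n)) \<le> (d * card I) * (d * card A)"
      using mult_le_mono2[OF t, of d] by (simp add: algebra_simps)
    from of_nat_mono[OF this, where 'a = real]
    show "real (Suc t) * real (d * n) \<le> real (d * card I) * real (d * card A) / 5"
      by (simp only: of_nat_mult of_nat_numeral le_divide_eq_numeral1 mult_ac)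
  qed simp
  finally have "real (d * card I) * real (d * card A) * ((27 / 50) * real (card (?N t)))
    \<le> real (d * card I) * real (d * card A) * (real (card (?N (Suc t))) / 5)"
    by simp
  moreover have "0 < real (d * card I) * real (d * card A)"
    using False fin by (simp add: card_gt_0_iff)
  ultimately have "(27 / 50) * real (card (?N t)) \<le> real (card (?N (Suc t))) / 5"
    by (simp only: mult_le_cancel_left_pos)
  then show ?thesis by simp
qed

text \<open>Level t + q is at least 2^q times level t while t + q stays below a fifth of the mean d
  |I| |A| / n. The shifted levels are disjoint, so they fit into the whole space.\<close>

lemma pr_few_edges:
  assumes n: "0 < n" and I: "I \<subseteq> {..<n}" and A: "A \<subseteq> {..<n}" "16 * d \<le> card A"
    and q: "5 * (T + q) * n \<le> d * card I * card A"
  shows "pr n d (\<lambda>E. card (E \<inter> (I \<times> A)) \<le> T) \<le> 1 / 2 ^ q"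
proof (rule pr_leI)
  let ?N = "\<lambda>t. {E \<in> digraphs n d. card (E \<inter> (I \<times> A)) = t}"
  have step: "2 ^ k * real (card (?N t)) \<le> real (card (?N (t + k)))"
    if "5 * (t + k) * n \<le> d * card I * card A" for t k
    using that
  proof (induction k)
    case (Suc k)
    have "5 * (t + k) * n \<le> 5 * (t + Suc k) * n" by simp
    then have "2 ^ k * real (card (?N t)) \<le> real (card (?N (t + k)))"
      using Suc order_trans by blast
    moreover have "2 * real (card (?N (t + k))) \<le> real (card (?N (Suc (t + k))))"
      by (rule edge_count_step[OF n I A]) (use Suc in simp)
    ultimately show ?case by simp
  qed simp
  have un: "{E \<in> digraphs n d. card (E \<inter> (I \<times> A)) \<le> T} = (\<Union>t\<le>T. ?N t)" by auto
  have "2 ^ q * real (card {E \<in> digraphs n d. card (E \<inter> (I \<times> A)) \<le> T})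
    = (\<Sum>t\<le>T. 2 ^ q * real (card (?N t)))"
    unfolding un by (subst card_UN_disjoint) (auto simp: sum_distrib_left)
  also have "\<dots> \<le> (\<Sum>t\<le>T. real (card (?N (t + q))))"
  proof (rule sum_mono)
    fix t assume "t \<in> {..T}"
    then have "5 * (t + q) * n \<le> 5 * (T + q) * n" by simp
    then show "2 ^ q * real (card (?N t)) \<le> real (card (?N (t + q)))"
      by (intro step) (use q in linarith)
  qed
  also have "\<dots> = real (card (\<Union>t\<le>T. ?N (t + q)))"
    by (subst card_UN_disjoint) auto
  also have "\<dots> \<le> real (card (digraphs n d))"
    by (intro of_nat_mono card_mono) auto
  finally show "real (card {E \<in> digraphs n d. card (E \<inter> (I \<times> A)) \<le> T}) \<le> 1 / 2 ^ q * real (card (digraphs n d))"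
    by (simp add: field_simps)
qed simp

subsection \<open>Resampling a pair of rows\<close>

text \<open>Empty when \<open>S\<close> has odd size. For two rows of equal degree the halves of
  their symmetric difference are the possible values of \<open>outs E i - outs E j\<close>.\<close>

definition halves :: "'a set \<Rightarrow> 'a set set" where
  "halves S = {T. T \<subseteq> S \<and> 2 * card T = card S}"

definition dif :: "(nat \<times> nat) set \<Rightarrow> nat \<Rightarrow> nat \<Rightarrow> nat set" where
  "dif E i j = (outs E i - outs E j) \<union> (outs E j - outs E i)"

text \<open>\<open>T\<close> is the part that row i receives and row j does not. For
  \<open>T\<close> a half of \<open>dif E i j\<close>, all degrees and the sum of the two rows are
  unchanged.\<close>

definition put :: "(nat \<times> nat) set \<Rightarrow> nat \<Rightarrow> nat \<Rightarrow> nat set \<Rightarrow> (nat \<times> nat) set" where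
  "put E i j T = E - {i, j} \<times> UNIV \<union> {i} \<times> (outs E i \<inter> outs E j \<union> T)
     \<union> {j} \<times> (outs E i \<inter> outs E j \<union> (dif E i j - T))"

lemma finite_halves: "finite S \<Longrightarrow> finite (halves S)"
  by (rule finite_subset[of _ "Pow S"]) (auto simp: halves_def)

lemma finite_dif: "E \<in> digraphs n d \<Longrightarrow> finite (dif E i j)"
  by (simp add: dif_def finite_outs)

lemma outs_put:
  assumes "i \<noteq> j"
  shows "outs (put E i j T) k = (if k = i then outs E i \<inter> outs E j \<union> T
    else if k = j then outs E i \<inter> outs E j \<union> (dif E i j - T) else outs E k)"
  using assms by (auto simp: put_def)

lemma ins_put:
  assumes "i \<noteq> j" "T \<subseteq> dif E i j"
  shows "ins (put E i j T) k = (if k \<in> dif E i j then ins E k - {i, j} \<union> {if k \<in> T then i else j} else ins E k)"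
  using assms by (auto simp: put_def dif_def)

lemma card_dif:
  assumes E: "E \<in> digraphs n d" and "i < n" "j < n"
  shows "card (dif E i j) = 2 * card (outs E i - outs E j)"
    "card (outs E i \<inter> outs E j) + card (outs E i - outs E j) = d"
proof -
  note fin = finite_outs[OF E]
  have "card (outs E i - outs E j) + card (outs E i \<inter> outs E j) = d"
    using card_Diff_subset_Int[of "outs E i" "outs E j"] card_outs[OF E] assms fin
      card_mono[of "outs E i" "outs E i \<inter> outs E j"] by simp
  moreover have "card (outs E j - outs E i) + card (outs E i \<inter> outs E j) = d"
    using card_Diff_subset_Int[of "outs E j" "outs E i"] card_outs[OF E] assms fin
      card_mono[of "outs E j" "outs E i \<inter> outs E j"] by (simp add: Int_commute)
  moreover have "card (dif E i j) = card (outs E i - outs E j) + card (outs E j - outs E i)"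
    unfolding dif_def by (rule card_Un_disjoint) (use fin in auto)
  ultimately show "card (dif E i j) = 2 * card (outs E i - outs E j)"
    "card (outs E i \<inter> outs E j) + card (outs E i - outs E j) = d" by simp_all
qed

lemma put_self:
  assumes "E \<in> digraphs n d" "i < n" "j < n"
  shows "outs E i - outs E j \<in> halves (dif E i j)" "put E i j (outs E i - outs E j) = E"
  using card_dif[OF assms] by (auto simp: halves_def dif_def put_def)

lemma put_in_digraphs:
  assumes E: "E \<in> digraphs n d" and ij: "i < n" "j < n" "i \<noteq> j" and T: "T \<in> halves (dif E i j)"
  shows "put E i j T \<in> digraphs n d"
proof -
  have TS: "T \<subseteq> dif E i j" "2 * card T = card (dif E i j)" using T by (auto simp: halves_def)
  have finS: "finite (dif E i j)" by (rule finite_dif[OF E])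
  have finT: "finite T" using TS finS finite_subset by blast
  note fin = finite_outs[OF E]
  have cT: "card T = card (outs E i - outs E j)" "card (dif E i j - T) = card (outs E i - outs E j)"
    using TS card_dif(1)[OF E ij(1,2)] card_Diff_subset[OF finT TS(1)] by simp_all
  have "card (outs (put E i j T) k) = d" if "k < n" for k
  proof -
    have "card (outs E i \<inter> outs E j \<union> T) = d"
      by (subst card_Un_disjoint) (use fin finT cT TS(1) card_dif(2)[OF E ij(1,2)] in \<open>auto simp: dif_def\<close>)
    moreover have "card (outs E i \<inter> outs E j \<union> (dif E i j - T)) = d"
      by (subst card_Un_disjoint) (use fin finS cT card_dif(2)[OF E ij(1,2)] in \<open>auto simp: dif_def\<close>)
    ultimately show ?thesis using that ij card_outs[OF E] by (simp add: outs_put)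
  qed
  moreover have "card (ins (put E i j T) k) = d" if k: "k < n" for k
  proof (cases "k \<in> dif E i j")
    case True
    define p q where "p = (if k \<in> outs E i then i else j)" and "q = (if k \<in> T then i else j)"
    have p: "p \<in> ins E k" "ins E k - {i, j} = ins E k - {p}" using True by (auto simp: p_def dif_def)
    have "ins (put E i j T) k = insert q (ins E k - {p})"
      using True p ins_put[OF ij(3) TS(1)] by (simp add: q_def)
    moreover have "q \<notin> ins E k - {p}" unfolding p(2)[symmetric] by (simp add: q_def)
    ultimately have "card (ins (put E i j T) k) = Suc (card (ins E k - {p}))"
      using finite_ins[OF E] by simp
    also have "\<dots> = card (ins E k)" using p(1) finite_ins[OF E] by (rule card_Suc_Diff1[rotated])
    finally show ?thesis using card_ins[OF E k] by simp
  qed (simp add: ins_put[OF ij(3) TS(1)] card_ins[OF E k])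
  moreover have "put E i j T \<subseteq> {..<n} \<times> {..<n}"
  proof -
    have "T \<subseteq> {..<n}" "dif E i j \<subseteq> {..<n}" "outs E i \<subseteq> {..<n}"
      using TS(1) outs_subset[OF E] by (auto simp: dif_def subset_iff)
    then show ?thesis using digraphs_subset[OF E] ij(1,2) unfolding put_def by blast
  qed
  ultimately show ?thesis by (simp add: digraphs_def)
qed

lemma dif_put:
  assumes "i \<noteq> j" "T \<subseteq> dif E i j"
  shows "dif (put E i j T) i j = dif E i j"
    "outs (put E i j T) i \<inter> outs (put E i j T) j = outs E i \<inter> outs E j"
    "outs (put E i j T) i - outs (put E i j T) j = T"
proof -
  show "outs (put E i j T) i \<inter> outs (put E i j T) j = outs E i \<inter> outs E j"
    "outs (put E i j T) i - outs (put E i j T) j = T"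
    using assms by (auto simp: outs_put dif_def)
  show "dif (put E i j T) i j = dif E i j"
    unfolding dif_def[of "put E i j T"] outs_put[OF assms(1)] using assms by (auto simp: dif_def)
qed

lemma put_put:
  assumes "i \<noteq> j" "T \<subseteq> dif E i j"
  shows "put (put E i j T) i j U = put E i j U"
proof -
  have "put E i j T - {i, j} \<times> UNIV = E - {i, j} \<times> UNIV" by (auto simp: put_def)
  then show ?thesis unfolding put_def[of "put E i j T"] dif_put[OF assms] by (simp add: put_def[of E])
qed

text \<open>The orbits under \<open>put\<close> partition \<open>H\<close>, and each is a bijective
  image of the halves of its symmetric difference; a bound for a uniform half in every orbit
  therefore averages. A general \<open>H\<close> permits successive conditioning on several
  pairs.\<close>

lemma resampling:
  fixes \<theta> :: real
  assumes ij: "i < n" "j < n" "i \<noteq> j" and H: "B \<subseteq> H" "H \<subseteq> digraphs n d"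
    and closed: "\<And>E T. E \<in> H \<Longrightarrow> T \<in> halves (dif E i j) \<Longrightarrow> put E i j T \<in> H"
    and \<theta>: "\<And>E. E \<in> H \<Longrightarrow> real (card {T \<in> halves (dif E i j). put E i j T \<in> B})
      \<le> \<theta> * real (card (halves (dif E i j)))"
  shows "real (card B) \<le> \<theta> * real (card H)"
proof -
  define orb where "orb E = put E i j ` halves (dif E i j)" for E
  have finH: "finite H" by (rule finite_subset[OF H(2)]) simp
  then have finB: "finite B" using H(1) finite_subset by blast
  have orb_eq: "orb E' = orb E" if "E' \<in> orb E" for E E'
    using that ij(3) by (auto simp: orb_def halves_def dif_put put_put)
  have self: "E \<in> orb E" if "E \<in> H" for E
    using put_self[of E n d i j] that H(2) ij by (force simp: orb_def)
  have fibre: "{E' \<in> H. orb E' = orb E} = orb E" if "E \<in> H" for E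
  proof
    show "{E' \<in> H. orb E' = orb E} \<subseteq> orb E" using self by auto
    show "orb E \<subseteq> {E' \<in> H. orb E' = orb E}"
      using orb_eq[of _ E] closed[OF that] by (auto simp: orb_def)
  qed
  have inj: "inj_on (put E i j) (halves (dif E i j))" for E
    by (rule inj_on_inverseI[where g = "\<lambda>E. outs E i - outs E j"]) (use ij in \<open>simp add: dif_put halves_def\<close>)
  have card_orb: "card (orb E) = card (halves (dif E i j))" for E
    unfolding orb_def by (rule card_image[OF inj])
  have card_bad: "card {E' \<in> B. orb E' = orb E} = card {T \<in> halves (dif E i j). put E i j T \<in> B}"
    if "E \<in> H" for E
  proof -
    have "{E' \<in> B. orb E' = orb E} = {E' \<in> H. orb E' = orb E} \<inter> B" using H(1) by auto
    also have "\<dots> = put E i j ` {T \<in> halves (dif E i j). put E i j T \<in> B}"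
      unfolding fibre[OF that] by (auto simp: orb_def)
    also have "card \<dots> = card {T \<in> halves (dif E i j). put E i j T \<in> B}"
      by (rule card_image) (rule inj_on_subset[OF inj], auto)
    finally show ?thesis .
  qed
  have "real (card B) = (\<Sum>w\<in>orb ` H. \<Sum>E'\<in>{E' \<in> B. orb E' = w}. 1)"
    by (subst sum.group) (use H finH finB in auto)
  also have "\<dots> = (\<Sum>w\<in>orb ` H. real (card {E' \<in> B. orb E' = w}))" by simp
  also have "\<dots> \<le> (\<Sum>w\<in>orb ` H. \<theta> * real (card {E' \<in> H. orb E' = w}))"
    by (rule sum_mono) (auto simp: card_bad fibre card_orb \<theta>)
  also have "\<dots> = \<theta> * (\<Sum>w\<in>orb ` H. \<Sum>E'\<in>{E' \<in> H. orb E' = w}. 1)" by (simp add: sum_distrib_left)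
  also have "(\<Sum>w\<in>orb ` H. \<Sum>E'\<in>{E' \<in> H. orb E' = w}. (1::real)) = real (card H)"
    by (subst sum.group) (use finH in auto)
  finally show ?thesis .
qed

subsection \<open>Anti-concentration of the sum over a random half\<close>

lemma card_halves:
  assumes "finite S" "card S = 2 * h"
  shows "card (halves S) = (2 * h) choose h"
proof -
  have "halves S = {T. T \<subseteq> S \<and> card T = h}" using assms by (auto simp: halves_def)
  then show ?thesis using n_subsets[OF assms(1), of h] assms(2) by simp
qed

lemma central_binomial_step: "Suc h * ((2 * Suc h) choose Suc h) = 2 * (2 * h + 1) * ((2 * h) choose h)"
proof -
  have "Suc h * ((2 * Suc h) choose Suc h) = (2 * Suc h) * ((2 * h + 1) choose h)"
    using binomial_absorption[of h "2 * Suc h"] by simp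
  also have "(2 * h + 1) choose h = (2 * h + 1) choose (Suc h)"
    using binomial_symmetric[of h "2 * h + 1"] by simp
  also have "(2 * Suc h) * ((2 * h + 1) choose Suc h) = 2 * (Suc h * ((2 * h + 1) choose Suc h))" by simp
  also have "Suc h * ((2 * h + 1) choose Suc h) = (2 * h + 1) * ((2 * h) choose h)"
    using binomial_absorption[of h "2 * h + 1"] by simp
  finally show ?thesis by simp
qed

text \<open>Squares keep the estimate among the naturals. By \<open>central_binomial_step\<close>
  the induction reduces to (2h + 1)(2h + 3) <= 4 (h + 1)^2; the lower bound below reduces to 4 h (h
  + 1) <= (2h + 1)^2.\<close>

lemma central_binomial_upper: "((2 * h) choose h)\<^sup>2 * (2 * h + 1) \<le> 16 ^ h"
proof (induction h)
  case (Suc h)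
  let ?c = "(2 * h) choose h" and ?c' = "(2 * Suc h) choose Suc h"
  have "(Suc h)\<^sup>2 * (?c'\<^sup>2 * (2 * Suc h + 1)) = (Suc h * ?c')\<^sup>2 * (2 * Suc h + 1)"
    by (simp only: power_mult_distrib mult_ac)
  also have "\<dots> = (?c\<^sup>2 * (2 * h + 1)) * (4 * ((2 * h + 1) * (2 * h + 3)))"
    unfolding central_binomial_step by (simp add: power2_eq_square algebra_simps)
  also have "\<dots> \<le> 16 ^ h * (4 * ((2 * h + 1) * (2 * h + 3)))"
    by (rule mult_right_mono[OF Suc]) simp
  also have "\<dots> \<le> 16 ^ h * (16 * (Suc h)\<^sup>2)"
    by (rule mult_left_mono) (simp_all add: power2_eq_square algebra_simps)
  finally have "(Suc h)\<^sup>2 * (?c'\<^sup>2 * (2 * Suc h + 1)) \<le> (Suc h)\<^sup>2 * 16 ^ Suc h"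
    by (simp only: power_Suc mult_ac)
  then show ?case by (simp only: mult_le_cancel1) simp
qed simp

lemma central_binomial_lower: "0 < h \<Longrightarrow> 16 ^ h \<le> ((2 * h) choose h)\<^sup>2 * (4 * h)"
proof (induction h)
  case (Suc h)
  let ?c = "(2 * h) choose h" and ?c' = "(2 * Suc h) choose Suc h"
  show ?case
  proof (cases "h = 0")
    case False
    have "(Suc h)\<^sup>2 * 16 ^ Suc h = 16 * (Suc h)\<^sup>2 * 16 ^ h" by simp
    also have "\<dots> \<le> 16 * (Suc h)\<^sup>2 * (?c\<^sup>2 * (4 * h))"
      by (rule mult_left_mono) (use Suc False in auto)
    also have "\<dots> = ?c\<^sup>2 * (4 * Suc h) * (16 * (h * Suc h))" by (simp add: power2_eq_square algebra_simps)
    also have "\<dots> \<le> ?c\<^sup>2 * (4 * Suc h) * (2 * (2 * h + 1))\<^sup>2"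
      by (rule mult_left_mono) (simp_all add: power2_eq_square algebra_simps)
    also have "\<dots> = (Suc h * ?c')\<^sup>2 * (4 * Suc h)"
      unfolding central_binomial_step by (simp only: power_mult_distrib mult_ac)
    finally have "(Suc h)\<^sup>2 * 16 ^ Suc h \<le> (Suc h)\<^sup>2 * (?c'\<^sup>2 * (4 * Suc h))"
      by (simp only: power_mult_distrib mult_ac)
    then show ?thesis by (simp only: mult_le_cancel1) simp
  qed simp
qed simp

text \<open>An odd n = 2h + 1 reduces to the even case, since the central binomial of 2h + 2 is
  twice \<open>n choose h\<close>.\<close>

lemma middle_binomial_upper: "(n choose (n div 2))\<^sup>2 * (n + 1) \<le> 4 ^ n"
proof (cases "even n")
  case True
  then obtain h where "n = 2 * h" by (elim evenE)
  then show ?thesis using central_binomial_upper[of h] by (simp add: power_mult)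
next
  case False
  then obtain h where n: "n = 2 * h + 1" by (elim oddE)
  have s: "(2 * h + 1) choose h = (2 * h + 1) choose (Suc h)"
    using binomial_symmetric[of h "2 * h + 1"] by simp
  have "(2 * Suc h) choose Suc h = 2 * (n choose h)"
    unfolding n using s by simp
  then have "(2 * (n choose h))\<^sup>2 * (2 * Suc h + 1) \<le> 16 ^ Suc h"
    using central_binomial_upper[of "Suc h"] by (simp only:)
  moreover have "16 ^ Suc h = 4 * (4::nat) ^ n" by (simp add: n power_mult)
  ultimately have "4 * ((n choose h)\<^sup>2 * (2 * Suc h + 1)) \<le> 4 * 4 ^ n"
    by (simp only: power_mult_distrib) simp
  then have "(n choose h)\<^sup>2 * (2 * Suc h + 1) \<le> 4 ^ n" by simp
  moreover have "(n choose h)\<^sup>2 * (n + 1) \<le> (n choose h)\<^sup>2 * (2 * Suc h + 1)"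
    by (rule mult_left_mono) (simp_all add: n)
  moreover have "n div 2 = h" by (simp add: n)
  ultimately show ?thesis by simp
qed

text \<open>Roughly 2^a / sqrt a * 2^b / sqrt b against 4^h / (2 sqrt h): the larger of a and b is
  at least h, the smaller at least k, and 2 / sqrt k remains.\<close>

lemma middle_binomials_le:
  fixes k :: real
  assumes ab: "a + b = 2 * h" and k: "0 < k" "k \<le> real a" "k \<le> real b"
  shows "real ((a choose (a div 2)) * (b choose (b div 2))) \<le> 2 / sqrt k * real ((2 * h) choose h)"
proof -
  let ?A = "real (a choose (a div 2))" and ?B = "real (b choose (b div 2))" and ?C = "real ((2 * h) choose h)"
  have h: "0 < h" using k ab by (cases h) auto
  have A: "?A\<^sup>2 * (real a + 1) \<le> 4 ^ a"
    using of_nat_mono[OF middle_binomial_upper[of a], where 'a = real]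
    by (simp only: of_nat_mult of_nat_power of_nat_add of_nat_1 of_nat_numeral)
  have B: "?B\<^sup>2 * (real b + 1) \<le> 4 ^ b"
    using of_nat_mono[OF middle_binomial_upper[of b], where 'a = real]
    by (simp only: of_nat_mult of_nat_power of_nat_add of_nat_1 of_nat_numeral)
  have C: "16 ^ h \<le> ?C\<^sup>2 * (4 * real h)"
    using of_nat_mono[OF central_binomial_lower[OF h], where 'a = real]
    by (simp only: of_nat_mult of_nat_power of_nat_numeral)
  have kh: "k * real h \<le> (real a + 1) * (real b + 1)"
  proof (cases "a \<le> b")
    case True
    then have "real h \<le> real b + 1" using ab by linarith
    then show ?thesis by (intro mult_mono) (use k in auto)
  next
    case False
    then have "real h \<le> real a + 1" using ab by linarith
    then have "real h * k \<le> (real a + 1) * (real b + 1)" by (intro mult_mono) (use k in auto)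
    then show ?thesis by (simp add: mult.commute)
  qed
  have "(?A * ?B)\<^sup>2 * (k * real h) \<le> (?A * ?B)\<^sup>2 * ((real a + 1) * (real b + 1))"
    by (rule mult_left_mono[OF kh]) simp
  also have "\<dots> = (?A\<^sup>2 * (real a + 1)) * (?B\<^sup>2 * (real b + 1))" by (simp add: power_mult_distrib)
  also have "\<dots> \<le> 4 ^ a * 4 ^ b" by (intro mult_mono A B) auto
  also have "\<dots> = 16 ^ h" by (simp add: ab power_mult flip: power_add)
  also note C
  finally have "((?A * ?B)\<^sup>2 * k) * real h \<le> (?C\<^sup>2 * 4) * real h" by (simp add: mult_ac)
  then have "(?A * ?B)\<^sup>2 * k \<le> ?C\<^sup>2 * 4" using h by simp
  then have "(?A * ?B)\<^sup>2 \<le> (2 / sqrt k * ?C)\<^sup>2"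
    using k by (simp add: power_mult_distrib power_divide field_simps)
  then have "?A * ?B \<le> 2 / sqrt k * ?C"
    by (rule power2_le_imp_le) (use k in auto)
  then show ?thesis by simp
qed

lemma sum_less_of_separated:
  fixes x :: "'a \<Rightarrow> real"
  assumes "finite P" "finite Q" "card P = card Q" "P \<noteq> {}" "\<And>p q. p \<in> P \<Longrightarrow> q \<in> Q \<Longrightarrow> x q < x p"
  shows "sum x Q < sum x P"
proof -
  obtain g where g: "bij_betw g P Q" using finite_same_card_bij[OF assms(1-3)] by blast
  then have "sum x Q = (\<Sum>p\<in>P. x (g p))" by (simp add: sum.reindex_bij_betw)
  also have "\<dots> < sum x P"
    by (rule sum_strict_mono) (use assms g in \<open>auto simp: bij_betw_def\<close>)
  finally show ?thesis .
qed

text \<open>Equal-sum halves form an antichain for the order in which one moves from $Q$ to $P$; the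
  bound is the LYM inequality for the chains given by a pair of orderings of $P$ and $Q$.\<close>

lemma card_halves_fixed_sum:
  fixes x :: "'a \<Rightarrow> real"
  assumes fin: "finite P" "finite Q" and disj: "P \<inter> Q = {}"
    and sep: "\<And>p q. p \<in> P \<Longrightarrow> q \<in> Q \<Longrightarrow> x q < x p"
  shows "card {T \<in> halves (P \<union> Q). sum x T = c}
    \<le> (card P choose (card P div 2)) * (card Q choose (card Q div 2))"
proof -
  define F where "F = {T \<in> halves (P \<union> Q). sum x T = c}"
  have FD: "T \<subseteq> P \<union> Q" "2 * card T = card (P \<union> Q)" "sum x T = c" "finite T" if "T \<in> F" for T
    using that fin finite_subset[of T "P \<union> Q"] by (auto simp: F_def halves_def)
  have finF: "finite F" using fin by (simp add: F_def finite_halves)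
  \<comment> \<open>The hypotheses place T' - T inside \<open>P\<close> and T - T' inside
    \<open>Q\<close>. They have equal size, so if nonempty the first would have the larger sum,
    although T and T' have the same sum.\<close>
  have anti: "T = T'" if T: "T \<in> F" "T' \<in> F" and sub: "T \<inter> P \<subseteq> T'" "T' \<inter> Q \<subseteq> T" for T T'
  proof -
    note f = FD[OF T(1)] FD[OF T(2)]
    have c: "card (T' - T) = card (T - T')"
      using f card_Diff_subset_Int[of T T'] card_Diff_subset_Int[of T' T] by (simp add: Int_commute)
    have s: "sum x (T' - T) = sum x (T - T')"
      using f sum.Int_Diff[of T x T'] sum.Int_Diff[of T' x T] by (simp add: Int_commute)
    have "T' - T = {}"
    proof (rule ccontr)
      assume "T' - T \<noteq> {}"
      then have "sum x (T - T') < sum x (T' - T)"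
        by (intro sum_less_of_separated) (use f c sub in \<open>auto intro!: sep\<close>)
      then show False using s by simp
    qed
    with c have "T - T' = {}" using f by simp
    then show ?thesis using \<open>T' - T = {}\<close> by blast
  qed
  \<comment> \<open>Pairs of orderings of \<open>P\<close> and \<open>Q\<close>, as lists cut in
    two, that begin with the elements of \<open>T\<close>.\<close>
  define W where "W T = (permutations_of_set (T \<inter> P) \<times> permutations_of_set (P - T))
      \<times> (permutations_of_set (T \<inter> Q) \<times> permutations_of_set (Q - T))" for T
  define f where "f = (\<lambda>(T :: 'a set, (a :: 'a list, b), (c :: 'a list, e)). (a @ b, c @ e))"
  have inj: "inj_on f (Sigma F W)"
  proof (rule inj_onI)
    fix w w' assume w: "w \<in> Sigma F W" "w' \<in> Sigma F W" and eq: "f w = f w'"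
    obtain T a b c e where w1: "w = (T, (a, b), (c, e))" by (metis prod.exhaust)
    obtain T' a' b' c' e' where w2: "w' = (T', (a', b'), (c', e'))" by (metis prod.exhaust)
    have T: "T \<in> F" "T' \<in> F" using w w1 w2 by auto
    note g = FD[OF T(1)] FD[OF T(2)]
    have sets: "set a = T \<inter> P" "set b = P - T" "set c = T \<inter> Q" "set e = Q - T"
      "set a' = T' \<inter> P" "set b' = P - T'" "set c' = T' \<inter> Q" "set e' = Q - T'"
      and dist: "distinct a" "distinct c" "distinct a'" "distinct c'"
      using w w1 w2 by (auto simp: W_def permutations_of_set_def)
    have len: "length a = card (T \<inter> P)" "length c = card (T \<inter> Q)"
      "length a' = card (T' \<inter> P)" "length c' = card (T' \<inter> Q)"
      using sets dist by (metis distinct_card)+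
    have cut: "card U = card (U \<inter> P) + card (U \<inter> Q)" if "U \<subseteq> P \<union> Q" for U
    proof -
      have "U = (U \<inter> P) \<union> (U \<inter> Q)" using that by blast
      then have "card U = card ((U \<inter> P) \<union> (U \<inter> Q))" by simp
      also have "\<dots> = card (U \<inter> P) + card (U \<inter> Q)"
        by (rule card_Un_disjoint) (use fin disj in auto)
      finally show ?thesis .
    qed
    have lens: "length a + length c = length a' + length c'"
      using cut[OF g(1)] cut[OF g(5)] g(2,6) len by simp
    have pre: "set xs \<subseteq> set xs'" if "xs @ ys = xs' @ ys'" "length xs \<le> length xs'"
      for xs ys xs' ys' :: "'a list"
      using that by (metis append_eq_append_conv_if set_take_subset)
    have eqs: "a @ b = a' @ b'" "c @ e = c' @ e'" using eq by (simp_all add: f_def w1 w2)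
    \<comment> \<open>Halves have equal size, so the one with the longer prefix in \<open>P\<close>
      has the shorter one in \<open>Q\<close>. Prefixes of a common ordering are nested, and
      \<open>anti\<close> applies.\<close>
    have "T = T'"
    proof (cases "length a \<le> length a'")
      case True
      then have "set a \<subseteq> set a'" "set c' \<subseteq> set c"
        using pre[OF eqs(1)] pre[OF eqs(2)[symmetric]] lens by simp_all
      then show ?thesis using sets anti[OF T] by auto
    next
      case False
      then have "set a' \<subseteq> set a" "set c \<subseteq> set c'"
        using pre[OF eqs(1)[symmetric]] pre[OF eqs(2)] lens by simp_all
      then show ?thesis using sets anti[OF T(2,1)] by auto
    qed
    moreover then have "a = a'" "b = b'" "c = c'" "e = e'" using eqs len by simp_all
    ultimately show "w = w'" by (simp add: w1 w2)
  qed
  have "f ` Sigma F W \<subseteq> permutations_of_set P \<times> permutations_of_set Q"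
    by (auto simp: f_def W_def permutations_of_set_def)
  then have le: "card (Sigma F W) \<le> fact (card P) * fact (card Q)"
    using card_inj_on_le[OF inj, of "permutations_of_set P \<times> permutations_of_set Q"] fin
    by (simp add: card_cartesian_product)
  let ?a = "card P choose (card P div 2)" and ?b = "card Q choose (card Q div 2)"
  have W: "fact (card P) * fact (card Q) \<le> ?a * ?b * card (W T)" if "T \<in> F" for T
  proof -
    define u v where "u = card (T \<inter> P)" and "v = card (T \<inter> Q)"
    have uv: "u \<le> card P" "v \<le> card Q" using fin by (simp_all add: u_def v_def card_mono)
    have "card (P - T) = card P - u" "card (Q - T) = card Q - v"
      using fin by (simp_all add: u_def v_def card_Diff_subset_Int Int_commute)
    then have cW: "card (W T) = (fact u * fact (card P - u)) * (fact v * fact (card Q - v))"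
      using fin by (simp add: W_def card_cartesian_product u_def v_def)
    have "(card P choose u) * (fact u * fact (card P - u)) = fact (card P)"
      "(card Q choose v) * (fact v * fact (card Q - v)) = fact (card Q)"
      using binomial_fact_lemma[OF uv(1)] binomial_fact_lemma[OF uv(2)] by (simp_all add: mult_ac)
    then have "fact (card P) * fact (card Q) = ((card P choose u) * (fact u * fact (card P - u)))
        * ((card Q choose v) * (fact v * fact (card Q - v)))" by (simp only:)
    also have "\<dots> = (card P choose u) * (card Q choose v) * card (W T)"
      unfolding cW by (simp only: mult_ac)
    also have "\<dots> \<le> ?a * ?b * card (W T)"
      by (intro mult_mono binomial_maximum) auto
    finally show ?thesis .
  qed
  have "card F * (fact (card P) * fact (card Q)) = (\<Sum>T\<in>F. fact (card P) * fact (card Q))" by simp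
  also have "\<dots> \<le> (\<Sum>T\<in>F. ?a * ?b * card (W T))" by (rule sum_mono[OF W])
  also have "\<dots> = ?a * ?b * card (Sigma F W)"
    using finF fin by (simp add: sum_distrib_left W_def)
  also have "\<dots> \<le> ?a * ?b * (fact (card P) * fact (card Q))" using le by (rule mult_le_mono2)
  finally show ?thesis by (simp add: F_def)
qed

text \<open>Littlewood-Offord on a slice: the elements above \<open>t\<close> and those at most
  \<open>t\<close> are the two separated sets, each of size at least \<open>k\<close>.\<close>

lemma halves_fixed_sum_le:
  fixes x :: "'a \<Rightarrow> real" and k :: real
  assumes S: "finite S" and k: "0 < k" "k \<le> real (card {a \<in> S. t < x a})" "k \<le> real (card {a \<in> S. x a \<le> t})"
  shows "real (card {T \<in> halves S. sum x T = c}) \<le> 2 / sqrt k * real (card (halves S))"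
proof (cases "even (card S)")
  case True
  then obtain h where h: "card S = 2 * h" by (elim evenE)
  let ?P = "{a \<in> S. t < x a}" and ?Q = "{a \<in> S. x a \<le> t}"
  have un: "?P \<union> ?Q = S" by auto
  have "card ?P + card ?Q = card (?P \<union> ?Q)" by (rule card_Un_disjoint[symmetric]) (use S in auto)
  then have ab: "card ?P + card ?Q = 2 * h" by (simp add: un h)
  have "card {T \<in> halves (?P \<union> ?Q). sum x T = c}
    \<le> (card ?P choose (card ?P div 2)) * (card ?Q choose (card ?Q div 2))"
    by (rule card_halves_fixed_sum) (use S in auto)
  then have "real (card {T \<in> halves S. sum x T = c})
    \<le> real ((card ?P choose (card ?P div 2)) * (card ?Q choose (card ?Q div 2)))"
    unfolding un by (rule of_nat_mono)
  also have "\<dots> \<le> 2 / sqrt k * real ((2 * h) choose h)" by (rule middle_binomials_le[OF ab k])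
  finally show ?thesis using card_halves[OF S h] by simp
next
  case False
  then have "2 * card T \<noteq> card S" for T :: "'a set" by (metis dvd_triv_left)
  then have "halves S = {}" by (auto simp: halves_def)
  then show ?thesis by simp
qed

text \<open>Exchanging a for b changes the residue of the sum. So for each U of size g in S - {a,
  b}, one of \<open>insert a U\<close> and \<open>insert b U\<close> misses the prescribed residue.
  These misses are distinct and number \<open>(2 * g) choose g\<close>, at least a quarter of all
  halves.\<close>

lemma halves_fixed_residue_le:
  fixes z :: "'a \<Rightarrow> int"
  assumes S: "finite S" and ab: "a \<in> S" "b \<in> S" "\<not> m dvd z a - z b"
  shows "real (card {T \<in> halves S. m dvd sum z T - c}) \<le> 3 / 4 * real (card (halves S))"
proof (cases "even (card S)")
  case True
  then obtain h where h: "card S = 2 * h" by (elim evenE)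
  have ne: "a \<noteq> b" using ab(3) by auto
  have "card {a, b} \<le> card S" by (rule card_mono) (use S ab in auto)
  then obtain g where g: "h = Suc g" using ne h by (cases h) auto
  let ?B = "{T \<in> halves S. m dvd sum z T - c}" and ?R = "S - {a, b}"
  let ?U = "{U. U \<subseteq> ?R \<and> card U = g}"
  define f where "f U = (if m dvd sum z (insert a U) - c then insert b U else insert a U)" for U
  have fU: "f U \<in> halves S - ?B" if U: "U \<in> ?U" for U
  proof -
    have finU: "finite U" using U S finite_subset by blast
    have nin: "a \<notin> U" "b \<notin> U" using U by auto
    have s: "sum z (insert a U) = z a + sum z U" "sum z (insert b U) = z b + sum z U"
      using finU nin by simp_all
    have "\<not> (m dvd sum z (insert a U) - c \<and> m dvd sum z (insert b U) - c)"
    proof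
      assume "m dvd sum z (insert a U) - c \<and> m dvd sum z (insert b U) - c"
      then have "m dvd (sum z (insert a U) - c) - (sum z (insert b U) - c)" by (simp only: dvd_diff)
      then show False using ab(3) s by simp
    qed
    moreover have "card (insert a U) = h" "card (insert b U) = h" using nin g finU U by simp_all
    ultimately show ?thesis using U ab h by (auto simp: f_def halves_def)
  qed
  have "inj_on f ?U"
    by (rule inj_on_inverseI[where g = "\<lambda>T. T - {a, b}"]) (auto simp: f_def)
  then have "card ?U \<le> card (halves S - ?B)"
    by (rule card_inj_on_le) (use fU S in \<open>auto simp: finite_halves\<close>)
  moreover have "card (halves S - ?B) = card (halves S) - card ?B"
    by (rule card_Diff_subset) (use S in \<open>auto simp: finite_halves\<close>)
  moreover have "card ?B \<le> card (halves S)"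
    by (rule card_mono) (use S in \<open>auto simp: finite_halves\<close>)
  moreover have "card ?U = (2 * g) choose g"
  proof -
    have "card ?R = 2 * g" using S ab ne h g by (simp add: card_Diff_subset)
    then show ?thesis using n_subsets[of ?R g] S by simp
  qed
  moreover have "(2 * Suc g) choose Suc g \<le> 4 * ((2 * g) choose g)"
  proof -
    have "Suc g * ((2 * Suc g) choose Suc g) \<le> Suc g * (4 * ((2 * g) choose g))"
      unfolding central_binomial_step by (simp add: algebra_simps)
    then show ?thesis by (simp only: mult_le_cancel1)
  qed
  moreover have "card (halves S) = (2 * Suc g) choose Suc g" using card_halves[OF S h] g by simp
  ultimately have "card (halves S) \<le> 4 * (card (halves S) - card ?B)" "card ?B \<le> card (halves S)"
    by linarith+
  then show ?thesis by linarith
next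
  case False
  then have "2 * card T \<noteq> card S" for T :: "'a set" by (metis dvd_triv_left)
  then have "halves S = {}" by (auto simp: halves_def)
  then show ?thesis by simp
qed

subsection \<open>Expansion\<close>

text \<open>Union bound by size: the binomial factor in the assumption pays for the choice of
  \<open>J\<close>, and the geometric series of ratio x <= 1/2 is at most 2 x. The expansion lemmas
  are shaped to fit it.\<close>

lemma pr_subsets:
  assumes x: "0 \<le> x" "x \<le> 1 / 2"
    and P: "\<And>J. J \<subseteq> {..<n} \<Longrightarrow> J \<noteq> {} \<Longrightarrow> real (n choose card J) * pr n d (P J) \<le> x ^ card J"
  shows "pr n d (\<lambda>E. \<exists>J\<subseteq>{..<n}. J \<noteq> {} \<and> P J E) \<le> 2 * x"
proof -
  define S where "S s = {J. J \<subseteq> {..<n} \<and> card J = s}" for s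
  have finS: "finite (S s)" for s by (rule finite_subset[of _ "Pow {..<n}"]) (auto simp: S_def)
  have cS: "card (S s) = n choose s" for s using n_subsets[of "{..<n}" s] by (simp add: S_def)
  have "pr n d (\<lambda>E. \<exists>J\<subseteq>{..<n}. J \<noteq> {} \<and> P J E) \<le> pr n d (\<lambda>E. \<exists>s\<in>{1..n}. \<exists>J\<in>S s. P J E)"
  proof (rule pr_mono)
    fix E assume "\<exists>J\<subseteq>{..<n}. J \<noteq> {} \<and> P J E"
    then obtain J where J: "J \<subseteq> {..<n}" "J \<noteq> {}" "P J E" by blast
    then have "finite J" using finite_subset by blast
    then have "card J \<in> {1..n}" using J card_mono[OF _ J(1)] by (auto simp: Suc_le_eq card_gt_0_iff)
    then show "\<exists>s\<in>{1..n}. \<exists>J\<in>S s. P J E" using J by (auto simp: S_def)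
  qed
  also have "\<dots> \<le> (\<Sum>s\<in>{1..n}. pr n d (\<lambda>E. \<exists>J\<in>S s. P J E))" by (rule pr_Bex) simp
  also have "\<dots> \<le> (\<Sum>s\<in>{1..n}. x ^ s)"
  proof (rule sum_mono)
    fix s assume s: "s \<in> {1..n}"
    then have pos: "0 < real (n choose s)" by simp
    have "pr n d (\<lambda>E. \<exists>J\<in>S s. P J E) \<le> (\<Sum>J\<in>S s. pr n d (P J))" by (rule pr_Bex[OF finS])
    also have "\<dots> \<le> (\<Sum>J\<in>S s. x ^ s / real (n choose s))"
    proof (rule sum_mono)
      fix J assume J: "J \<in> S s"
      then have "J \<noteq> {}" using s by (auto simp: S_def)
      then have "real (n choose s) * pr n d (P J) \<le> x ^ s" using P[of J] J by (auto simp: S_def)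
      then show "pr n d (P J) \<le> x ^ s / real (n choose s)" using pos by (simp add: field_simps)
    qed
    also have "\<dots> = x ^ s" using pos by (simp add: cS)
    finally show "pr n d (\<lambda>E. \<exists>J\<in>S s. P J E) \<le> x ^ s" .
  qed
  also have "\<dots> \<le> 2 * x"
  proof -
    have "(\<Sum>s\<in>{1..n}. x ^ s) = (\<Sum>s<n. x * x ^ s)"
      by (rule sum.reindex_bij_witness[of _ Suc "\<lambda>s. s - 1"]) (auto simp flip: power_Suc)
    also have "\<dots> = x * ((1 - x ^ n) / (1 - x))"
      using x by (simp add: sum_distrib_left[symmetric] sum_gp_strict)
    also have "\<dots> \<le> x * 2"
    proof (rule mult_left_mono[OF _ x(1)])
      have "1 - x ^ n \<le> 1" using zero_le_power[OF x(1), of n] by simp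
      also have "1 \<le> 2 * (1 - x)" using x by simp
      finally have "1 - x ^ n \<le> 2 * (1 - x)" .
      then show "(1 - x ^ n) / (1 - x) \<le> 2" using x by (simp add: divide_le_eq)
    qed
    finally show ?thesis by simp
  qed
  finally show ?thesis .
qed

definition codeg :: "(nat \<times> nat) set \<Rightarrow> nat \<Rightarrow> nat \<Rightarrow> nat" where
  "codeg E i j = card (outs E i \<inter> outs E j)"

text \<open>The blocks are {(i, k), (j, k)}. The base in \<open>pr_many_blocks\<close> is 12 d^2 /
  (q n), at most 1/2 once q is 24 times d^2 / n.\<close>

lemma pr_codeg:
  assumes d: "0 < d" "8 * d \<le> n" and ij: "i \<noteq> j" and q: "0 < q" "q \<le> d" "24 * real d ^ 2 \<le> real q * real n"
  shows "pr n d (\<lambda>E. q \<le> codeg E i j) \<le> (1 / 2) ^ q"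
proof -
  have n: "0 < n" using d by simp
  have "pr n d (\<lambda>E. q \<le> codeg E i j) \<le> pr n d (\<lambda>E. q \<le> card {k \<in> {..<n}. {(i, k), (j, k)} \<subseteq> E})"
  proof (rule pr_mono)
    fix E assume E: "E \<in> digraphs n d" "q \<le> codeg E i j"
    have "outs E i \<inter> outs E j = {k \<in> {..<n}. {(i, k), (j, k)} \<subseteq> E}"
      using outs_subset[OF E(1), of i] by auto
    then show "q \<le> card {k \<in> {..<n}. {(i, k), (j, k)} \<subseteq> E}" using E by (simp add: codeg_def)
  qed
  also have "\<dots> \<le> (3 * real n / real q * (2 * real d / real n) ^ 2) ^ q"
  proof (rule pr_many_blocks[OF d])
    have "q * 8 \<le> d * n" by (rule mult_mono) (use q d in auto)
    then show "4 * (2 * q) \<le> n * d" by (simp add: mult.commute)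
  qed (use q ij in \<open>auto simp: disjoint_family_on_def\<close>)
  also have "\<dots> \<le> (1 / 2) ^ q"
    by (rule power_mono) (use q n in \<open>auto simp: power2_eq_square field_simps\<close>)
  finally show ?thesis .
qed

definition touched :: "(nat \<times> nat) set \<Rightarrow> nat set \<Rightarrow> nat set" where
  "touched E J = {i. outs E i \<inter> J \<noteq> {}}"

lemma touched_subset: "E \<in> digraphs n d \<Longrightarrow> touched E J \<subseteq> {..<n}"
  by (auto simp: touched_def dest: digraphs_lt)

lemma touchedI: "(i, j) \<in> E \<Longrightarrow> j \<in> J \<Longrightarrow> i \<in> touched E J"
  by (auto simp: touched_def)

text \<open>If \<open>J\<close> of size s touches few rows, all its d s edges start in one set of r
  = d s div 2 rows, a small part of all rows. Union bound over that set and over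
  \<open>J\<close>.\<close>

lemma pr_small_expansion:
  assumes d: "200000 \<le> d" and J: "J \<subseteq> {..<n}" "J \<noteq> {}" "card J * d\<^sup>2 \<le> n"
  shows "real (n choose card J) * pr n d (\<lambda>E. 2 * card (touched E J) \<le> d * card J) \<le> (1 / real d) ^ card J"
proof -
  define s where "s = card J"
  define r where "r = d * s div 2"
  \<comment> \<open>The number of edges entering \<open>J\<close>, relative to n; at most 1 /
    d.\<close>
  define u where "u = real d * real s / real n"
  have finJ: "finite J" using J(1) finite_subset by blast
  then have s: "1 \<le> s" using J(2) by (simp add: s_def Suc_le_eq card_gt_0_iff)
  have sd: "s * d\<^sup>2 \<le> n" using J(3) by (simp add: s_def)
  have dn: "8 * d \<le> n"
  proof -
    have "8 * d \<le> d * d" using d by simp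
    also have "\<dots> \<le> s * d\<^sup>2" using s by (simp add: power2_eq_square)
    finally show ?thesis using sd by simp
  qed
  have n: "0 < n" using dn d by simp
  have u0: "0 < u" using s n d by (simp add: u_def)
  have ud: "u * real d \<le> 1"
    using of_nat_mono[OF sd, where 'a = real] n by (simp add: u_def power2_eq_square field_simps)
  have u81: "81 * u \<le> 1"
  proof -
    have "81 * u \<le> real d * u" using d u0 by (intro mult_right_mono) auto
    then show ?thesis using ud by (simp add: mult.commute)
  qed
  have ds: "200000 * s \<le> d * s" using d by simp
  have r: "2 * r \<le> d * s" "d * s \<le> 3 * r" "5 * s \<le> r" "1 \<le> r"
    using ds s unfolding r_def by linarith+
  have rn: "r \<le> n"
  proof -
    have "r \<le> d * s" using r(1) by simp
    also have "\<dots> \<le> s * d\<^sup>2" by (simp add: power2_eq_square)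
    finally show ?thesis using sd by simp
  qed
  let ?R = "{I. I \<subseteq> {..<n} \<and> card I = r}"
  have finR: "finite ?R" by (rule finite_subset[of _ "Pow {..<n}"]) auto
  have "pr n d (\<lambda>E. 2 * card (touched E J) \<le> d * card J)
    \<le> pr n d (\<lambda>E. \<exists>I\<in>?R. d * s \<le> card (E \<inter> (I \<times> J)))"
  proof (rule pr_mono)
    fix E assume E: "E \<in> digraphs n d" "2 * card (touched E J) \<le> d * card J"
    have "card (touched E J) \<le> r" using E(2) by (simp add: r_def s_def)
    then obtain I where I: "touched E J \<subseteq> I" "I \<subseteq> {..<n}" "card I = r"
      using exists_subset_between[of "touched E J" r "{..<n}"] rn touched_subset[OF E(1)] by auto
    have "E \<inter> ({..<n} \<times> J) \<subseteq> E \<inter> (I \<times> J)" using I(1) touchedI by fastforce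
    then have "card (E \<inter> ({..<n} \<times> J)) \<le> card (E \<inter> (I \<times> J))"
      by (rule card_mono[rotated]) (use finite_digraph[OF E(1)] in simp)
    then show "\<exists>I\<in>?R. d * s \<le> card (E \<inter> (I \<times> J))"
      using card_edges_all_rows[OF E(1) J(1)] I by (auto simp: s_def)
  qed
  also have "\<dots> \<le> (\<Sum>I\<in>?R. pr n d (\<lambda>E. d * s \<le> card (E \<inter> (I \<times> J))))" by (rule pr_Bex[OF finR])
  also have "\<dots> \<le> (\<Sum>I\<in>?R. (3 * u) ^ (d * s))"
  proof (rule sum_mono)
    fix I assume I: "I \<in> ?R"
    then have finI: "finite I" using finite_subset by blast
    have "pr n d (\<lambda>E. d * s \<le> card (E \<inter> (I \<times> J)))
      \<le> (6 * (real r * real s) * real d / (real (d * s) * real n)) ^ (d * s)"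
    proof (rule pr_many_edges)
      have "2 * 2 \<le> d * d" by (rule mult_le_mono) (use d in auto)
      then have "s * 4 \<le> s * d\<^sup>2" by (simp add: power2_eq_square)
      then have "4 * s \<le> n" using sd by (metis le_trans mult.commute)
      then show "4 * (d * s) \<le> n * d" by simp
    qed (use I finI finJ d s dn in \<open>auto simp: s_def card_cartesian_product\<close>)
    also have "6 * (real r * real s) * real d / (real (d * s) * real n) = 6 * real r / real n"
      using d s by (simp add: field_simps)
    also have "(6 * real r / real n) ^ (d * s) \<le> (3 * u) ^ (d * s)"
    proof (rule power_mono)
      have "2 * real r \<le> real d * real s" using of_nat_mono[OF r(1), where 'a = real] by simp
      then show "6 * real r / real n \<le> 3 * u" using n by (simp add: u_def field_simps)
    qed simp
    finally show "pr n d (\<lambda>E. d * s \<le> card (E \<inter> (I \<times> J))) \<le> (3 * u) ^ (d * s)" .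
  qed
  also have "\<dots> = real (n choose r) * (3 * u) ^ (d * s)"
    using n_subsets[of "{..<n}" r] by simp
  \<comment> \<open>The row sets cost (9 / u)^r; half of the exponent 2 r pays for this and (81 u)^r
    is left.\<close>
  also have "\<dots> \<le> (9 / u) ^ r * (3 * u) ^ (2 * r)"
  proof (rule mult_mono)
    have "real (n choose r) \<le> (3 * real n / real r) ^ r" by (rule binomial_le_power) (use r in auto)
    also have "\<dots> \<le> (9 / u) ^ r"
    proof (rule power_mono)
      have "real d * real s \<le> 3 * real r" using of_nat_mono[OF r(2), where 'a = real] by simp
      then show "3 * real n / real r \<le> 9 / u" using n r(4) d s by (simp add: u_def field_simps)
    qed simp
    finally show "real (n choose r) \<le> (9 / u) ^ r" .
    show "(3 * u) ^ (d * s) \<le> (3 * u) ^ (2 * r)"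
      by (rule power_decreasing) (use r u0 u81 in auto)
  qed (use u0 in auto)
  also have "\<dots> = (81 * u) ^ r"
  proof -
    have "(9 / u) ^ r * (3 * u) ^ (2 * r) = ((9 / u) * (3 * u)\<^sup>2) ^ r"
      by (simp only: power_mult power_mult_distrib)
    also have "(9 / u) * (3 * u)\<^sup>2 = 81 * u" using u0 by (simp add: power2_eq_square)
    finally show ?thesis .
  qed
  \<comment> \<open>Five powers per element of \<open>J\<close>: one cancels the 1 / u in the cost
    of choosing \<open>J\<close>, the other four make d * u^4 at most d^(-3).\<close>
  also have "\<dots> \<le> (81 * u) ^ (5 * s)" by (rule power_decreasing) (use r u0 u81 in auto)
  finally have pr: "pr n d (\<lambda>E. 2 * card (touched E J) \<le> d * card J) \<le> (81 * u) ^ (5 * s)" .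
  have "real (n choose card J) * pr n d (\<lambda>E. 2 * card (touched E J) \<le> d * card J)
    \<le> (3 * real d / u) ^ s * (81 * u) ^ (5 * s)"
  proof (rule mult_mono[OF _ pr])
    have "real (n choose s) \<le> (3 * real n / real s) ^ s" by (rule binomial_le_power) (use s in auto)
    also have "3 * real n / real s = 3 * real d / u" using n d s by (simp add: u_def field_simps)
    finally show "real (n choose card J) \<le> (3 * real d / u) ^ s" by (simp add: s_def)
  qed (use u0 in auto)
  also have "\<dots> = ((3 * real d / u) * (81 * u) ^ 5) ^ s"
    by (simp only: power_mult power_mult_distrib)
  also have "\<dots> \<le> (1 / real d) ^ s"
  proof (rule power_mono)
    have d0: "0 < real d" using d by simp
    have "u ^ 5 = u ^ 4 * u" by (simp add: eval_nat_numeral)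
    then have eq: "(3 * real d / u) * (81 * u) ^ 5 = 3 * 81 ^ 5 * (real d * u ^ 4)"
      using u0 by (simp add: power_mult_distrib)
    have "3 * 81 ^ 5 \<le> (200000::real) * 200000" by simp
    also have "\<dots> \<le> real d * real d" by (rule mult_mono) (use d in auto)
    finally have "3 * 81 ^ 5 * (real d * u ^ 4 * real d) \<le> real d * real d * (real d * u ^ 4 * real d)"
      by (rule mult_right_mono) (use u0 in simp)
    also have "\<dots> = (u * real d) ^ 4" by (simp add: eval_nat_numeral)
    also have "\<dots> \<le> 1" using ud u0 by (intro power_le_one) auto
    finally have "3 * 81 ^ 5 * (real d * u ^ 4) * real d \<le> 1" by (simp only: mult.assoc)
    then show "(3 * real d / u) * (81 * u) ^ 5 \<le> 1 / real d"
      unfolding eq using d0 by (simp only: pos_le_divide_eq)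
  qed (use u0 in simp)
  finally show ?thesis by (simp add: s_def)
qed

text \<open>The numerical constants are chosen with no attempt at economy.\<close>

locale regime =
  fixes n d :: nat and L :: real
  assumes L: "L = ln (real d)" "10 ^ 6 \<le> L"
    and sparse: "1500 * (real d * L\<^sup>2) \<le> real n"
    and d_exp: "6 * real d ^ 3 \<le> exp (real d / 10)"
    and d_powr: "real d ^ 3 \<le> 2 powr (real d / (60 * L\<^sup>2))"
    and d_poly: "2000 * L ^ 4 \<le> real d"
begin

lemma exp_L: "exp L = real d"
  using L by (cases "d = 0") auto

lemma L_sq_le_d: "L\<^sup>2 \<le> 2 * real d"
  using exp_lower_Taylor_quadratic[of L] L(2) unfolding exp_L by simp

lemma d_ge: "400000 * L \<le> real d"
proof -
  have "10 ^ 6 * L \<le> L * L" by (rule mult_right_mono) (use L in auto)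
  also have "\<dots> \<le> 2 * real d" using L_sq_le_d by (simp add: power2_eq_square)
  finally show ?thesis using L(2) by simp
qed

lemma d_large: "200000 \<le> d"
proof -
  have "200000 \<le> real d" using d_ge L(2) by simp
  then show ?thesis by linarith
qed

lemma n_ge: "1500 * real d \<le> real n"
proof -
  have "1 \<le> L\<^sup>2" by (rule one_le_power) (use L in simp)
  then have "real d * 1 \<le> real d * L\<^sup>2" by (intro mult_left_mono) auto
  then show ?thesis using sparse by simp
qed

lemma n_ge': "1500 * d \<le> n"
  using n_ge by (metis of_nat_le_iff of_nat_mult of_nat_numeral)

text \<open>Rows are paired once and for all as 2p, 2p + 1, so that distinct pairs can be resampled
  without affecting each other. For odd n row n - 1 has no partner.\<close>

definition unequal_pairs :: "(nat \<times> nat) set \<Rightarrow> nat set \<Rightarrow> nat set" where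
  "unequal_pairs E J = {p. p < n div 2 \<and> outs E (2 * p) \<inter> J \<noteq> outs E (2 * p + 1) \<inter> J}"

text \<open>At most 3 s of these pairs will be lost, so at least 36 s L remain, and (3/4)^(36 s L)
  <= d^(-9 s) outweighs the choice of a support and of residues on it.\<close>

definition threshold :: "nat \<Rightarrow> nat" where
  "threshold s = nat \<lceil>40 * real s * L\<rceil>"

lemma threshold_bounds:
  assumes "1 \<le> s"
  shows "40 * real s * L \<le> real (threshold s)" "real (threshold s) \<le> 41 * real s * L" "1 \<le> threshold s"
proof -
  have "1 * 1 \<le> real s * L" by (rule mult_mono) (use assms L in auto)
  then show "40 * real s * L \<le> real (threshold s)" "real (threshold s) \<le> 41 * real s * L" "1 \<le> threshold s"
    unfolding threshold_def by linarith+
qed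

text \<open>An edge into \<open>J\<close> outside the listed rows lies in an equal pair and so has a
  twin in the partner row. Hence d |J| is at most the number of edges in the listed rows plus twice
  \<open>card ?Y\<close>.\<close>

lemma unequal_pairs_dichotomy:
  assumes E: "E \<in> digraphs n d" and J: "J \<subseteq> {..<n}"
    and Q: "unequal_pairs E J \<subseteq> Q" "Q \<subseteq> {..<n div 2}" and t: "4 * t \<le> d * card J" "0 < t"
  shows "t \<le> card (E \<inter> (((\<lambda>p. 2 * p) ` Q \<union> (\<lambda>p. 2 * p + 1) ` Q \<union> {n - 1}) \<times> J))
    \<or> t \<le> card {e \<in> {..<n div 2} \<times> J. {(2 * fst e, snd e), (2 * fst e + 1, snd e)} \<subseteq> E}"
    (is "t \<le> card (E \<inter> (?I \<times> J)) \<or> t \<le> card ?Y")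
proof -
  have finJ: "finite J" using J finite_subset by blast
  have finE: "finite E" by (rule finite_digraph[OF E])
  have finY: "finite ?Y" using finJ by simp
  let ?f = "\<lambda>e::nat \<times> nat. (2 * fst e, snd e)" and ?g = "\<lambda>e::nat \<times> nat. (2 * fst e + 1, snd e)"
  have "E \<inter> ({..<n} \<times> J) \<subseteq> E \<inter> (?I \<times> J) \<union> (?f ` ?Y \<union> ?g ` ?Y)"
  proof
    fix e assume e: "e \<in> E \<inter> ({..<n} \<times> J)"
    obtain i j where ij: "e = (i, j)" by (cases e)
    show "e \<in> E \<inter> (?I \<times> J) \<union> (?f ` ?Y \<union> ?g ` ?Y)"
    proof (cases "i \<in> ?I")
      case False
      define p where "p = i div 2"
      have ip: "i = 2 * p \<or> i = 2 * p + 1" by (auto simp: p_def)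
      \<comment> \<open>Every row before n - 1 has its partner below n, whatever the parity of
        n.\<close>
      have i: "i < n" "i \<noteq> n - 1" using e ij False by auto
      then have p: "p < n div 2" by (auto simp: p_def)
      have "p \<notin> Q" using False ip by auto
      then have "outs E (2 * p) \<inter> J = outs E (2 * p + 1) \<inter> J"
        using Q(1) p by (auto simp: unequal_pairs_def)
      then have "(2 * p, j) \<in> E \<and> (2 * p + 1, j) \<in> E" using e ij ip by auto
      then have "(p, j) \<in> ?Y" using e ij p by auto
      then have "?f (p, j) \<in> ?f ` ?Y" "?g (p, j) \<in> ?g ` ?Y" by (rule imageI)+
      then show ?thesis using ip ij by auto
    qed (use e ij in auto)
  qed
  then have "card (E \<inter> ({..<n} \<times> J)) \<le> card (E \<inter> (?I \<times> J) \<union> (?f ` ?Y \<union> ?g ` ?Y))"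
    by (rule card_mono[rotated]) (use finE finY in simp)
  also have "\<dots> \<le> card (E \<inter> (?I \<times> J)) + card (?f ` ?Y \<union> ?g ` ?Y)" by (rule card_Un_le)
  also have "card (?f ` ?Y \<union> ?g ` ?Y) \<le> card (?f ` ?Y) + card (?g ` ?Y)" by (rule card_Un_le)
  also have "card (?f ` ?Y) \<le> card ?Y" by (rule card_image_le[OF finY])
  also have "card (?g ` ?Y) \<le> card ?Y" by (rule card_image_le[OF finY])
  finally have "d * card J \<le> card (E \<inter> (?I \<times> J)) + (card ?Y + card ?Y)"
    using card_edges_all_rows[OF E J] by simp
  then show ?thesis using t by linarith
qed

text \<open>With too few unequal pairs, either at most 2 K + 1 rows receive a fifth of the d s edges
  or a comparable number of edges have twins. Each has probability at most exp (- d s / 10), against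
  at most (3 d^2)^s choices of \<open>J\<close> because s > n / d^2; \<open>d_exp\<close> is the
  resulting inequality.\<close>

lemma pr_mid_expansion:
  assumes J: "J \<subseteq> {..<n}" and mid: "n < card J * d\<^sup>2" "real (card J) * L\<^sup>2 \<le> real n"
  shows "real (n choose card J) * pr n d (\<lambda>E. card (unequal_pairs E J) < threshold (card J))
    \<le> (1 / real d) ^ card J"
proof -
  define s where "s = card J"
  define K where "K = threshold s"
  define t where "t = d * s div 4"
  \<comment> \<open>Bounds the base in \<open>pr_many_edges\<close>: at most 3 K rows and d s <= 5 t
    give 6 * 3 * 5 = 90.\<close>
  define v where "v = 90 * real K / real n"
  have finJ: "finite J" using J finite_subset by blast
  have s: "1 \<le> s" using mid(1) by (cases "s = 0") (auto simp: s_def)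
  note K = threshold_bounds[OF s, folded K_def]
  have n: "0 < n" and dpos: "0 < d" and dn: "8 * d \<le> n" using n_ge' d_large by auto
  have sL: "real s * L\<^sup>2 \<le> real n" using mid(2) by (simp add: s_def)
  have sn: "real s * L \<le> real n / 10 ^ 6"
  proof -
    have "real s * L * 10 ^ 6 \<le> real s * L * L" by (rule mult_left_mono) (use L in auto)
    then show ?thesis using sL by (simp add: power2_eq_square)
  qed
  have Kn: "24300 * real K \<le> real n" using K(2) sn by simp
  have KP: "K \<le> n div 2" using Kn by linarith
  have s4: "4 * s \<le> n"
  proof -
    have "real s * 1 \<le> real s * L" by (rule mult_left_mono) (use L in auto)
    then have "4 * real s \<le> real n" using sn by simp
    then show ?thesis by linarith
  qed
  have ds: "200000 * s \<le> d * s" using d_large by simp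
  have t: "4 * t \<le> d * s" "d * s \<le> 5 * t" "0 < t"
    using ds s unfolding t_def by linarith+
  have tr: "real d * real s \<le> 5 * real t" using of_nat_mono[OF t(2), where 'a = real] by simp
  have v: "0 < v" "270 * v \<le> 1" using K(3) n Kn by (auto simp: v_def field_simps)
  have tK: "real d * real s / 10 \<le> real t - 2 * real K"
  proof -
    have "820 * L \<le> real d" using d_ge L(2) by simp
    then have "820 * L * real s \<le> real d * real s" by (rule mult_right_mono) simp
    then have "820 * (real s * L) \<le> real d * real s" by (simp only: mult_ac)
    moreover have "real K \<le> 41 * (real s * L)" using K(2) by (simp only: mult.assoc)
    ultimately show ?thesis using tr by linarith
  qed
  have t2K: "2 * K \<le> t"
  proof -
    have "0 \<le> real d * real s / 10" by simp
    then show ?thesis using tK by linarith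
  qed
  define rows where "rows Q = (\<lambda>p. 2 * p) ` Q \<union> (\<lambda>p. 2 * p + 1) ` Q \<union> {n - 1}" for Q :: "nat set"
  define Y where "Y E = {e \<in> {..<n div 2} \<times> J. {(2 * fst e, snd e), (2 * fst e + 1, snd e)} \<subseteq> E}" for E
  let ?Q = "{Q. Q \<subseteq> {..<n div 2} \<and> card Q = K}"
  have finQ: "finite ?Q" by (rule finite_subset[of _ "Pow {..<n div 2}"]) auto
  have "pr n d (\<lambda>E. card (unequal_pairs E J) < threshold (card J))
    \<le> pr n d (\<lambda>E. (\<exists>Q\<in>?Q. t \<le> card (E \<inter> (rows Q \<times> J))) \<or> t \<le> card (Y E))"
  proof (rule pr_mono)
    fix E assume E: "E \<in> digraphs n d" "card (unequal_pairs E J) < threshold (card J)"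
    have "card (unequal_pairs E J) \<le> K" using E(2) by (simp add: K_def s_def)
    moreover have "unequal_pairs E J \<subseteq> {..<n div 2}" by (auto simp: unequal_pairs_def)
    ultimately obtain Q where Q: "unequal_pairs E J \<subseteq> Q" "Q \<subseteq> {..<n div 2}" "card Q = K"
      using exists_subset_between[of "unequal_pairs E J" K "{..<n div 2}"] KP by auto
    have "t \<le> card (E \<inter> (rows Q \<times> J)) \<or> t \<le> card (Y E)"
      unfolding rows_def Y_def
      by (rule unequal_pairs_dichotomy[OF E(1) J Q(1,2)]) (use t in \<open>auto simp: s_def\<close>)
    then show "(\<exists>Q\<in>?Q. t \<le> card (E \<inter> (rows Q \<times> J))) \<or> t \<le> card (Y E)" using Q by blast
  qed
  also have "\<dots> \<le> pr n d (\<lambda>E. \<exists>Q\<in>?Q. t \<le> card (E \<inter> (rows Q \<times> J))) + pr n d (\<lambda>E. t \<le> card (Y E))"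
    by (rule pr_disj)
  also have "pr n d (\<lambda>E. \<exists>Q\<in>?Q. t \<le> card (E \<inter> (rows Q \<times> J))) \<le> exp (- (real d * real s / 10))"
  proof -
    have "pr n d (\<lambda>E. \<exists>Q\<in>?Q. t \<le> card (E \<inter> (rows Q \<times> J)))
      \<le> (\<Sum>Q\<in>?Q. pr n d (\<lambda>E. t \<le> card (E \<inter> (rows Q \<times> J))))" by (rule pr_Bex[OF finQ])
    also have "\<dots> \<le> (\<Sum>Q\<in>?Q. v ^ t)"
    proof (rule sum_mono)
      fix Q assume Q: "Q \<in> ?Q"
      then have finQ: "finite Q" using finite_subset by blast
      have "card (rows Q) \<le> card ((\<lambda>p. 2 * p) ` Q) + card ((\<lambda>p. 2 * p + 1) ` Q) + card {n - 1}"
        unfolding rows_def by (intro order_trans[OF card_Un_le] add_mono order_refl)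
      also have "\<dots> \<le> 3 * K"
        using card_image_le[OF finQ, of "\<lambda>p. 2 * p"] card_image_le[OF finQ, of "\<lambda>p. 2 * p + 1"] Q K(3)
        by simp
      finally have "card (rows Q \<times> J) \<le> 3 * K * s"
        by (simp add: card_cartesian_product s_def mult_right_mono)
      then have cR: "real (card (rows Q \<times> J)) \<le> 3 * real K * real s"
        by (metis of_nat_le_iff of_nat_mult of_nat_numeral)
      have "pr n d (\<lambda>E. t \<le> card (E \<inter> (rows Q \<times> J)))
        \<le> (6 * (3 * real K * real s) * real d / (real t * real n)) ^ t"
      proof (rule pr_many_edges[OF dpos dn _ cR t(3)])
        have "4 * t \<le> d * s" by (rule t(1))
        also have "\<dots> \<le> n * d" using s4 by simp
        finally show "4 * t \<le> n * d" .
      qed (use finQ finJ in \<open>simp add: rows_def\<close>)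
      also have "\<dots> \<le> v ^ t"
      proof (rule power_mono)
        have "18 * real K * (real d * real s) \<le> 18 * real K * (5 * real t)"
          by (rule mult_left_mono[OF tr]) simp
        then show "6 * (3 * real K * real s) * real d / (real t * real n) \<le> v"
          using n t(3) by (simp add: v_def field_simps)
      qed simp
      finally show "pr n d (\<lambda>E. t \<le> card (E \<inter> (rows Q \<times> J))) \<le> v ^ t" .
    qed
    also have "\<dots> = real ((n div 2) choose K) * v ^ t"
      using n_subsets[of "{..<n div 2}" K] by simp
    also have "\<dots> \<le> (270 / v) ^ K * v ^ t"
    proof (rule mult_right_mono)
      have "real ((n div 2) choose K) \<le> (3 * real n / real K) ^ K"
        by (rule binomial_le_power) (use K(3) in auto)
      also have "3 * real n / real K = 270 / v" using n K(3) by (simp add: v_def)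
      finally show "real ((n div 2) choose K) \<le> (270 / v) ^ K" .
    qed (use v in simp)
    \<comment> \<open>2 K of the t powers turn the cost (270 / v)^K of choosing \<open>Q\<close>
      into (270 v)^K <= 1; the other t - 2 K provide the decay.\<close>
    also have "\<dots> = (270 * v) ^ K * v ^ (t - 2 * K)"
    proof -
      have "v ^ t = v ^ (2 * K) * v ^ (t - 2 * K)" using t2K by (simp flip: power_add)
      also have "v ^ (2 * K) = (v * v) ^ K" by (simp add: power_mult power2_eq_square)
      finally have "(270 / v) ^ K * v ^ t = (270 / v * (v * v)) ^ K * v ^ (t - 2 * K)"
        by (simp only: power_mult_distrib mult_ac)
      also have "270 / v * (v * v) = 270 * v" using v by simp
      finally show ?thesis .
    qed
    also have "\<dots> \<le> 1 * exp (- 1) ^ (t - 2 * K)"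
    proof (rule mult_mono)
      have "exp (1::real) \<le> 270" using exp_le by simp
      then have "1 / 270 \<le> exp (- 1 :: real)" by (simp add: exp_minus field_simps)
      then have "v \<le> exp (- 1)" using v(2) by simp
      then show "v ^ (t - 2 * K) \<le> exp (- 1) ^ (t - 2 * K)" using v(1) by (intro power_mono) auto
      show "(270 * v) ^ K \<le> 1" by (rule power_le_one) (use v in auto)
    qed (use v in auto)
    also have "\<dots> = exp (- (real t - 2 * real K))"
      using t2K by (simp add: of_nat_diff flip: exp_of_nat_mult)
    also have "\<dots> \<le> exp (- (real d * real s / 10))" using tK by simp
    finally show ?thesis .
  qed
  also have "pr n d (\<lambda>E. t \<le> card (Y E)) \<le> exp (- (real d * real s / 10))"
  proof -
    have "pr n d (\<lambda>E. t \<le> card (Y E)) \<le> (3 * (real n * real s / 2) / real t * (2 * real d / real n) ^ 2) ^ t"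
      unfolding Y_def
    proof (rule pr_many_blocks[OF dpos dn _ _ t(3)])
      have "real (n div 2) \<le> real n / 2" by linarith
      then have "real (n div 2) * real s \<le> real n / 2 * real s" by (rule mult_right_mono) simp
      then show "real (card ({..<n div 2} \<times> J)) \<le> real n * real s / 2"
        by (simp add: card_cartesian_product s_def)
      have "4 * (2 * t) \<le> 2 * (d * s)" using t(1) by simp
      also have "\<dots> \<le> d * (4 * s)" by simp
      also have "\<dots> \<le> d * n" by (rule mult_le_mono2[OF s4])
      finally show "4 * (2 * t) \<le> n * d" by (simp add: mult.commute)
      show "disjoint_family_on (\<lambda>e. {(2 * fst e, snd e), (2 * fst e + 1, snd e)}) ({..<n div 2} \<times> J)"
        by (auto simp: disjoint_family_on_def)
    qed (use finJ in auto)
    also have "\<dots> \<le> exp (- 1) ^ t"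
    proof (rule power_mono)
      have "3 * (real n * real s / 2) / real t * (2 * real d / real n) ^ 2 = 6 * real d * (real d * real s) / (real t * real n)"
        using n t(3) by (simp add: power2_eq_square field_simps)
      also have "\<dots> \<le> 6 * real d * (5 * real t) / (real t * real n)"
        by (intro divide_right_mono mult_left_mono tr) auto
      also have "\<dots> = 30 * real d / real n" using t(3) by simp
      also have "\<dots> \<le> 1 / 3" using n_ge n by (simp add: field_simps)
      also have "\<dots> \<le> exp (- 1)" using exp_le by (simp add: exp_minus field_simps)
      finally show "3 * (real n * real s / 2) / real t * (2 * real d / real n) ^ 2 \<le> exp (- 1)" .
    qed simp
    also have "\<dots> = exp (- real t)" by (simp flip: exp_of_nat_mult)
    also have "\<dots> \<le> exp (- (real d * real s / 10))" using tr by simp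
    finally show ?thesis .
  qed
  finally have pr: "pr n d (\<lambda>E. card (unequal_pairs E J) < threshold (card J))
    \<le> 2 * exp (- (real d * real s / 10))" by simp
  have "real (n choose card J) * pr n d (\<lambda>E. card (unequal_pairs E J) < threshold (card J))
    \<le> (3 * real d ^ 2) ^ s * (2 * exp (- (real d * real s / 10)))"
  proof (rule mult_mono[OF _ pr])
    have "real (n choose s) \<le> (3 * real n / real s) ^ s" by (rule binomial_le_power) (use s in auto)
    also have "\<dots> \<le> (3 * real d ^ 2) ^ s"
    proof (rule power_mono)
      have "real n \<le> real s * real d ^ 2"
        using of_nat_mono[OF less_imp_le[OF mid(1)], where 'a = real] by (simp add: s_def)
      then show "3 * real n / real s \<le> 3 * real d ^ 2" using s by (simp add: field_simps)
    qed simp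
    finally show "real (n choose card J) \<le> (3 * real d ^ 2) ^ s" by (simp add: s_def)
  qed auto
  also have "\<dots> \<le> (3 * real d ^ 2) ^ s * (2 ^ s * exp (- (real d / 10)) ^ s)"
  proof (intro mult_left_mono mult_mono)
    show "(2::real) \<le> 2 ^ s" using s by (simp add: self_le_power)
    show "exp (- (real d * real s / 10)) \<le> exp (- (real d / 10)) ^ s"
      by (simp add: mult.commute flip: exp_of_nat_mult)
  qed auto
  also have "\<dots> = (6 * real d ^ 2 * exp (- (real d / 10))) ^ s"
  proof -
    have "6 * real d ^ 2 * exp (- (real d / 10)) = 3 * real d ^ 2 * (2 * exp (- (real d / 10)))" by simp
    then show ?thesis by (simp only: power_mult_distrib)
  qed
  also have "\<dots> \<le> (1 / real d) ^ s"
  proof (rule power_mono)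
    have "6 * real d ^ 2 * exp (- (real d / 10)) * real d = 6 * real d ^ 3 * exp (- (real d / 10))"
      by (simp add: eval_nat_numeral)
    also have "\<dots> \<le> exp (real d / 10) * exp (- (real d / 10))" by (rule mult_right_mono[OF d_exp]) simp
    also have "\<dots> = 1" by (simp flip: exp_add)
    finally show "6 * real d ^ 2 * exp (- (real d / 10)) \<le> 1 / real d"
      using dpos by (simp only: pos_le_divide_eq of_nat_0_less_iff)
  qed simp
  finally show ?thesis by (simp add: s_def)
qed

end

subsection \<open>Null vectors modulo $d + 1$ that are constant up to few entries\<close>

context regime
begin

text \<open>Half of d / (30 L^2), the number of coordinates on each side of the threshold in a row
  that is not poor (see \<open>many_sensitive_pairs\<close>). Removing fewer shared columns than
  this leaves the other half in \<open>dif\<close>.\<close>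

definition codeg_bound :: nat where
  "codeg_bound = nat \<lceil>real d / (60 * L\<^sup>2)\<rceil>"

lemma codeg_bound:
  shows "0 < codeg_bound" "2 * codeg_bound \<le> d" "real d / (60 * L\<^sup>2) \<le> real codeg_bound"
    "24 * real d ^ 2 \<le> real codeg_bound * real n" "(1 / 2) ^ codeg_bound \<le> 1 / real d ^ 3"
proof -
  have d0: "0 < real d" and L0: "1 \<le> L\<^sup>2" "L \<noteq> 0" using d_large L by (auto simp: one_le_power)
  have pos: "0 < real d / (60 * L\<^sup>2)" using d0 L0 by simp
  have le: "real d / (60 * L\<^sup>2) \<le> real d / 60"
    using d0 L0 by (intro divide_left_mono) auto
  show q: "real d / (60 * L\<^sup>2) \<le> real codeg_bound" unfolding codeg_bound_def using pos by linarith
  then show "0 < codeg_bound" using pos by (cases codeg_bound) auto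
  have "real codeg_bound \<le> real d / 60 + 1" unfolding codeg_bound_def using pos le by linarith
  then have "2 * real codeg_bound \<le> real d" using d_large by simp
  then show "2 * codeg_bound \<le> d" by linarith
  \<comment> \<open>1500 / 60 = 25: \<open>sparse\<close> keeps d^2 / n well below the
    bound.\<close>
  have "24 * real d ^ 2 \<le> real d / (60 * L\<^sup>2) * (1500 * (real d * L\<^sup>2))"
    using L0 by (simp add: power2_eq_square field_simps)
  also have "\<dots> \<le> real codeg_bound * real n"
    by (rule mult_mono[OF q sparse]) (use L0 in auto)
  finally show "24 * real d ^ 2 \<le> real codeg_bound * real n" .
  have "real d ^ 3 \<le> 2 powr (real d / (60 * L\<^sup>2))" by (rule d_powr)
  also have "\<dots> \<le> 2 powr (real codeg_bound)" by (rule powr_mono[OF q]) simp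
  also have "\<dots> = 2 ^ codeg_bound" by (simp add: powr_realpow)
  finally show "(1 / 2) ^ codeg_bound \<le> 1 / real d ^ 3"
    using d0 by (simp add: power_one_over field_simps)
qed

definition codeg_pairs :: "(nat \<times> nat) set \<Rightarrow> nat set" where
  "codeg_pairs E = {p \<in> {..<n div 2}. codeg_bound \<le> codeg E (2 * p) (2 * p + 1)}"

text \<open>Markov, with probability d^(-3) per pair. The level n / d^2 lies below |J| for the
  supports it is combined with in \<open>pr_flat_null\<close>.\<close>

lemma pr_codeg_pairs: "pr n d (\<lambda>E. real n / real d ^ 2 \<le> real (card (codeg_pairs E))) \<le> 1 / real d"
proof -
  have pos: "0 < real n" "0 < real d" using n_ge' d_large by auto
  have "pr n d (\<lambda>E. real n / real d ^ 2 \<le> real (card (codeg_pairs E)))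
    \<le> (\<Sum>p<n div 2. pr n d (\<lambda>E. codeg_bound \<le> codeg E (2 * p) (2 * p + 1))) / (real n / real d ^ 2)"
    unfolding codeg_pairs_def by (rule pr_markov) (use pos in auto)
  also have "\<dots> \<le> (\<Sum>p<n div 2. 1 / real d ^ 3) / (real n / real d ^ 2)"
  proof (intro divide_right_mono sum_mono)
    fix p
    have "pr n d (\<lambda>E. codeg_bound \<le> codeg E (2 * p) (2 * p + 1)) \<le> (1 / 2) ^ codeg_bound"
      by (rule pr_codeg) (use codeg_bound(1-4) d_large n_ge' in auto)
    then show "pr n d (\<lambda>E. codeg_bound \<le> codeg E (2 * p) (2 * p + 1)) \<le> 1 / real d ^ 3"
      using codeg_bound(5) by linarith
  qed simp
  also have "\<dots> = real (n div 2) / real n * (1 / real d)"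
    using pos by (simp add: field_simps eval_nat_numeral)
  also have "\<dots> \<le> 1 * (1 / real d)" using pos by (intro mult_right_mono) auto
  finally show ?thesis by simp
qed

text \<open>An element of \<open>dif\<close> in \<open>J\<close> and one outside serve as a and b in
  \<open>halves_fixed_residue_le\<close>. Only \<open>dif\<close> occurs, so resampling a pair
  preserves this set (\<open>good_pairs_put\<close>).\<close>

definition good_pairs :: "(nat \<times> nat) set \<Rightarrow> nat set \<Rightarrow> nat set" where
  "good_pairs E J = {p. p < n div 2 \<and> dif E (2 * p) (2 * p + 1) \<inter> J \<noteq> {}
     \<and> \<not> dif E (2 * p) (2 * p + 1) \<subseteq> J}"

lemma good_pairs_subset: "good_pairs E J \<subseteq> {..<n div 2}"
  by (auto simp: good_pairs_def)

text \<open>An unequal pair that is not good has its symmetric difference inside \<open>J\<close>,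
  so row 2p consists of shared columns and elements of \<open>J\<close>. Either the codegree reaches
  \<open>codeg_bound\<close> <= d / 2, or half of the row lies in \<open>J\<close>, which edge
  counting allows for at most 2 |J| rows.\<close>

lemma card_unequal_pairs_le:
  assumes E: "E \<in> digraphs n d" and J: "J \<subseteq> {..<n}"
  shows "card (unequal_pairs E J) \<le> card (good_pairs E J) + card (codeg_pairs E) + 2 * card J"
proof -
  define X where "X = {p. p < n div 2 \<and> d \<le> 2 * card (outs E (2 * p) \<inter> J)}"
  have finJ: "finite J" using J finite_subset by blast
  have finX: "finite X" by (rule finite_subset[of _ "{..<n}"]) (auto simp: X_def)
  have fins: "finite (good_pairs E J)" "finite (codeg_pairs E)"
    using good_pairs_subset finite_subset by (blast, simp add: codeg_pairs_def)
  note finr = finite_outs[OF E]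
  have "unequal_pairs E J \<subseteq> good_pairs E J \<union> codeg_pairs E \<union> X"
  proof
    fix p assume p: "p \<in> unequal_pairs E J"
    then have pn: "p < n div 2" "2 * p < n" by (auto simp: unequal_pairs_def)
    show "p \<in> good_pairs E J \<union> codeg_pairs E \<union> X"
    proof (rule ccontr)
      assume np: "p \<notin> good_pairs E J \<union> codeg_pairs E \<union> X"
      have "dif E (2 * p) (2 * p + 1) \<inter> J \<noteq> {}" using p by (auto simp: unequal_pairs_def dif_def)
      then have sub: "dif E (2 * p) (2 * p + 1) \<subseteq> J" using np pn by (auto simp: good_pairs_def)
      let ?R = "outs E (2 * p)" and ?R' = "outs E (2 * p + 1)"
      have "d = card ?R" using card_outs[OF E pn(2)] by simp
      also have "\<dots> \<le> card ((?R \<inter> ?R') \<union> (?R \<inter> J))"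
        by (rule card_mono) (use sub finr in \<open>auto simp: dif_def\<close>)
      also have "\<dots> \<le> card (?R \<inter> ?R') + card (?R \<inter> J)" by (rule card_Un_le)
      finally have "d \<le> codeg E (2 * p) (2 * p + 1) + card (?R \<inter> J)" by (simp add: codeg_def)
      moreover have "codeg E (2 * p) (2 * p + 1) < codeg_bound" "2 * card (?R \<inter> J) < d"
        using np pn by (auto simp: codeg_pairs_def X_def)
      ultimately show False using codeg_bound(2) by linarith
    qed
  qed
  then have "card (unequal_pairs E J) \<le> card (good_pairs E J \<union> codeg_pairs E \<union> X)"
    by (rule card_mono[rotated]) (use fins finX in simp)
  also have "\<dots> \<le> card (good_pairs E J \<union> codeg_pairs E) + card X" by (rule card_Un_le)
  also have "card (good_pairs E J \<union> codeg_pairs E) \<le> card (good_pairs E J) + card (codeg_pairs E)"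
    by (rule card_Un_le)
  also have "card X \<le> 2 * card J"
  proof -
    have "d * card X = (\<Sum>p\<in>X. d)" by simp
    also have "\<dots> \<le> (\<Sum>p\<in>X. 2 * card (outs E (2 * p) \<inter> J))" by (rule sum_mono) (simp add: X_def)
    also have "\<dots> = 2 * (\<Sum>i\<in>(\<lambda>p. 2 * p) ` X. card (outs E i \<inter> J))"
      by (subst sum.reindex) (auto simp: inj_on_def sum_distrib_left)
    also have "(\<Sum>i\<in>(\<lambda>p. 2 * p) ` X. card (outs E i \<inter> J)) = card (E \<inter> ((\<lambda>p. 2 * p) ` X \<times> J))"
      by (rule card_edges_rows[symmetric]) (use finX finite_digraph[OF E] in auto)
    also have "\<dots> \<le> card (E \<inter> ({..<n} \<times> J))"
      by (rule card_mono) (use finite_digraph[OF E] in \<open>auto simp: X_def\<close>)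
    also have "\<dots> = d * card J" by (rule card_edges_all_rows[OF E J])
    finally have "d * card X \<le> d * (2 * card J)" by simp
    then show ?thesis using d_large by simp
  qed
  finally show ?thesis by simp
qed

lemma good_pairs_put:
  assumes "k < n div 2" "T \<in> halves (dif E (2 * k) (2 * k + 1))"
  shows "good_pairs (put E (2 * k) (2 * k + 1) T) J = good_pairs E J"
proof -
  have "dif (put E (2 * k) (2 * k + 1) T) (2 * p) (2 * p + 1) = dif E (2 * p) (2 * p + 1)" for p
  proof (cases "p = k")
    case True
    then show ?thesis using dif_put(1)[of "2 * k" "2 * k + 1" T E] assms by (simp add: halves_def)
  next
    case False
    then have "2 * p \<noteq> 2 * k" "2 * p \<noteq> 2 * k + 1" "2 * p + 1 \<noteq> 2 * k" "2 * p + 1 \<noteq> 2 * k + 1"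
      by presburger+
    then show ?thesis unfolding dif_def by (simp add: outs_put)
  qed
  then show ?thesis by (simp add: good_pairs_def)
qed

text \<open>Fix the set Q of good pairs first; it is invariant under resampling. Then go through the
  pairs in order: resampling a pair in Q leaves the even rows tested earlier alone, so at most 3/4
  of the survivors remain.\<close>

lemma pr_null_fixed:
  fixes z :: "nat \<Rightarrow> int" and m :: int
  defines "J \<equiv> {j \<in> {..<n}. \<not> m dvd z j}"
  shows "pr n d (\<lambda>E. K \<le> card (good_pairs E J) \<and> (\<forall>i<n. m dvd sum z (outs E i) - c)) \<le> (3 / 4) ^ K"
proof (rule pr_leI)
  define X where "X Q k = {E \<in> digraphs n d. good_pairs E J = Q \<and>
    (\<forall>p\<in>Q. p < k \<longrightarrow> m dvd sum z (outs E (2 * p)) - c)}" for Q k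
  have finX: "finite (X Q k)" for Q k by (simp add: X_def)
  have step: "real (card (X Q (Suc k))) \<le> (if k \<in> Q then 3 / 4 else 1) * real (card (X Q k))"
    if k: "k < n div 2" for Q k
  proof (cases "k \<in> Q")
    case False
    then have "X Q (Suc k) = X Q k" by (auto simp: X_def less_Suc_eq)
    then show ?thesis using False by simp
  next
    case True
    let ?i = "2 * k" and ?j = "2 * k + 1"
    have ij: "?i < n" "?j < n" "?i \<noteq> ?j" using k by auto
    have "real (card (X Q (Suc k))) \<le> 3 / 4 * real (card (X Q k))"
    proof (rule resampling[OF ij])
      show "X Q (Suc k) \<subseteq> X Q k" "X Q k \<subseteq> digraphs n d" by (auto simp: X_def)
    next
      fix E T assume E: "E \<in> X Q k" and T: "T \<in> halves (dif E ?i ?j)"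
      have "put E ?i ?j T \<in> digraphs n d"
        by (rule put_in_digraphs[OF _ ij T]) (use E in \<open>simp add: X_def\<close>)
      moreover have "outs (put E ?i ?j T) (2 * p) = outs E (2 * p)" if "p < k" for p
        using that by (simp add: outs_put)
      ultimately show "put E ?i ?j T \<in> X Q k"
        using E good_pairs_put[OF k T] by (simp add: X_def)
    next
      fix E assume EX: "E \<in> X Q k"
      then have E: "E \<in> digraphs n d" by (simp add: X_def)
      let ?S = "dif E ?i ?j" and ?C = "outs E ?i \<inter> outs E ?j"
      have finS: "finite ?S" by (rule finite_dif[OF E])
      have "k \<in> good_pairs E J" using EX True by (simp add: X_def)
      then obtain a b where ab: "a \<in> ?S" "a \<in> J" "b \<in> ?S" "b \<notin> J" by (auto simp: good_pairs_def)
      have "b < n" using ab(3) digraphs_lt[OF E] by (auto simp: dif_def)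
      then have "m dvd z b" "\<not> m dvd z a" using ab by (auto simp: J_def)
      then have nab: "\<not> m dvd z a - z b" by (simp add: dvd_diff_left_iff)
      have "{T \<in> halves ?S. put E ?i ?j T \<in> X Q (Suc k)} \<subseteq> {T \<in> halves ?S. m dvd sum z T - (c - sum z ?C)}"
      proof
        fix T assume T: "T \<in> {T \<in> halves ?S. put E ?i ?j T \<in> X Q (Suc k)}"
        then have TS: "T \<subseteq> ?S" "finite T" using finS finite_subset by (auto simp: halves_def)
        have "m dvd sum z (outs (put E ?i ?j T) ?i) - c" using T True by (simp add: X_def)
        moreover have "outs (put E ?i ?j T) ?i = ?C \<union> T" by (simp add: outs_put)
        moreover have "sum z (?C \<union> T) = sum z ?C + sum z T"
          by (rule sum.union_disjoint) (use TS finite_outs[OF E] in \<open>auto simp: dif_def\<close>)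
        ultimately show "T \<in> {T \<in> halves ?S. m dvd sum z T - (c - sum z ?C)}"
          using T by (simp add: algebra_simps)
      qed
      then have "card {T \<in> halves ?S. put E ?i ?j T \<in> X Q (Suc k)}
        \<le> card {T \<in> halves ?S. m dvd sum z T - (c - sum z ?C)}"
        by (rule card_mono[rotated]) (use finite_halves[OF finS] in simp)
      also have "real \<dots> \<le> 3 / 4 * real (card (halves ?S))"
        by (rule halves_fixed_residue_le[OF finS ab(1,3) nab])
      finally show "real (card {T \<in> halves ?S. put E ?i ?j T \<in> X Q (Suc k)}) \<le> 3 / 4 * real (card (halves ?S))"
        by simp
    qed
    then show ?thesis using True by simp
  qed
  have iter: "real (card (X Q k)) \<le> (3 / 4) ^ card (Q \<inter> {..<k}) * real (card (X Q 0))"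
    if "k \<le> n div 2" for Q k
    using that
  proof (induction k)
    case (Suc k)
    have "real (card (X Q (Suc k))) \<le> (if k \<in> Q then 3 / 4 else 1) * real (card (X Q k))"
      by (rule step) (use Suc in simp)
    also have "\<dots> \<le> (if k \<in> Q then 3 / 4 else 1) * ((3 / 4) ^ card (Q \<inter> {..<k}) * real (card (X Q 0)))"
      by (rule mult_left_mono) (use Suc in auto)
    also have "\<dots> = (3 / 4) ^ card (Q \<inter> {..<Suc k}) * real (card (X Q 0))"
      by (auto simp: lessThan_Suc Int_insert_right)
    finally show ?case .
  qed simp
  let ?P = "{Q \<in> Pow {..<n div 2}. K \<le> card Q}"
  have "{E \<in> digraphs n d. K \<le> card (good_pairs E J) \<and> (\<forall>i<n. m dvd sum z (outs E i) - c)}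
    \<subseteq> (\<Union>Q\<in>?P. X Q (n div 2))"
    using good_pairs_subset by (auto simp: X_def)
  then have "card {E \<in> digraphs n d. K \<le> card (good_pairs E J) \<and> (\<forall>i<n. m dvd sum z (outs E i) - c)}
    \<le> card (\<Union>Q\<in>?P. X Q (n div 2))"
    by (rule card_mono[rotated]) (simp add: finX)
  also have "\<dots> \<le> (\<Sum>Q\<in>?P. card (X Q (n div 2)))" by (rule card_UN_le) simp
  also have "real \<dots> \<le> (\<Sum>Q\<in>?P. (3 / 4) ^ K * real (card (X Q 0)))"
    unfolding of_nat_sum
  proof (rule sum_mono)
    fix Q assume Q: "Q \<in> ?P"
    have "real (card (X Q (n div 2))) \<le> (3 / 4) ^ card (Q \<inter> {..<n div 2}) * real (card (X Q 0))"
      by (rule iter) simp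
    also have "\<dots> \<le> (3 / 4) ^ K * real (card (X Q 0))"
      using Q by (intro mult_right_mono power_decreasing) (auto simp: Int_absorb2)
    finally show "real (card (X Q (n div 2))) \<le> (3 / 4) ^ K * real (card (X Q 0))" .
  qed
  also have "\<dots> = (3 / 4) ^ K * real (card (\<Union>Q\<in>?P. X Q 0))"
    by (subst card_UN_disjoint) (auto simp: finX sum_distrib_left X_def)
  also have "\<dots> \<le> (3 / 4) ^ K * real (card (digraphs n d))"
    by (intro mult_left_mono of_nat_mono card_mono) (auto simp: X_def)
  finally show "real (card {E \<in> digraphs n d. K \<le> card (good_pairs E J) \<and> (\<forall>i<n. m dvd sum z (outs E i) - c)})
    \<le> (3 / 4) ^ K * real (card (digraphs n d))" by simp
qed simp

text \<open>Affine rather than linear: \<open>z\<close> arises from a null vector by subtracting a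
  constant, after which the row sums share a residue that need not vanish.\<close>

definition null_mod :: "nat \<Rightarrow> nat set \<Rightarrow> (nat \<times> nat) set \<Rightarrow> bool" where
  "null_mod m J E \<longleftrightarrow> (\<exists>(z :: nat \<Rightarrow> int) c. J = {j \<in> {..<n}. \<not> int m dvd z j}
     \<and> (\<forall>i<n. int m dvd sum z (outs E i) - c))"

text \<open>Union bound over representatives: off \<open>J\<close> the residues are 0, so those on
  \<open>J\<close> together with c give m^(|J| + 1) cases for \<open>pr_null_fixed\<close>.\<close>

lemma pr_null_mod:
  assumes J: "J \<subseteq> {..<n}" and m: "0 < m"
  shows "pr n d (\<lambda>E. K \<le> card (good_pairs E J) \<and> null_mod m J E) \<le> real m ^ Suc (card J) * (3 / 4) ^ K"
proof -
  define V where "V = (J \<rightarrow>\<^sub>E {0..<int m}) \<times> {0..<int m}"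
  define ext where "ext f j = (if j \<in> J then f j else 0)" for f :: "nat \<Rightarrow> int" and j
  define bad where "bad v E \<longleftrightarrow> J = {j \<in> {..<n}. \<not> int m dvd ext (fst v) j} \<and> K \<le> card (good_pairs E J)
    \<and> (\<forall>i<n. int m dvd sum (ext (fst v)) (outs E i) - snd v)" for v E
  have finJ: "finite J" using J finite_subset by blast
  have finV: "finite V" unfolding V_def using finJ by (intro finite_cartesian_product finite_PiE) auto
  have cV: "card V = m ^ Suc (card J)"
    using finJ by (simp add: V_def card_cartesian_product card_PiE)
  have "pr n d (\<lambda>E. K \<le> card (good_pairs E J) \<and> null_mod m J E) \<le> pr n d (\<lambda>E. \<exists>v\<in>V. bad v E)"
  proof (rule pr_mono)
    fix E assume E: "E \<in> digraphs n d" and h: "K \<le> card (good_pairs E J) \<and> null_mod m J E"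
    then obtain z c where z: "J = {j \<in> {..<n}. \<not> int m dvd z j}"
      and null: "\<And>i. i < n \<Longrightarrow> int m dvd sum z (outs E i) - c"
      by (auto simp: null_mod_def)
    define f where "f = restrict (\<lambda>j. z j mod int m) J"
    have close: "int m dvd ext f j - z j" if "j < n" for j
      using that z by (auto simp: ext_def f_def mod_eq_dvd_iff[symmetric] dvd_minus_iff)
    have "int m dvd ext f j \<longleftrightarrow> int m dvd z j" if "j < n" for j
      using dvd_add_left_iff[OF close[OF that], of "z j"] dvd_add_right_iff[OF close[OF that], of "z j"] by simp
    then have supp: "J = {j \<in> {..<n}. \<not> int m dvd ext f j}" using z by auto
    have "int m dvd sum (ext f) (outs E i) - c mod int m" if i: "i < n" for i
    proof -
      have "int m dvd (\<Sum>j\<in>outs E i. ext f j - z j)"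
        by (rule dvd_sum) (use close digraphs_lt[OF E] in auto)
      then have "int m dvd sum (ext f) (outs E i) - sum z (outs E i)" by (simp add: sum_subtractf)
      moreover have "int m dvd c - c mod int m" by (rule dvd_minus_mod)
      ultimately have "int m dvd (sum (ext f) (outs E i) - sum z (outs E i)) + (sum z (outs E i) - c) + (c - c mod int m)"
        using null[OF i] by (intro dvd_add)
      then show ?thesis by simp
    qed
    then have "bad (f, c mod int m) E" using supp h by (simp add: bad_def)
    moreover have "(f, c mod int m) \<in> V" using m by (auto simp: V_def f_def)
    ultimately show "\<exists>v\<in>V. bad v E" by blast
  qed
  also have "\<dots> \<le> (\<Sum>v\<in>V. pr n d (bad v))" by (rule pr_Bex[OF finV])
  also have "\<dots> \<le> (\<Sum>v\<in>V. (3 / 4) ^ K)"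
  proof (rule sum_mono)
    fix v
    show "pr n d (bad v) \<le> (3 / 4) ^ K"
    proof (cases "J = {j \<in> {..<n}. \<not> int m dvd ext (fst v) j}")
      case True
      have "pr n d (bad v) \<le> pr n d (\<lambda>E. K \<le> card (good_pairs E {j \<in> {..<n}. \<not> int m dvd ext (fst v) j})
        \<and> (\<forall>i<n. int m dvd sum (ext (fst v)) (outs E i) - snd v))"
        by (rule pr_mono) (auto simp: bad_def simp flip: True)
      also have "\<dots> \<le> (3 / 4) ^ K" by (rule pr_null_fixed)
      finally show ?thesis .
    next
      case False
      then have "bad v = (\<lambda>E. False)" by (auto simp: bad_def)
      then show ?thesis by (simp add: pr_def)
    qed
  qed
  also have "\<dots> = real m ^ Suc (card J) * (3 / 4) ^ K" by (simp add: cV)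
  finally show ?thesis .
qed

text \<open>Powers of d per element of \<open>J\<close>: 2 for the support, since s > n / d^2, 4 for
  the residues and c, and -9 from the pairs, leaving 3 d^(-3) <= 1 / d.\<close>

lemma pr_mid_null:
  assumes J: "J \<subseteq> {..<n}" and mid: "n < card J * d\<^sup>2"
  shows "real (n choose card J) * pr n d (\<lambda>E. threshold (card J) - 3 * card J \<le> card (good_pairs E J)
    \<and> null_mod (Suc d) J E) \<le> (1 / real d) ^ card J"
proof -
  define s where "s = card J"
  define K where "K = threshold s - 3 * s"
  have s: "1 \<le> s" using mid by (cases "s = 0") (auto simp: s_def)
  have d0: "0 < real d" using d_large by simp
  have "real s * 1 \<le> real s * L" by (rule mult_left_mono) (use L in auto)
  then have "3 * real s \<le> 3 * (real s * L)" by simp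
  moreover have "40 * (real s * L) \<le> real (threshold s)"
    using threshold_bounds(1)[OF s] by (simp only: mult.assoc)
  moreover have "real (threshold s) - 3 * real s \<le> real K" by (simp add: K_def)
  ultimately have K: "36 * (real s * L) \<le> real K" using L(2) by linarith
  \<comment> \<open>3/4 <= exp (-1/4) because 81/256 <= 1/3 <= exp (-1); hence 36 s L pairs yield
    exp (- 9 s L).\<close>
  have "(3 / 4 :: real) ^ 4 \<le> exp (- 1 / 4) ^ 4"
  proof -
    have "(3 / 4 :: real) ^ 4 \<le> 1 / 3" by (simp add: eval_nat_numeral)
    also have "\<dots> \<le> exp (- 1)" using exp_le by (simp add: exp_minus field_simps)
    also have "\<dots> = exp (- 1 / 4) ^ 4" by (simp flip: exp_of_nat_mult)
    finally show ?thesis .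
  qed
  then have "(3 / 4 :: real) \<le> exp (- 1 / 4)" by (simp add: power_mono_iff)
  then have "(3 / 4 :: real) ^ K \<le> exp (- 1 / 4) ^ K" by (rule power_mono) simp
  also have "\<dots> = exp (- (real K / 4))" by (simp flip: exp_of_nat_mult)
  also have "\<dots> \<le> exp (real s * (- (9 * L)))" using K by simp
  also have "\<dots> = exp (- (9 * L)) ^ s" by (rule exp_of_nat_mult)
  also have "exp (- (9 * L)) = 1 / real d ^ 9"
    using exp_of_nat_mult[of 9 L] by (simp add: exp_minus exp_L field_simps)
  finally have K': "(3 / 4 :: real) ^ K \<le> (1 / real d ^ 9) ^ s" .
  have "real (n choose s) \<le> (3 * real n / real s) ^ s" by (rule binomial_le_power) (use s in auto)
  also have "\<dots> \<le> (3 * real d ^ 2) ^ s"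
  proof (rule power_mono)
    have "real n \<le> real s * real d ^ 2"
      using of_nat_mono[OF less_imp_le[OF mid], where 'a = real] by (simp add: s_def)
    then show "3 * real n / real s \<le> 3 * real d ^ 2" using s by (simp add: field_simps)
  qed simp
  finally have ns: "real (n choose s) \<le> (3 * real d ^ 2) ^ s" .
  have ds: "real (Suc d) ^ Suc s \<le> (real d ^ 4) ^ s"
  proof -
    have "real (Suc d) \<le> real d ^ 2"
    proof -
      have "real (Suc d) \<le> 2 * real d" using d_large by simp
      also have "\<dots> \<le> real d * real d" by (rule mult_right_mono) (use d_large in auto)
      finally show ?thesis by (simp add: power2_eq_square)
    qed
    then have "real (Suc d) ^ Suc s \<le> (real d ^ 2) ^ Suc s" by (rule power_mono) simp
    also have "\<dots> \<le> (real d ^ 2) ^ (2 * s)"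
      by (rule power_increasing) (use s d_large in \<open>auto intro!: one_le_power\<close>)
    also have "\<dots> = (real d ^ 4) ^ s" by (simp flip: power_mult)
    finally show ?thesis .
  qed
  have "real (n choose s) * pr n d (\<lambda>E. K \<le> card (good_pairs E J) \<and> null_mod (Suc d) J E)
    \<le> (3 * real d ^ 2) ^ s * ((real d ^ 4) ^ s * (1 / real d ^ 9) ^ s)"
  proof (intro mult_mono ns)
    have "pr n d (\<lambda>E. K \<le> card (good_pairs E J) \<and> null_mod (Suc d) J E) \<le> real (Suc d) ^ Suc s * (3 / 4) ^ K"
      unfolding s_def by (rule pr_null_mod[OF J]) simp
    also have "\<dots> \<le> (real d ^ 4) ^ s * (1 / real d ^ 9) ^ s"
      by (rule mult_mono[OF ds K']) auto
    finally show "pr n d (\<lambda>E. K \<le> card (good_pairs E J) \<and> null_mod (Suc d) J E)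
      \<le> (real d ^ 4) ^ s * (1 / real d ^ 9) ^ s" .
  qed auto
  also have "\<dots> = (3 * real d ^ 2 * (real d ^ 4 * (1 / real d ^ 9))) ^ s"
    by (simp only: power_mult_distrib)
  also have "\<dots> \<le> (1 / real d) ^ s"
  proof (rule power_mono)
    have "3 \<le> real d ^ 2" using d_large self_le_power[of "real d" 2] by linarith
    have "3 * real d ^ 2 * (real d ^ 4 * (1 / real d ^ 9)) = 3 / (real d ^ 2 * real d)"
      using d0 by (simp add: divide_simps eval_nat_numeral)
    also have "\<dots> \<le> real d ^ 2 / (real d ^ 2 * real d)"
      by (rule divide_right_mono[OF \<open>3 \<le> real d ^ 2\<close>]) simp
    also have "\<dots> = 1 / real d" using d0 by simp
    finally show "3 * real d ^ 2 * (real d ^ 4 * (1 / real d ^ 9)) \<le> 1 / real d" .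
  qed simp
  finally show ?thesis by (simp add: s_def K_def)
qed

definition flat_null :: "(nat \<times> nat) set \<Rightarrow> bool" where
  "flat_null E \<longleftrightarrow> (\<exists>J\<subseteq>{..<n}. J \<noteq> {} \<and> real (card J) * L\<^sup>2 \<le> real n \<and> null_mod (Suc d) J E)"

text \<open>A row meeting the support exactly once forces the common value $c$ to be nonzero, and then
  every row has to meet the support, which is too small for that.\<close>

lemma small_support_touched:
  assumes E: "E \<in> digraphs n d" and J: "J \<subseteq> {..<n}" "J \<noteq> {}" and small: "card J * d\<^sup>2 \<le> n"
    and null: "null_mod (Suc d) J E"
  shows "2 * card (touched E J) \<le> d * card J"
proof (rule ccontr)
  assume "\<not> 2 * card (touched E J) \<le> d * card J"
  then have big: "d * card J < 2 * card (touched E J)" by simp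
  have finJ: "finite J" using J finite_subset by blast
  have finT: "finite (touched E J)" using touched_subset[OF E] finite_subset by blast
  have edges: "(\<Sum>i\<in>touched E J. card (outs E i \<inter> J)) \<le> d * card J"
  proof -
    have "(\<Sum>i\<in>touched E J. card (outs E i \<inter> J)) = card (E \<inter> (touched E J \<times> J))"
      by (rule card_edges_rows[symmetric, OF finT finite_digraph[OF E]])
    also have "\<dots> \<le> card (E \<inter> ({..<n} \<times> J))"
      by (rule card_mono) (use finite_digraph[OF E] touched_subset[OF E] in auto)
    finally show ?thesis using card_edges_all_rows[OF E J(1)] by simp
  qed
  have pos: "0 < card (outs E i \<inter> J)" if "i \<in> touched E J" for i
    using that finJ by (simp add: touched_def card_gt_0_iff)
  obtain i where i: "i \<in> touched E J" "card (outs E i \<inter> J) = 1"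
  proof -
    \<comment> \<open>Otherwise the touched rows, more than d |J| / 2 in number, would absorb more
      than d |J| edges.\<close>
    have "\<exists>i\<in>touched E J. card (outs E i \<inter> J) < 2"
    proof (rule ccontr)
      assume "\<not> (\<exists>i\<in>touched E J. card (outs E i \<inter> J) < 2)"
      then have "(\<Sum>i\<in>touched E J. 2) \<le> (\<Sum>i\<in>touched E J. card (outs E i \<inter> J))"
        by (intro sum_mono) (simp add: not_less)
      then show False using big edges by simp
    qed
    then show ?thesis using that pos by (metis One_nat_def less_2_cases less_numeral_extra(3))
  qed
  obtain z c where z: "J = {j \<in> {..<n}. \<not> int (Suc d) dvd z j}"
    and nl: "\<And>i. i < n \<Longrightarrow> int (Suc d) dvd sum z (outs E i) - c"
    using null by (auto simp: null_mod_def)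
  have off: "int (Suc d) dvd sum z (outs E i - J)" for i
    by (rule dvd_sum) (use z digraphs_lt[OF E] in auto)
  have split: "sum z (outs E i) = sum z (outs E i \<inter> J) + sum z (outs E i - J)" for i
    using sum.Int_Diff[OF finite_outs[OF E]] .
  obtain j where j: "outs E i \<inter> J = {j}" using i(2) by (auto simp: card_1_singleton_iff)
  then have "\<not> int (Suc d) dvd z j" using z by auto
  then have c: "\<not> int (Suc d) dvd c"
  proof (rule contrapos_nn)
    assume "int (Suc d) dvd c"
    moreover have "int (Suc d) dvd sum z (outs E i) - c" using nl i(1) touched_subset[OF E] by auto
    ultimately have "int (Suc d) dvd (sum z (outs E i) - c) + c" by (intro dvd_add)
    then have "int (Suc d) dvd (sum z (outs E i) - c) + c - sum z (outs E i - J)"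
      using off[of i] by (rule dvd_diff)
    then show "int (Suc d) dvd z j" using split[of i] j by simp
  qed
  have "{..<n} \<subseteq> touched E J"
  proof
    fix k assume k: "k \<in> {..<n}"
    show "k \<in> touched E J"
    proof (rule ccontr)
      assume "k \<notin> touched E J"
      then have "outs E k \<inter> J = {}" by (auto simp: touched_def)
      then have "int (Suc d) dvd sum z (outs E k)" using split[of k] off[of k] by simp
      moreover have "int (Suc d) dvd sum z (outs E k) - c" using nl k by simp
      ultimately have "int (Suc d) dvd sum z (outs E k) - (sum z (outs E k) - c)" by (rule dvd_diff)
      then show False using c by simp
    qed
  qed
  then have "card {..<n} \<le> card (touched E J)" by (rule card_mono[OF finT])
  then have "n \<le> card (touched E J)" by simp
  also have "\<dots> \<le> (\<Sum>i\<in>touched E J. card (outs E i \<inter> J))"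
    using sum_mono[of "touched E J" "\<lambda>_. 1" "\<lambda>i. card (outs E i \<inter> J)"] pos by (simp add: Suc_le_eq)
  also note edges
  finally have "n \<le> d * card J" .
  with small have "card J * d\<^sup>2 \<le> d * card J" by (rule order_trans)
  then have "(card J * d) * d \<le> (card J * d) * 1" by (simp only: power2_eq_square mult_ac mult_1_right)
  moreover have "0 < card J * d" using finJ J(2) d_large by (simp add: card_gt_0_iff)
  ultimately have "d \<le> 1" by (simp only: mult_le_cancel1)
  then show False using d_large by simp
qed

text \<open>7 = 2 + 2 + 2 + 1: small supports that do not expand, larger ones with few unequal
  pairs, larger ones with many good pairs and yet a null vector, and too many pairs of large
  codegree.\<close>

lemma pr_flat_null: "pr n d flat_null \<le> 7 / real d"
proof -
  define bad1 where "bad1 J E \<longleftrightarrow> card J * d\<^sup>2 \<le> n \<and> 2 * card (touched E J) \<le> d * card J" for J E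
  define bad2 where "bad2 J E \<longleftrightarrow> n < card J * d\<^sup>2 \<and> real (card J) * L\<^sup>2 \<le> real n
    \<and> card (unequal_pairs E J) < threshold (card J)" for J E
  define bad3 where "bad3 J E \<longleftrightarrow> n < card J * d\<^sup>2
    \<and> threshold (card J) - 3 * card J \<le> card (good_pairs E J) \<and> null_mod (Suc d) J E" for J E
  define bad4 where "bad4 E \<longleftrightarrow> real n / real d ^ 2 \<le> real (card (codeg_pairs E))" for E
  let ?ex = "\<lambda>P E. \<exists>J\<subseteq>{..<n}. J \<noteq> {} \<and> P J E"
  have x: "0 \<le> 1 / real d" "1 / real d \<le> 1 / 2" using d_large by auto
  have zero: "pr n d (\<lambda>E. False) = 0" by (simp add: pr_def)
  have b1: "pr n d (?ex bad1) \<le> 2 * (1 / real d)"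
  proof (rule pr_subsets[OF x])
    fix J assume J: "J \<subseteq> {..<n}" "J \<noteq> {}"
    show "real (n choose card J) * pr n d (bad1 J) \<le> (1 / real d) ^ card J"
    proof (cases "card J * d\<^sup>2 \<le> n")
      case True
      then have "bad1 J = (\<lambda>E. 2 * card (touched E J) \<le> d * card J)" by (simp add: bad1_def fun_eq_iff)
      then show ?thesis using pr_small_expansion[OF d_large J True] by simp
    next
      case False
      then have "bad1 J = (\<lambda>E. False)" by (simp add: bad1_def fun_eq_iff)
      then show ?thesis by (simp add: zero)
    qed
  qed
  have b2: "pr n d (?ex bad2) \<le> 2 * (1 / real d)"
  proof (rule pr_subsets[OF x])
    fix J assume J: "J \<subseteq> {..<n}" "J \<noteq> {}"
    show "real (n choose card J) * pr n d (bad2 J) \<le> (1 / real d) ^ card J"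
    proof (cases "n < card J * d\<^sup>2 \<and> real (card J) * L\<^sup>2 \<le> real n")
      case True
      then have "bad2 J = (\<lambda>E. card (unequal_pairs E J) < threshold (card J))"
        by (simp add: bad2_def fun_eq_iff)
      then show ?thesis using pr_mid_expansion[OF J(1)] True by simp
    next
      case False
      then have "bad2 J = (\<lambda>E. False)" by (auto simp: bad2_def)
      then show ?thesis by (simp add: zero)
    qed
  qed
  have b3: "pr n d (?ex bad3) \<le> 2 * (1 / real d)"
  proof (rule pr_subsets[OF x])
    fix J assume J: "J \<subseteq> {..<n}" "J \<noteq> {}"
    show "real (n choose card J) * pr n d (bad3 J) \<le> (1 / real d) ^ card J"
    proof (cases "n < card J * d\<^sup>2")
      case True
      then have "bad3 J = (\<lambda>E. threshold (card J) - 3 * card J \<le> card (good_pairs E J)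
        \<and> null_mod (Suc d) J E)" by (simp add: bad3_def fun_eq_iff)
      then show ?thesis using pr_mid_null[OF J(1) True] by simp
    next
      case False
      then have "bad3 J = (\<lambda>E. False)" by (simp add: bad3_def fun_eq_iff)
      then show ?thesis by (simp add: zero)
    qed
  qed
  have "pr n d flat_null \<le> pr n d (\<lambda>E. (?ex bad1 E \<or> ?ex bad2 E) \<or> (?ex bad3 E \<or> bad4 E))"
  proof (rule pr_mono)
    fix E assume E: "E \<in> digraphs n d" and "flat_null E"
    then obtain J where J: "J \<subseteq> {..<n}" "J \<noteq> {}" "real (card J) * L\<^sup>2 \<le> real n"
      and null: "null_mod (Suc d) J E" by (auto simp: flat_null_def)
    show "(?ex bad1 E \<or> ?ex bad2 E) \<or> (?ex bad3 E \<or> bad4 E)"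
    proof (cases "card J * d\<^sup>2 \<le> n")
      case True
      then have "bad1 J E" using small_support_touched[OF E J(1,2) True null] by (simp add: bad1_def)
      then show ?thesis using J by blast
    next
      case False
      then have mid: "n < card J * d\<^sup>2" by simp
      show ?thesis
      proof (cases "bad2 J E \<or> bad4 E")
        case True
        then show ?thesis using J by blast
      next
        case False
        then have "threshold (card J) \<le> card (unequal_pairs E J)"
          and "real (card (codeg_pairs E)) < real n / real d ^ 2"
          using mid J(3) by (auto simp: bad2_def bad4_def)
        moreover have "real n / real d ^ 2 \<le> real (card J)"
          using of_nat_mono[OF less_imp_le[OF mid], where 'a = real] d_large by (simp add: field_simps)
        ultimately have "threshold (card J) \<le> card (unequal_pairs E J)" "card (codeg_pairs E) \<le> card J"
          by linarith+
        \<comment> \<open>|J| for pairs of large codegree and 2 |J| from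
          \<open>card_unequal_pairs_le\<close> make up the 3 |J|.\<close>
        then have "threshold (card J) - 3 * card J \<le> card (good_pairs E J)"
          using card_unequal_pairs_le[OF E J(1)] by linarith
        then have "bad3 J E" using mid null by (simp add: bad3_def)
        then show ?thesis using J by blast
      qed
    qed
  qed
  also have "\<dots> \<le> pr n d (\<lambda>E. ?ex bad1 E \<or> ?ex bad2 E) + pr n d (\<lambda>E. ?ex bad3 E \<or> bad4 E)"
    by (rule pr_disj)
  also have "\<dots> \<le> (pr n d (?ex bad1) + pr n d (?ex bad2)) + (pr n d (?ex bad3) + pr n d bad4)"
    by (intro add_mono pr_disj)
  also have "\<dots> \<le> (2 * (1 / real d) + 2 * (1 / real d)) + (2 * (1 / real d) + 1 / real d)"
    unfolding bad4_def by (intro add_mono b1 b2 b3 pr_codeg_pairs)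
  finally show ?thesis by simp
qed

end

subsection \<open>Real null vectors\<close>

context regime
begin

text \<open>Only nonzero null vectors, so being nonempty means singularity. Values at indices from n
  on are arbitrary, whence the restriction j < n.\<close>

definition kernel :: "(nat \<times> nat) set \<Rightarrow> (nat \<Rightarrow> real) set" where
  "kernel E = {x. (\<exists>j<n. x j \<noteq> 0) \<and> (\<forall>i<n. sum x (outs E i) = 0)}"

text \<open>Simultaneous Diophantine approximation turns a real null vector into an integer one with
  the same level sets.\<close>

lemma integer_null_vector:
  assumes E: "E \<in> digraphs n d" and x: "x \<in> kernel E"
  obtains w :: "nat \<Rightarrow> int" where "\<And>i. i < n \<Longrightarrow> sum w (outs E i) = 0"
    "\<And>j k. j < n \<Longrightarrow> k < n \<Longrightarrow> x j = x k \<Longrightarrow> w j = w k"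
    "\<exists>j<n. \<not> int (Suc d) dvd w j"
proof -
  obtain j0 where j0: "j0 < n" "x j0 \<noteq> 0" and nullx: "\<And>i. i < n \<Longrightarrow> sum x (outs E i) = 0"
    using x by (auto simp: kernel_def)
  \<comment> \<open>With y j0 = 1 the approximation at \<open>j0\<close> is within 1 of q > 0, hence
    nonzero.\<close>
  define y where "y j = x j / x j0" for j
  have y: "y j0 = 1" "\<And>i. i < n \<Longrightarrow> sum y (outs E i) = 0"
    using j0 nullx by (simp_all add: y_def flip: sum_divide_distrib)
  \<comment> \<open>Errors below 1 / (d + 2) sum over a row to less than 1, so the integral row sums
    vanish; being below 1/2, they also round equal reals to equal integers.\<close>
  define N where "N = d + 2"
  have N: "2 \<le> real N" "0 < real N" "0 < N" by (simp_all add: N_def)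
  obtain q p where q: "0 < q" and p: "\<And>i. i < n \<Longrightarrow> \<bar>of_int q * y i - of_int (p i)\<bar> < 1 / real N"
    by (rule Dirichlet_approx_simult[OF N(3), of n y]) blast
  have half: "1 / real N \<le> 1 / 2" using N by (simp add: field_simps)
  have same: "p j = p k" if "j < n" "k < n" "x j = x k" for j k
  proof -
    have "y j = y k" using that(3) by (simp add: y_def)
    then have "\<bar>of_int q * y k - of_int (p j)\<bar> < 1 / 2" "\<bar>of_int q * y k - of_int (p k)\<bar> < 1 / 2"
      using p[OF that(1)] p[OF that(2)] half by auto
    then show ?thesis by linarith
  qed
  have null: "sum p (outs E i) = 0" if i: "i < n" for i
  proof -
    have "real_of_int (sum p (outs E i)) = (\<Sum>j\<in>outs E i. real_of_int (p j) - of_int q * y j)"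
      using y(2)[OF i] by (simp add: sum_subtractf flip: sum_distrib_left)
    also have "\<bar>\<dots>\<bar> \<le> (\<Sum>j\<in>outs E i. \<bar>real_of_int (p j) - of_int q * y j\<bar>)" by (rule sum_abs)
    also have "\<dots> \<le> (\<Sum>j\<in>outs E i. 1 / real N)"
      by (rule sum_mono) (use p digraphs_lt[OF E] in \<open>auto simp: abs_minus_commute intro!: less_imp_le\<close>)
    also have "\<dots> = real d / real N" using card_outs[OF E i] by simp
    also have "\<dots> < 1" by (simp add: N_def)
    finally show ?thesis by linarith
  qed
  have "\<bar>real_of_int q - real_of_int (p j0)\<bar> < 1" using p[OF j0(1)] y(1) half by simp
  then have pj0: "p j0 \<noteq> 0" using q by linarith
  \<comment> \<open>If d + 1 divided every quotient by the gcd, then g (d + 1) would divide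
    g.\<close>
  define g where "g = Gcd (p ` {..<n})"
  have g: "g \<noteq> 0" using pj0 j0(1) by (auto simp: g_def)
  have gp: "p j = g * (p j div g)" if "j < n" for j using that by (simp add: g_def)
  show ?thesis
  proof
    fix i assume i: "i < n"
    have "g * (\<Sum>j\<in>outs E i. p j div g) = (\<Sum>j\<in>outs E i. p j)"
      unfolding sum_distrib_left by (rule sum.cong) (use gp digraphs_lt[OF E] in auto)
    then show "(\<Sum>j\<in>outs E i. p j div g) = 0" using null[OF i] g by simp
  next
    show "p j div g = p k div g" if "j < n" "k < n" "x j = x k" for j k using same[OF that] by simp
  next
    show "\<exists>j<n. \<not> int (Suc d) dvd p j div g"
    proof (rule ccontr)
      assume "\<not> (\<exists>j<n. \<not> int (Suc d) dvd p j div g)"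
      then have "g * int (Suc d) dvd p j" if "j < n" for j
        using gp[OF that] that by (metis mult_dvd_mono dvd_refl)
      then have "g * int (Suc d) dvd g" unfolding g_def by (intro Gcd_greatest) (auto simp flip: g_def)
      then have "int (Suc d) dvd 1" using g by (metis dvd_times_left_cancel_iff mult_1_right)
      then show False using d_large by simp
    qed
  qed
qed

text \<open>Subtract from the integer vector w its value c on the coordinates with x j = t. The row
  sums become - d c, which is c modulo d + 1. If z vanished modulo d + 1, so would c and hence w,
  contradicting its choice.\<close>

lemma flat_null_of_kernel:
  assumes E: "E \<in> digraphs n d" and x: "x \<in> kernel E"
    and flat: "real (card {j \<in> {..<n}. x j \<noteq> t}) * L\<^sup>2 \<le> real n"
  shows "flat_null E"
proof -
  obtain w :: "nat \<Rightarrow> int" where w: "\<And>i. i < n \<Longrightarrow> sum w (outs E i) = 0"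
    "\<And>j k. j < n \<Longrightarrow> k < n \<Longrightarrow> x j = x k \<Longrightarrow> w j = w k" "\<exists>j<n. \<not> int (Suc d) dvd w j"
    by (rule integer_null_vector[OF E x]) blast
  obtain c where c: "\<And>j. j < n \<Longrightarrow> x j = t \<Longrightarrow> w j = c"
    using w(2) by (metis (mono_tags))
  define z where "z j = w j - c" for j
  define J where "J = {j \<in> {..<n}. \<not> int (Suc d) dvd z j}"
  have zsum: "sum z (outs E i) - (- (int d * c)) = 0" if "i < n" for i
    using w(1)[OF that] card_outs[OF E that] by (simp add: z_def sum_subtractf)
  have "J \<noteq> {}"
  proof
    assume J: "J = {}"
    obtain j where j: "j < n" "\<not> int (Suc d) dvd w j" using w(3) by blast
    have zj: "int (Suc d) dvd z k" if "k < n" for k using J that by (auto simp: J_def)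
    have "int (Suc d) dvd sum z (outs E j)" by (rule dvd_sum) (use zj digraphs_lt[OF E] in auto)
    moreover have "sum z (outs E j) = - (int d * c)" using zsum[OF j(1)] by simp
    ultimately have "int (Suc d) dvd - (int d * c)" by (simp only:)
    moreover have "int (Suc d) dvd int (Suc d) * c" by simp
    ultimately have "int (Suc d) dvd - (int d * c) + int (Suc d) * c" by (rule dvd_add)
    then have "int (Suc d) dvd c" by (simp add: algebra_simps)
    then have "int (Suc d) dvd z j + c" using zj[OF j(1)] by (rule dvd_add[rotated])
    then show False using j(2) by (simp add: z_def)
  qed
  moreover have "J \<subseteq> {..<n}" by (auto simp: J_def)
  moreover have "J \<subseteq> {j \<in> {..<n}. x j \<noteq> t}" using c by (auto simp: J_def z_def)
  then have "card J \<le> card {j \<in> {..<n}. x j \<noteq> t}" by (rule card_mono[rotated]) simp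
  then have "real (card J) * L\<^sup>2 \<le> real (card {j \<in> {..<n}. x j \<noteq> t}) * L\<^sup>2"
    by (intro mult_right_mono) auto
  then have "real (card J) * L\<^sup>2 \<le> real n" using flat by linarith
  moreover have "null_mod (Suc d) J E" unfolding null_mod_def
    by (rule exI[of _ z], rule exI[of _ "- (int d * c)"]) (use zsum in \<open>simp add: J_def\<close>)
  ultimately show ?thesis unfolding flat_null_def by blast
qed

end

text \<open>Take the least value t with at least \<open>a\<close> entries at or below it. Fewer than
  \<open>a\<close> lie strictly below, so of the at least 2 a entries different from t at least
  \<open>a\<close> lie above.\<close>

lemma balanced_threshold:
  fixes x :: "'a \<Rightarrow> real" and a :: real
  assumes N: "finite N" and a: "0 < a" and spread: "\<And>t. 2 * a \<le> real (card {j \<in> N. x j \<noteq> t})"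
  shows "\<exists>t. a \<le> real (card {j \<in> N. t < x j}) \<and> a \<le> real (card {j \<in> N. x j \<le> t})"
proof -
  have "N \<noteq> {}" using spread[of 0] a by auto
  define T where "T = {t \<in> x ` N. a \<le> real (card {j \<in> N. x j \<le> t})}"
  have "Max (x ` N) \<in> T"
  proof -
    have "{j \<in> N. x j \<noteq> 0} \<subseteq> {j \<in> N. x j \<le> Max (x ` N)}" using N by auto
    then have "card {j \<in> N. x j \<noteq> 0} \<le> card {j \<in> N. x j \<le> Max (x ` N)}"
      by (rule card_mono[rotated]) (use N in simp)
    moreover have "a \<le> real (card {j \<in> N. x j \<noteq> 0})" using spread[of 0] a by linarith
    ultimately show ?thesis using N \<open>N \<noteq> {}\<close> by (simp add: T_def)
  qed
  then have T: "finite T" "T \<noteq> {}" using N by (auto simp: T_def)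
  define t where "t = Min T"
  have tT: "t \<in> T" using T by (simp add: t_def)
  have below: "real (card {j \<in> N. x j < t}) < a"
  proof (cases "{j \<in> N. x j < t} = {}")
    case False
    define u where "u = Max (x ` {j \<in> N. x j < t})"
    have "u \<in> x ` {j \<in> N. x j < t}" unfolding u_def by (rule Max_in) (use N False in auto)
    then have u: "u \<in> x ` N" "u < t" by auto
    have "{j \<in> N. x j < t} = {j \<in> N. x j \<le> u}" using u(2) N by (auto simp: u_def)
    moreover have "u \<notin> T" using u(2) T Min_le[of T u] by (auto simp: t_def)
    ultimately show ?thesis using u(1) by (simp add: T_def)
  next
    case True
    then have "card {j \<in> N. x j < t} = 0" by (simp only: card.empty)
    then show ?thesis using a by simp
  qed
  have "{j \<in> N. x j \<noteq> t} \<subseteq> {j \<in> N. x j < t} \<union> {j \<in> N. t < x j}" by auto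
  then have "card {j \<in> N. x j \<noteq> t} \<le> card ({j \<in> N. x j < t} \<union> {j \<in> N. t < x j})"
    by (rule card_mono[rotated]) (use N in simp)
  also have "\<dots> \<le> card {j \<in> N. x j < t} + card {j \<in> N. t < x j}" by (rule card_Un_le)
  finally have "a \<le> real (card {j \<in> N. t < x j})" using below spread[of t] by linarith
  then show ?thesis using tT by (auto simp: T_def)
qed

section \<open>Sensitive pairs of rows and the probability of singularity\<close>

context regime
begin

definition large :: "(nat \<Rightarrow> real) \<Rightarrow> real \<Rightarrow> bool" where
  "large x t \<longleftrightarrow> real n / (3 * L\<^sup>2) \<le> real (card {j \<in> {..<n}. t < x j})
     \<and> real n / (3 * L\<^sup>2) \<le> real (card {j \<in> {..<n}. x j \<le> t})"

text \<open>The choice depends on the kernel alone, and \<open>cut\<close> on the vector alone. Both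
  are therefore constant in \<open>pr_sensitive\<close>, where resampling keeps the kernel.\<close>

definition null_vec :: "(nat \<times> nat) set \<Rightarrow> nat \<Rightarrow> real" where
  "null_vec E = (SOME x. x \<in> kernel E)"

definition cut :: "(nat \<Rightarrow> real) \<Rightarrow> real" where
  "cut x = (SOME t. large x t)"

text \<open>The left null vector certifies that the kernel survives resampling; the two counts
  supply the k of \<open>halves_fixed_sum_le\<close>.\<close>

definition sensitive :: "(nat \<times> nat) set \<Rightarrow> nat \<Rightarrow> nat \<Rightarrow> bool" where
  "sensitive E i j \<longleftrightarrow> kernel E \<noteq> {} \<and> (\<exists>y\<in>kernel (E\<inverse>). y i \<noteq> y j)
    \<and> real d / (60 * L\<^sup>2) \<le> real (card {a \<in> dif E i j. cut (null_vec E) < null_vec E a})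
    \<and> real d / (60 * L\<^sup>2) \<le> real (card {a \<in> dif E i j. null_vec E a \<le> cut (null_vec E)})"

text \<open>If some left null vector separates rows $i$ and $j$, then both rows are spanned by the other
  rows and the sum of the two, so the kernel does not change when the pair is resampled.\<close>

lemma kernel_separated:
  assumes E: "E \<in> digraphs n d" and ij: "i < n" "j < n" "i \<noteq> j"
    and y: "y \<in> kernel (E\<inverse>)" "y i \<noteq> y j"
  shows "kernel E = {x. (\<exists>k<n. x k \<noteq> 0) \<and> (\<forall>k<n. k \<noteq> i \<and> k \<noteq> j \<longrightarrow> sum x (outs E k) = 0)
    \<and> sum x (outs E i) + sum x (outs E j) = 0}" (is "_ = ?W")
proof
  show "kernel E \<subseteq> ?W" using ij by (auto simp: kernel_def)
  show "?W \<subseteq> kernel E"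
  proof
    fix x assume x: "x \<in> ?W"
    have finE: "finite E" by (rule finite_digraph[OF E])
    have outsE: "outs (E\<inverse>) a = ins E a" for a by auto
    \<comment> \<open>Pairing y with the row sums of x gives 0. Only rows i and j contribute, with
      opposite row sums, so (y i - y j) times the first is 0.\<close>
    have "(\<Sum>k<n. y k * sum x (outs E k)) = (\<Sum>k<n. \<Sum>a<n. if (k, a) \<in> E then y k * x a else 0)"
    proof (rule sum.cong)
      fix k
      have "outs E k = {a \<in> {..<n}. (k, a) \<in> E}" using digraphs_lt[OF E] by auto
      then show "y k * sum x (outs E k) = (\<Sum>a<n. if (k, a) \<in> E then y k * x a else 0)"
        by (simp add: sum_distrib_left sum.If_cases Int_def)
    qed simp
    also have "\<dots> = (\<Sum>a<n. \<Sum>k<n. if (k, a) \<in> E then y k * x a else 0)" by (rule sum.swap)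
    also have "\<dots> = (\<Sum>a<n. sum y (ins E a) * x a)"
    proof (rule sum.cong)
      fix a
      have "ins E a = {k \<in> {..<n}. (k, a) \<in> E}" using digraphs_lt[OF E] by auto
      then show "(\<Sum>k<n. if (k, a) \<in> E then y k * x a else 0) = sum y (ins E a) * x a"
        by (simp add: sum_distrib_right sum.If_cases Int_def)
    qed simp
    also have "\<dots> = 0" using y(1) by (intro sum.neutral) (simp add: kernel_def outsE)
    finally have "(\<Sum>k<n. y k * sum x (outs E k)) = 0" .
    moreover have "(\<Sum>k<n. y k * sum x (outs E k)) = (\<Sum>k\<in>{i, j}. y k * sum x (outs E k))"
      by (rule sum.mono_neutral_right) (use x ij in auto)
    ultimately have "y i * sum x (outs E i) + y j * sum x (outs E j) = 0" using ij by simp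
    moreover have s: "sum x (outs E j) = - sum x (outs E i)" using x by auto
    ultimately have "(y i - y j) * sum x (outs E i) = 0" by (simp add: algebra_simps)
    then have "sum x (outs E i) = 0" "sum x (outs E j) = 0" using y(2) s by auto
    then show "x \<in> kernel E" using x by (auto simp: kernel_def)
  qed
qed

text \<open>In \<open>kernel_separated\<close> the pair enters only through the sum of its rows,
  which \<open>put\<close> preserves. Each of the two digraphs brings its own separating left null
  vector.\<close>

lemma kernel_put_eq:
  assumes E: "E \<in> digraphs n d" and ij: "i < n" "j < n" "i \<noteq> j"
    and T: "T \<in> halves (dif E i j)" "T' \<in> halves (dif E i j)"
    and sep: "\<exists>y\<in>kernel ((put E i j T)\<inverse>). y i \<noteq> y j" "\<exists>y\<in>kernel ((put E i j T')\<inverse>). y i \<noteq> y j"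
  shows "kernel (put E i j T) = kernel (put E i j T')"
proof -
  have s: "sum x (outs (put E i j U) i) + sum x (outs (put E i j U) j)
    = 2 * sum x (outs E i \<inter> outs E j) + sum x (dif E i j)" if U: "U \<in> halves (dif E i j)"
    for x :: "nat \<Rightarrow> real" and U
  proof -
    have US: "U \<subseteq> dif E i j" using U by (simp add: halves_def)
    have fin: "finite (dif E i j)" "finite U" using finite_dif[OF E] finite_subset[OF US] by auto
    have "sum x (outs E i \<inter> outs E j \<union> U) = sum x (outs E i \<inter> outs E j) + sum x U"
      by (rule sum.union_disjoint) (use US fin finite_outs[OF E] in \<open>auto simp: dif_def\<close>)
    moreover have "sum x (outs E i \<inter> outs E j \<union> (dif E i j - U)) = sum x (outs E i \<inter> outs E j) + sum x (dif E i j - U)"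
      by (rule sum.union_disjoint) (use US fin finite_outs[OF E] in \<open>auto simp: dif_def\<close>)
    moreover have "sum x (dif E i j) = sum x (dif E i j - U) + sum x U"
      by (rule sum.subset_diff[OF US fin(1)])
    ultimately show ?thesis using ij by (simp add: outs_put)
  qed
  obtain y y' where y: "y \<in> kernel ((put E i j T)\<inverse>)" "y i \<noteq> y j"
    and y': "y' \<in> kernel ((put E i j T')\<inverse>)" "y' i \<noteq> y' j" using sep by blast
  show ?thesis
    unfolding kernel_separated[OF put_in_digraphs[OF E ij T(1)] ij y]
      kernel_separated[OF put_in_digraphs[OF E ij T(2)] ij y'] s[OF T(1)] s[OF T(2)]
    using ij by (simp add: outs_put)
qed

text \<open>All sensitive members of an orbit share kernel, \<open>null_vec\<close> and
  \<open>cut\<close>. With x taken from one of them, the vanishing of row i on x prescribes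
  \<open>sum x T\<close>, and \<open>halves_fixed_sum_le\<close> applies.\<close>

lemma pr_sensitive:
  assumes ij: "i < n" "j < n" "i \<noteq> j"
  shows "pr n d (\<lambda>E. sensitive E i j) \<le> 2 / sqrt (real d / (60 * L\<^sup>2))"
proof (rule pr_leI)
  let ?k = "real d / (60 * L\<^sup>2)"
  let ?B = "{E \<in> digraphs n d. sensitive E i j}"
  have k: "0 < ?k" using d_large L by (intro divide_pos_pos) auto
  show "0 \<le> 2 / sqrt ?k" using k by simp
  show "real (card ?B) \<le> 2 / sqrt ?k * real (card (digraphs n d))"
  proof (rule resampling[OF ij])
    fix E assume E: "E \<in> digraphs n d"
    let ?S = "dif E i j" and ?C = "outs E i \<inter> outs E j"
    let ?bad = "{T \<in> halves ?S. put E i j T \<in> ?B}"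
    have finS: "finite ?S" by (rule finite_dif[OF E])
    show "real (card ?bad) \<le> 2 / sqrt ?k * real (card (halves ?S))"
    proof (cases "?bad = {}")
      case True
      then have "card ?bad = 0" by (simp only: card.empty)
      then show ?thesis using k by (simp only:) simp
    next
      case False
      then obtain T0 where T0: "T0 \<in> halves ?S" "sensitive (put E i j T0) i j" by auto
      define x where "x = null_vec (put E i j T0)"
      have dif0: "dif (put E i j T0) i j = ?S" using dif_put(1)[OF ij(3)] T0(1) by (simp add: halves_def)
      have "?bad \<subseteq> {T \<in> halves ?S. sum x T = - sum x ?C}"
      proof
        fix T assume "T \<in> ?bad"
        then have T: "T \<in> halves ?S" "sensitive (put E i j T) i j" by auto
        then have TS: "T \<subseteq> ?S" "finite T" using finS finite_subset by (auto simp: halves_def)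
        have "kernel (put E i j T) = kernel (put E i j T0)"
          by (rule kernel_put_eq[OF E ij T(1) T0(1)]) (use T(2) T0(2) in \<open>auto simp: sensitive_def\<close>)
        then have "x = null_vec (put E i j T)" by (simp add: x_def null_vec_def)
        moreover have "kernel (put E i j T) \<noteq> {}" using T(2) by (simp add: sensitive_def)
        ultimately have "x \<in> kernel (put E i j T)" by (simp add: null_vec_def some_in_eq)
        then have "sum x (outs (put E i j T) i) = 0" using ij by (simp add: kernel_def)
        moreover have "sum x (outs (put E i j T) i) = sum x ?C + sum x T"
          unfolding outs_put[OF ij(3)] by (simp, rule sum.union_disjoint)
            (use TS finite_outs[OF E] in \<open>auto simp: dif_def\<close>)
        ultimately show "T \<in> {T \<in> halves ?S. sum x T = - sum x ?C}" using T by simp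
      qed
      then have "card ?bad \<le> card {T \<in> halves ?S. sum x T = - sum x ?C}"
        by (rule card_mono[rotated]) (use finite_halves[OF finS] in simp)
      also have "real \<dots> \<le> 2 / sqrt ?k * real (card (halves ?S))"
        by (rule halves_fixed_sum_le[OF finS k, where t = "cut x"])
          (use T0(2) in \<open>simp_all add: sensitive_def dif0 x_def\<close>)
      finally show ?thesis by simp
    qed
  qed (use put_in_digraphs[OF _ ij] in auto)
qed

text \<open>At most a tenth of the typical number d |I| |A| / n of edges; the size condition on
  \<open>A\<close> matches \<open>large\<close>.\<close>

definition sparse_block :: "(nat \<times> nat) set \<Rightarrow> nat set \<Rightarrow> nat set \<Rightarrow> bool" where
  "sparse_block E I A \<longleftrightarrow> real n \<le> 16 * L\<^sup>2 * real (card I) \<and> real n \<le> 3 * L\<^sup>2 * real (card A)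
    \<and> 10 * real n * real (card (E \<inter> (I \<times> A))) \<le> real d * real (card I) * real (card A)"

text \<open>There are 4^n pairs of sets, so 2^(-3 n) for each suffices. Take q = 3 n in
  \<open>pr_few_edges\<close>: a tenth of the mean plus 3 n is at most a fifth once the mean is at
  least 30 n. This follows from \<open>d_poly\<close>, as |I| |A| >= n^2 / (48 L^4).\<close>

lemma pr_sparse_block: "pr n d (\<lambda>E. \<exists>I\<subseteq>{..<n}. \<exists>A\<subseteq>{..<n}. sparse_block E I A) \<le> 1 / real d"
proof -
  let ?P = "Pow {..<n} \<times> Pow {..<n}"
  have n: "0 < n" and d0: "0 < real d" using n_ge' d_large by auto
  have "pr n d (\<lambda>E. \<exists>I\<subseteq>{..<n}. \<exists>A\<subseteq>{..<n}. sparse_block E I A)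
    \<le> pr n d (\<lambda>E. \<exists>v\<in>?P. sparse_block E (fst v) (snd v))"
    by (rule pr_mono) force
  also have "\<dots> \<le> (\<Sum>v\<in>?P. pr n d (\<lambda>E. sparse_block E (fst v) (snd v)))" by (rule pr_Bex) simp
  also have "\<dots> \<le> (\<Sum>v\<in>?P. 1 / 2 ^ (3 * n))"
  proof (rule sum_mono)
    fix v assume v: "v \<in> ?P"
    define I A where "I = fst v" and "A = snd v"
    have IA: "I \<subseteq> {..<n}" "A \<subseteq> {..<n}" using v by (auto simp: I_def A_def)
    show "pr n d (\<lambda>E. sparse_block E (fst v) (snd v)) \<le> 1 / 2 ^ (3 * n)"
    proof (cases "real n \<le> 16 * L\<^sup>2 * real (card I) \<and> real n \<le> 3 * L\<^sup>2 * real (card A)")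
      case False
      then have "(\<lambda>E. sparse_block E (fst v) (snd v)) = (\<lambda>E. False)"
        by (auto simp: sparse_block_def I_def A_def)
      then show ?thesis by (simp add: pr_def)
    next
      case True
      define M where "M = d * card I * card A"
      have L0: "0 < L\<^sup>2" using L by simp
      have "real n * real n \<le> (16 * L\<^sup>2 * real (card I)) * (3 * L\<^sup>2 * real (card A))"
        by (rule mult_mono) (use True in auto)
      also have "\<dots> = 48 * L ^ 4 * (real (card I) * real (card A))" by (simp add: eval_nat_numeral)
      finally have nn: "real n * real n \<le> 48 * L ^ 4 * (real (card I) * real (card A))" .
      have "2000 * L ^ 4 * (real (card I) * real (card A)) \<le> real d * (real (card I) * real (card A))"
        by (rule mult_right_mono[OF d_poly]) simp
      moreover have "0 \<le> L ^ 4 * (real (card I) * real (card A))" by simp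
      ultimately have "30 * (real n * real n) \<le> real d * (real (card I) * real (card A))"
        using nn unfolding mult.assoc[of _ "L ^ 4"] by linarith
      then have "real (30 * n * n) \<le> real M" by (simp add: M_def mult_ac)
      then have M: "30 * n * n \<le> M" by (simp only: of_nat_le_iff)
      have cA: "16 * d \<le> card A"
      proof -
        have "L\<^sup>2 * (1500 * real d) \<le> L\<^sup>2 * (3 * real (card A))"
          using sparse True by (simp add: mult_ac)
        then have "1500 * real d \<le> 3 * real (card A)" using L0 by (simp only: mult_le_cancel_left_pos)
        then show ?thesis by linarith
      qed
      define T where "T = M div (10 * n)"
      have TM: "10 * n * T \<le> M" by (simp add: T_def)
      have "pr n d (\<lambda>E. sparse_block E (fst v) (snd v)) \<le> pr n d (\<lambda>E. card (E \<inter> (I \<times> A)) \<le> T)"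
      proof (rule pr_mono)
        fix E assume "sparse_block E (fst v) (snd v)"
        then have "real (10 * n * card (E \<inter> (I \<times> A))) \<le> real M"
          by (simp add: sparse_block_def I_def A_def M_def)
        then have "10 * n * card (E \<inter> (I \<times> A)) \<le> M" by (simp only: of_nat_le_iff)
        then show "card (E \<inter> (I \<times> A)) \<le> T"
          using n by (simp add: T_def less_eq_div_iff_mult_less_eq mult.commute)
      qed
      also have "\<dots> \<le> 1 / 2 ^ (3 * n)"
      proof (rule pr_few_edges[OF n IA cA])
        have "2 * (5 * (T + 3 * n) * n) = 10 * n * T + 30 * n * n" by (simp add: algebra_simps)
        also have "\<dots> \<le> M + M" by (rule add_mono[OF TM M])
        finally have "2 * (5 * (T + 3 * n) * n) \<le> 2 * M" by (simp only: mult_2)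
        then have "5 * (T + 3 * n) * n \<le> M" by (rule mult_left_le_imp_le) simp
        then show "5 * (T + 3 * n) * n \<le> d * card I * card A" by (simp only: M_def)
      qed
      finally show ?thesis .
    qed
  qed
  also have "\<dots> = 1 / 2 ^ n"
  proof -
    have "(2::real) ^ (3 * n) = 2 ^ n * 2 ^ n * 2 ^ n" by (simp flip: power_add)
    then show ?thesis by (simp add: card_cartesian_product card_Pow)
  qed
  also have "\<dots> \<le> 1 / real d"
  proof -
    have "real d \<le> real n" using n_ge by simp
    also have "\<dots> \<le> 2 ^ n" using less_exp[of n] by (simp add: less_imp_le)
    finally show ?thesis using d0 by (intro divide_left_mono) auto
  qed
  finally show ?thesis .
qed

definition offdiag :: "(nat \<times> nat) set" where
  "offdiag = {(i, j). i < n \<and> j < n \<and> i \<noteq> j}"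

lemma offdiag: "finite offdiag" "card offdiag \<le> n * n"
proof -
  have sub: "offdiag \<subseteq> {..<n} \<times> {..<n}" by (auto simp: offdiag_def)
  then show "finite offdiag" by (rule finite_subset) simp
  show "card offdiag \<le> n * n" using card_mono[OF _ sub] by simp
qed

text \<open>Serves twice: to show that large codegrees are rare and, as singularity forces many
  sensitive pairs outside exceptional events, to bound singularity itself.\<close>

lemma pr_offdiag_many:
  assumes a: "0 < a" and p: "0 \<le> p" "\<And>i j. i < n \<Longrightarrow> j < n \<Longrightarrow> i \<noteq> j \<Longrightarrow> pr n d (\<lambda>E. P E i j) \<le> p"
  shows "pr n d (\<lambda>E. real n ^ 2 / a \<le> real (card {e \<in> offdiag. P E (fst e) (snd e)})) \<le> a * p"
proof -
  have n: "0 < real n" using n_ge' d_large by auto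
  have "pr n d (\<lambda>E. real n ^ 2 / a \<le> real (card {e \<in> offdiag. P E (fst e) (snd e)}))
    \<le> (\<Sum>e\<in>offdiag. pr n d (\<lambda>E. P E (fst e) (snd e))) / (real n ^ 2 / a)"
    by (rule pr_markov) (use offdiag n a in auto)
  also have "\<dots> \<le> (real n ^ 2 * p) / (real n ^ 2 / a)"
  proof (rule divide_right_mono)
    have "(\<Sum>e\<in>offdiag. pr n d (\<lambda>E. P E (fst e) (snd e))) \<le> (\<Sum>e\<in>offdiag. p)"
      by (rule sum_mono) (auto simp: offdiag_def p)
    also have "\<dots> = real (card offdiag) * p" by simp
    also have "\<dots> \<le> real (n * n) * p" by (intro mult_right_mono of_nat_mono offdiag p)
    finally show "(\<Sum>e\<in>offdiag. pr n d (\<lambda>E. P E (fst e) (snd e))) \<le> real n ^ 2 * p"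
      by (simp add: power2_eq_square)
  qed (use a in simp)
  also have "\<dots> = a * p" using n a by simp
  finally show ?thesis .
qed

text \<open>At least 7/8 of the rows see enough of both sides of the cut, and non-flatness of y
  gives each at least n / L^2 partners with another value of y. Discarding fewer than n^2 / (4 L^2)
  pairs of large codegree leaves 7/8 - 1/4 >= 1/2 of n^2 / L^2.\<close>

lemma many_sensitive_pairs:
  assumes E: "E \<in> digraphs n d" and ker: "kernel E \<noteq> {}" "kernel (E\<inverse>) \<noteq> {}"
    and nf: "\<not> flat_null E" "\<not> flat_null (E\<inverse>)"
    and ns: "\<not> (\<exists>I\<subseteq>{..<n}. \<exists>A\<subseteq>{..<n}. sparse_block E I A)"
    and nc: "real (card {e \<in> offdiag. codeg_bound \<le> codeg E (fst e) (snd e)}) < real n ^ 2 / (4 * L\<^sup>2)"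
  shows "real n ^ 2 / (2 * L\<^sup>2) \<le> real (card {e \<in> offdiag. sensitive E (fst e) (snd e)})"
proof -
  have L0: "0 < L\<^sup>2" and L1: "1 \<le> L\<^sup>2" using L by (auto simp: one_le_power)
  have n: "0 < real n" using n_ge' d_large by auto
  obtain y where y: "y \<in> kernel (E\<inverse>)" using ker(2) by blast
  define x where "x = null_vec E"
  have x: "x \<in> kernel E" using ker(1) by (simp add: x_def null_vec_def some_in_eq)
  have spread: "real n / L\<^sup>2 \<le> real (card {k \<in> {..<n}. v k \<noteq> t})"
    if "F \<in> digraphs n d" "v \<in> kernel F" "\<not> flat_null F" for F v t
  proof (rule ccontr)
    assume "\<not> real n / L\<^sup>2 \<le> real (card {k \<in> {..<n}. v k \<noteq> t})"
    then have "real (card {k \<in> {..<n}. v k \<noteq> t}) * L\<^sup>2 \<le> real n"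
      using L0 by (simp only: not_le pos_less_divide_eq less_imp_le)
    then show False using flat_null_of_kernel[OF that(1,2)] that(3) by blast
  qed
  have Econv: "E\<inverse> \<in> digraphs n d" using E by simp
  note ysp = spread[OF Econv y nf(2)] and xsp = spread[OF E x nf(1)]
  have "\<exists>t. large x t" unfolding large_def
  proof (rule balanced_threshold)
    show "0 < real n / (3 * L\<^sup>2)" using n L0 by (intro divide_pos_pos) auto
    show "2 * (real n / (3 * L\<^sup>2)) \<le> real (card {j \<in> {..<n}. x j \<noteq> t})" for t
    proof -
      have "2 * (real n / (3 * L\<^sup>2)) \<le> real n / L\<^sup>2" using n L0 by (simp add: field_simps)
      then show ?thesis using xsp[of t] by linarith
    qed
  qed simp
  then have cut: "large x (cut x)" unfolding cut_def by (rule someI_ex)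
  define A B where "A = {k \<in> {..<n}. cut x < x k}" and "B = {k \<in> {..<n}. x k \<le> cut x}"
  have AB: "real n / (3 * L\<^sup>2) \<le> real (card A)" "real n / (3 * L\<^sup>2) \<le> real (card B)"
    using cut by (simp_all add: large_def A_def B_def)
  \<comment> \<open>Rows with at most a tenth of their typical number of neighbours in
    \<open>S\<close>. They form a sparse block with a large \<open>S\<close> unless there are fewer
    than n / (16 L^2) of them.\<close>
  define poor where "poor S = {i \<in> {..<n}. 10 * real n * real (card (outs E i \<inter> S)) \<le> real d * real (card S)}" for S
  have poor_sub: "poor S \<subseteq> {..<n}" for S by (auto simp: poor_def)
  have poor: "real (card (poor S)) \<le> real n / 16"
    if S: "S \<subseteq> {..<n}" "real n / (3 * L\<^sup>2) \<le> real (card S)" for S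
  proof -
    have "10 * real n * real (card (E \<inter> (poor S \<times> S))) = (\<Sum>i\<in>poor S. 10 * real n * real (card (outs E i \<inter> S)))"
      by (subst card_edges_rows) (use finite_digraph[OF E] in \<open>auto simp: poor_def sum_distrib_left\<close>)
    also have "\<dots> \<le> (\<Sum>i\<in>poor S. real d * real (card S))" by (rule sum_mono) (simp add: poor_def)
    also have "\<dots> = real d * real (card (poor S)) * real (card S)" by simp
    finally have "10 * real n * real (card (E \<inter> (poor S \<times> S))) \<le> real d * real (card (poor S)) * real (card S)" .
    moreover have "real n \<le> 3 * L\<^sup>2 * real (card S)" using S(2) L0 by (simp add: field_simps)
    moreover have "\<not> sparse_block E (poor S) S" using ns S(1) poor_sub by blast
    ultimately have "16 * L\<^sup>2 * real (card (poor S)) < real n" by (auto simp: sparse_block_def)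
    moreover have "16 * 1 * real (card (poor S)) \<le> 16 * L\<^sup>2 * real (card (poor S))"
      by (intro mult_right_mono mult_left_mono L1) auto
    ultimately show ?thesis by simp
  qed
  define R where "R = {..<n} - poor A - poor B"
  have finR: "finite R" by (simp add: R_def)
  have cR: "7 / 8 * real n \<le> real (card R)"
  proof -
    have "{..<n} \<subseteq> R \<union> poor A \<union> poor B" by (auto simp: R_def)
    then have "card {..<n} \<le> card (R \<union> poor A \<union> poor B)"
      by (rule card_mono[rotated]) (simp add: R_def poor_def)
    also have "\<dots> \<le> card R + card (poor A) + card (poor B)"
      by (rule order_trans[OF card_Un_le]) (simp add: card_Un_le)
    finally have "real n \<le> real (card R) + real (card (poor A)) + real (card (poor B))" by simp
    moreover have "real (card (poor A)) \<le> real n / 16" by (rule poor[OF _ AB(1)]) (auto simp: A_def)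
    moreover have "real (card (poor B)) \<le> real n / 16" by (rule poor[OF _ AB(2)]) (auto simp: B_def)
    ultimately show ?thesis by linarith
  qed
  define W where "W = (SIGMA i:R. {k \<in> {..<n}. y k \<noteq> y i})"
  define Cd where "Cd = {e \<in> offdiag. codeg_bound \<le> codeg E (fst e) (snd e)}"
  have finCd: "finite Cd" using offdiag(1) by (simp add: Cd_def)
  have sens: "sensitive E i j" if ij: "(i, j) \<in> W" "(i, j) \<notin> Cd" for i j
  proof -
    have i: "i < n" "i \<notin> poor A" "i \<notin> poor B" and j: "j < n" "y j \<noteq> y i"
      using ij(1) by (auto simp: W_def R_def)
    then have "(i, j) \<in> offdiag" by (auto simp: offdiag_def)
    then have "codeg E i j < codeg_bound" using ij(2) by (simp add: Cd_def)
    then have cd: "real (codeg E i j) < real d / (60 * L\<^sup>2)" unfolding codeg_bound_def by linarith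
    have big: "real d / (60 * L\<^sup>2) \<le> real (card (dif E i j \<inter> S))"
      if S: "i \<notin> poor S" "real n / (3 * L\<^sup>2) \<le> real (card S)" for S
    proof -
      have "real d * (real n / (3 * L\<^sup>2)) \<le> real d * real (card S)" by (rule mult_left_mono[OF S(2)]) simp
      also have "\<dots> < 10 * real n * real (card (outs E i \<inter> S))" using S(1) i(1) by (simp add: poor_def)
      finally have "real d / (30 * L\<^sup>2) < real (card (outs E i \<inter> S))"
        using n L0 by (simp add: field_simps)
      moreover have "card (outs E i \<inter> S) \<le> card ((dif E i j \<inter> S) \<union> (outs E i \<inter> outs E j))"
        by (rule card_mono) (use finite_dif[OF E] finite_outs[OF E] in \<open>auto simp: dif_def\<close>)
      then have "card (outs E i \<inter> S) \<le> card (dif E i j \<inter> S) + codeg E i j"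
        using card_Un_le[of "dif E i j \<inter> S" "outs E i \<inter> outs E j"] unfolding codeg_def by linarith
      moreover have "real d / (30 * L\<^sup>2) = 2 * (real d / (60 * L\<^sup>2))" by simp
      ultimately show ?thesis using cd by linarith
    qed
    have dn: "dif E i j \<subseteq> {..<n}" using digraphs_lt[OF E] by (auto simp: dif_def)
    have "dif E i j \<inter> A = {a \<in> dif E i j. cut x < x a}" "dif E i j \<inter> B = {a \<in> dif E i j. x a \<le> cut x}"
      using dn by (auto simp: A_def B_def)
    then have "real d / (60 * L\<^sup>2) \<le> real (card {a \<in> dif E i j. cut x < x a})"
      "real d / (60 * L\<^sup>2) \<le> real (card {a \<in> dif E i j. x a \<le> cut x})"
      using big[OF i(2) AB(1)] big[OF i(3) AB(2)] by simp_all
    moreover have "\<exists>y\<in>kernel (E\<inverse>). y i \<noteq> y j" using y j(2) by metis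
    ultimately show ?thesis using ker(1) by (simp add: sensitive_def x_def)
  qed
  have "7 / 8 * real n * (real n / L\<^sup>2) \<le> real (card R) * (real n / L\<^sup>2)"
    by (rule mult_right_mono[OF cR]) simp
  also have "\<dots> = (\<Sum>i\<in>R. real n / L\<^sup>2)" by simp
  also have "\<dots> \<le> (\<Sum>i\<in>R. real (card {k \<in> {..<n}. y k \<noteq> y i}))" by (rule sum_mono) (rule ysp)
  also have "\<dots> = real (card W)" using finR by (simp add: W_def)
  also have "\<dots> \<le> real (card {e \<in> offdiag. sensitive E (fst e) (snd e)}) + real (card Cd)"
  proof -
    have "W \<subseteq> {e \<in> offdiag. sensitive E (fst e) (snd e)} \<union> Cd"
    proof
      fix e assume e: "e \<in> W"
      then have "e \<in> offdiag" by (auto simp: W_def R_def offdiag_def)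
      then show "e \<in> {e \<in> offdiag. sensitive E (fst e) (snd e)} \<union> Cd"
        using sens[of "fst e" "snd e"] e by auto
    qed
    then have "card W \<le> card ({e \<in> offdiag. sensitive E (fst e) (snd e)} \<union> Cd)"
      by (rule card_mono[rotated]) (use offdiag(1) finCd in simp)
    also have "\<dots> \<le> card {e \<in> offdiag. sensitive E (fst e) (snd e)} + card Cd" by (rule card_Un_le)
    finally show ?thesis by linarith
  qed
  finally have "7 / 8 * (real n ^ 2 / L\<^sup>2) \<le> real (card {e \<in> offdiag. sensitive E (fst e) (snd e)}) + real (card Cd)"
    by (simp add: power2_eq_square)
  moreover have "real (card Cd) < 1 / 4 * (real n ^ 2 / L\<^sup>2)" using nc by (simp add: Cd_def)
  moreover have "0 \<le> real n ^ 2 / L\<^sup>2" by simp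
  moreover have "q / 2 \<le> a" if "7 / 8 * q \<le> a + b" "b < 1 / 4 * q" "0 \<le> q" for a b q :: real
    using that by linarith
  ultimately have "real n ^ 2 / L\<^sup>2 / 2 \<le> real (card {e \<in> offdiag. sensitive E (fst e) (snd e)})"
    by blast
  then show ?thesis by simp
qed

text \<open>The exceptional events cost 7 + 7 + 1 + 1 = 16 times 1 / d <= L^3 / sqrt d. The main
  term is 2 L^2, the inverse proportion of sensitive pairs, times the bound of
  \<open>pr_sensitive\<close>; here 4 sqrt 60 <= 32.\<close>

lemma pr_singular: "pr n d (\<lambda>E. kernel E \<noteq> {} \<and> kernel (E\<inverse>) \<noteq> {}) \<le> 60 * L ^ 3 / sqrt (real d)"
proof -
  let ?sp = "\<lambda>E. \<exists>I\<subseteq>{..<n}. \<exists>A\<subseteq>{..<n}. sparse_block E I A"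
  let ?cd = "\<lambda>E. real n ^ 2 / (4 * L\<^sup>2) \<le> real (card {e \<in> offdiag. codeg_bound \<le> codeg E (fst e) (snd e)})"
  let ?sn = "\<lambda>E. real n ^ 2 / (2 * L\<^sup>2) \<le> real (card {e \<in> offdiag. sensitive E (fst e) (snd e)})"
  have L0: "0 < L\<^sup>2" "0 < L" "1 \<le> L" using L by auto
  have d1: "1 \<le> real d" using d_large by simp
  have cd: "pr n d ?cd \<le> 4 * L\<^sup>2 * (1 / real d ^ 3)"
  proof (rule pr_offdiag_many)
    fix i j assume ij: "i < n" "j < n" "i \<noteq> (j::nat)"
    have "pr n d (\<lambda>E. codeg_bound \<le> codeg E i j) \<le> (1 / 2) ^ codeg_bound"
      by (rule pr_codeg) (use codeg_bound(1-4) d_large n_ge' ij in auto)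
    then show "pr n d (\<lambda>E. codeg_bound \<le> codeg E i j) \<le> 1 / real d ^ 3"
      using codeg_bound(5) by linarith
  qed (use L0 in auto)
  have cd': "4 * L\<^sup>2 * (1 / real d ^ 3) \<le> 1 / real d"
  proof -
    have "4 * L\<^sup>2 \<le> 8 * real d" using L_sq_le_d by simp
    also have "\<dots> \<le> real d * real d" by (rule mult_right_mono) (use d_large in auto)
    finally have "4 * L\<^sup>2 * (1 / real d ^ 3) \<le> real d * real d * (1 / real d ^ 3)"
      by (rule mult_right_mono) simp
    then show ?thesis using d1 by (simp add: eval_nat_numeral)
  qed
  have sn: "pr n d ?sn \<le> 2 * L\<^sup>2 * (2 / sqrt (real d / (60 * L\<^sup>2)))"
    by (rule pr_offdiag_many) (use L0 pr_sensitive in auto)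
  have sn': "2 * L\<^sup>2 * (2 / sqrt (real d / (60 * L\<^sup>2))) \<le> 32 * L ^ 3 / sqrt (real d)"
  proof -
    have "sqrt (real d / (60 * L\<^sup>2)) = sqrt (real d) / (sqrt 60 * L)"
      using L0 by (simp add: real_sqrt_divide real_sqrt_mult)
    then have "2 * L\<^sup>2 * (2 / sqrt (real d / (60 * L\<^sup>2))) = 4 * sqrt 60 * L ^ 3 / sqrt (real d)"
      by (simp add: eval_nat_numeral)
    also have "sqrt 60 \<le> sqrt (8\<^sup>2)" by (rule real_sqrt_le_mono) simp
    then have "sqrt 60 \<le> 8" by simp
    then have "4 * sqrt 60 * L ^ 3 / sqrt (real d) \<le> 4 * 8 * L ^ 3 / sqrt (real d)"
      using L0 by (intro divide_right_mono mult_right_mono mult_left_mono) auto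
    finally show ?thesis by simp
  qed
  have conv: "pr n d (\<lambda>E. flat_null (E\<inverse>)) \<le> 7 / real d" using pr_flat_null by (simp add: pr_converse)
  have "pr n d (\<lambda>E. kernel E \<noteq> {} \<and> kernel (E\<inverse>) \<noteq> {})
    \<le> pr n d (\<lambda>E. (flat_null E \<or> flat_null (E\<inverse>)) \<or> (?sp E \<or> (?cd E \<or> ?sn E)))"
  proof (rule pr_mono)
    fix E assume E: "E \<in> digraphs n d" and k: "kernel E \<noteq> {} \<and> kernel (E\<inverse>) \<noteq> {}"
    show "(flat_null E \<or> flat_null (E\<inverse>)) \<or> (?sp E \<or> (?cd E \<or> ?sn E))"
    proof (rule ccontr)
      assume neg: "\<not> ((flat_null E \<or> flat_null (E\<inverse>)) \<or> (?sp E \<or> (?cd E \<or> ?sn E)))"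
      then have "?sn E"
        by (intro many_sensitive_pairs[OF E]) (use k in \<open>simp_all add: not_le\<close>)
      then show False using neg by blast
    qed
  qed
  also have "\<dots> \<le> pr n d (\<lambda>E. flat_null E \<or> flat_null (E\<inverse>)) + pr n d (\<lambda>E. ?sp E \<or> (?cd E \<or> ?sn E))"
    by (rule pr_disj)
  also have "\<dots> \<le> (pr n d flat_null + pr n d (\<lambda>E. flat_null (E\<inverse>))) + (pr n d ?sp + pr n d (\<lambda>E. ?cd E \<or> ?sn E))"
    by (intro add_mono pr_disj)
  also have "pr n d (\<lambda>E. ?cd E \<or> ?sn E) \<le> pr n d ?cd + pr n d ?sn" by (rule pr_disj)
  finally have "pr n d (\<lambda>E. kernel E \<noteq> {} \<and> kernel (E\<inverse>) \<noteq> {})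
    \<le> 7 / real d + 7 / real d + (1 / real d + (1 / real d + 32 * L ^ 3 / sqrt (real d)))"
    using pr_flat_null conv pr_sparse_block cd cd' sn sn' by linarith
  also have "\<dots> = 16 * (1 / real d) + 32 * L ^ 3 / sqrt (real d)" by simp
  also have "1 / real d \<le> L ^ 3 / sqrt (real d)"
  proof (rule frac_le)
    show "1 \<le> L ^ 3" using L0 by simp
    show "sqrt (real d) \<le> real d" using d1 by (simp add: real_sqrt_le_iff' real_le_lsqrt self_le_power)
  qed (use L0 d1 in auto)
  finally have "pr n d (\<lambda>E. kernel E \<noteq> {} \<and> kernel (E\<inverse>) \<noteq> {}) \<le> 48 * (L ^ 3 / sqrt (real d))" by simp
  also have "\<dots> \<le> 60 * (L ^ 3 / sqrt (real d))" using L0 by (intro mult_right_mono) auto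
  finally show ?thesis by simp
qed

end

subsection \<open>Matrices\<close>

definition ones :: "nat \<Rightarrow> real mat \<Rightarrow> (nat \<times> nat) set" where
  "ones n M = {(i, j). i < n \<and> j < n \<and> M $$ (i, j) = 1}"

lemma bij_betw_ones: "bij_betw (ones n) (regular_digraph_matrices n d) (digraphs n d)"
proof (rule bij_betw_byWitness[where f' = "\<lambda>E. mat n n (\<lambda>e. if e \<in> E then 1 else 0)"])
  show "\<forall>M\<in>regular_digraph_matrices n d. mat n n (\<lambda>e. if e \<in> ones n M then 1 else 0) = M"
  proof
    fix M assume M: "M \<in> regular_digraph_matrices n d"
    have c: "M \<in> carrier_mat n n" and bin: "\<And>i j. i < n \<Longrightarrow> j < n \<Longrightarrow> M $$ (i, j) \<in> {0, 1}"
      using M unfolding regular_digraph_matrices_def by blast+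
    show "mat n n (\<lambda>e. if e \<in> ones n M then 1 else 0) = M"
    proof (rule eq_matI)
      fix i j assume "i < dim_row M" "j < dim_col M"
      then have ij: "i < n" "j < n" using c by auto
      show "mat n n (\<lambda>e. if e \<in> ones n M then 1 else 0) $$ (i, j) = M $$ (i, j)"
        using ij bin[OF ij] by (auto simp: ones_def)
    qed (use c in auto)
  qed
  have eq: "ones n (mat n n (\<lambda>e. if e \<in> E then 1 else 0)) = E" if "E \<in> digraphs n d" for E
    using digraphs_subset[OF that] by (auto simp: ones_def split: if_splits)
  then show "\<forall>E\<in>digraphs n d. ones n (mat n n (\<lambda>e. if e \<in> E then 1 else 0)) = E" by blast
  have outs_ones: "outs (ones n M) i = {j. j < n \<and> M $$ (i, j) = 1}" if "i < n" for M i
    using that by (auto simp: ones_def)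
  have ins_ones: "ins (ones n M) j = {i. i < n \<and> M $$ (i, j) = 1}" if "j < n" for M j
    using that by (auto simp: ones_def)
  show "ones n ` regular_digraph_matrices n d \<subseteq> digraphs n d"
  proof
    fix E assume "E \<in> ones n ` regular_digraph_matrices n d"
    then obtain M where M: "M \<in> regular_digraph_matrices n d" "E = ones n M" by blast
    have "E \<subseteq> {..<n} \<times> {..<n}" using M(2) by (auto simp: ones_def)
    then show "E \<in> digraphs n d"
      using M by (simp add: digraphs_def outs_ones ins_ones regular_digraph_matrices_def)
  qed
  show "(\<lambda>E. mat n n (\<lambda>e. if e \<in> E then 1 else 0)) ` digraphs n d \<subseteq> regular_digraph_matrices n d"
  proof
    fix M assume "M \<in> (\<lambda>E. mat n n (\<lambda>e. if e \<in> E then 1 else 0 :: real)) ` digraphs n d"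
    then obtain E where E: "E \<in> digraphs n d" and M: "M = mat n n (\<lambda>e. if e \<in> E then 1 else 0)" by blast
    have "{j. j < n \<and> M $$ (i, j) = 1} = outs E i" if "i < n" for i
      using outs_ones[OF that, of M] eq[OF E] M by simp
    moreover have "{i. i < n \<and> M $$ (i, j) = 1} = ins E j" if "j < n" for j
      using ins_ones[OF that, of M] eq[OF E] M by simp
    ultimately show "M \<in> regular_digraph_matrices n d"
      using card_outs[OF E] card_ins[OF E] by (auto simp: regular_digraph_matrices_def M)
  qed
qed

lemma det_eq_0_of_singular:
  assumes M: "M \<in> carrier_mat n n" and sing: "singular_mat M"
  shows "det M = 0"
proof (rule ccontr)
  assume "det M \<noteq> 0"
  then have "M \<in> Units (ring_mat TYPE(real) n ())" by (rule det_non_zero_imp_unit[OF M])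
  then obtain B where "B \<in> carrier_mat n n" "B * M = 1\<^sub>m n" "M * B = 1\<^sub>m n"
    by (auto simp: Units_def ring_mat_def)
  then have "invertible_mat M" using M by (auto simp: invertible_mat_def inverts_mat_def)
  then show False using sing by (simp add: singular_mat_def)
qed

lemma null_vector_of_det_eq_0:
  fixes M :: "real mat"
  assumes M: "M \<in> carrier_mat n n" "det M = 0" and bin: "\<And>i j. i < n \<Longrightarrow> j < n \<Longrightarrow> M $$ (i, j) \<in> {0, 1}"
  shows "\<exists>x :: nat \<Rightarrow> real. (\<exists>j<n. x j \<noteq> 0) \<and> (\<forall>i<n. sum x (outs (ones n M) i) = 0)"
proof -
  obtain v where v: "v \<in> carrier_vec n" "v \<noteq> 0\<^sub>v n" "M *\<^sub>v v = 0\<^sub>v n"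
    using det_0_iff_vec_prod_zero[OF M(1)] M(2) by blast
  have "\<exists>j<n. v $ j \<noteq> 0" using v(1,2) by (metis carrier_vecD eq_vecI index_zero_vec)
  moreover have "sum (($) v) (outs (ones n M) i) = 0" if i: "i < n" for i
  proof -
    have o: "outs (ones n M) i = {j \<in> {..<n}. M $$ (i, j) = 1}" using i by (auto simp: ones_def)
    have "0 = (M *\<^sub>v v) $ i" using v(3) i by simp
    also have "\<dots> = (\<Sum>j<n. M $$ (i, j) * v $ j)"
      using i M(1) v(1) by (simp add: scalar_prod_def lessThan_atLeast0)
    also have "\<dots> = (\<Sum>j<n. if M $$ (i, j) = 1 then v $ j else 0)"
      by (rule sum.cong) (use bin[OF i] in auto)
    also have "\<dots> = sum (($) v) (outs (ones n M) i)"
      unfolding o by (simp add: sum.If_cases Int_def)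
    finally show ?thesis by simp
  qed
  ultimately have "(\<exists>j<n. v $ j \<noteq> 0) \<and> (\<forall>i<n. sum (($) v) (outs (ones n M) i) = 0)" by simp
  then show ?thesis by (rule exI[of _ "($) v"])
qed

context regime
begin

lemma singular_prob_le: "singular_prob n d \<le> 60 * L ^ 3 / sqrt (real d)"
proof -
  let ?R = "regular_digraph_matrices n d"
  have sub: "ones n ` {M \<in> ?R. singular_mat M} \<subseteq> {E \<in> digraphs n d. kernel E \<noteq> {} \<and> kernel (E\<inverse>) \<noteq> {}}"
  proof
    fix E assume "E \<in> ones n ` {M \<in> ?R. singular_mat M}"
    then obtain M where M: "M \<in> ?R" "singular_mat M" "E = ones n M" by blast
    have c: "M \<in> carrier_mat n n" and bin: "\<And>i j. i < n \<Longrightarrow> j < n \<Longrightarrow> M $$ (i, j) \<in> {0, 1}"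
      using M(1) by (auto simp: regular_digraph_matrices_def)
    have det: "det M = 0" by (rule det_eq_0_of_singular[OF c M(2)])
    have "kernel E \<noteq> {}"
      using null_vector_of_det_eq_0[OF c det bin] by (auto simp: kernel_def M(3))
    moreover have "kernel (E\<inverse>) \<noteq> {}"
    proof -
      have "det M\<^sup>T = 0" using det det_transpose[OF c] by simp
      moreover have "\<And>i j. i < n \<Longrightarrow> j < n \<Longrightarrow> M\<^sup>T $$ (i, j) \<in> {0, 1}" using bin c by auto
      moreover have "E\<inverse> = ones n M\<^sup>T" using c by (auto simp: M(3) ones_def)
      ultimately show ?thesis
        using null_vector_of_det_eq_0[of "M\<^sup>T" n] c by (auto simp: kernel_def)
    qed
    moreover have "E \<in> digraphs n d" using M(1,3) bij_betw_ones by (auto simp: bij_betw_def)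
    ultimately show "E \<in> {E \<in> digraphs n d. kernel E \<noteq> {} \<and> kernel (E\<inverse>) \<noteq> {}}" by simp
  qed
  have "inj_on (ones n) {M \<in> ?R. singular_mat M}"
    by (rule inj_on_subset[of _ ?R]) (use bij_betw_ones in \<open>auto simp: bij_betw_def\<close>)
  then have "card {M \<in> ?R. singular_mat M} \<le> card {E \<in> digraphs n d. kernel E \<noteq> {} \<and> kernel (E\<inverse>) \<noteq> {}}"
    by (rule card_inj_on_le[OF _ sub]) simp
  moreover have "card ?R = card (digraphs n d)" by (rule bij_betw_same_card[OF bij_betw_ones])
  ultimately have "singular_prob n d \<le> pr n d (\<lambda>E. kernel E \<noteq> {} \<and> kernel (E\<inverse>) \<noteq> {})"
    unfolding singular_prob_eq_card pr_def by (simp add: divide_right_mono)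
  also note pr_singular
  finally show ?thesis .
qed

end

section \<open>Choice of the absolute constants\<close>

text \<open>These are the assumptions of \<open>regime\<close> on d alone; that they hold for all
  large d makes the threshold absolute.\<close>

lemma eventually_regime:
  "eventually (\<lambda>x::real. 10 ^ 6 \<le> ln x \<and> 6 * x ^ 3 \<le> exp (x / 10)
    \<and> x ^ 3 \<le> 2 powr (x / (60 * (ln x)\<^sup>2)) \<and> 2000 * ln x ^ 4 \<le> x) at_top"
proof -
  have l: "((\<lambda>x::real. ln x ^ 4 / x) \<longlongrightarrow> 0) at_top" "((\<lambda>x::real. x ^ 3 / exp (x / 10)) \<longlongrightarrow> 0) at_top"
    "((\<lambda>x::real. ln x ^ 3 / x) \<longlongrightarrow> 0) at_top" by real_asymp+
  have "eventually (\<lambda>x::real. 10 ^ 6 \<le> ln x) at_top"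
    using ln_at_top by (simp only: filterlim_at_top)
  moreover have "eventually (\<lambda>x::real. ln x ^ 4 / x < 1 / 2000) at_top"
    by (rule order_tendstoD(2)[OF l(1)]) simp
  moreover have "eventually (\<lambda>x::real. x ^ 3 / exp (x / 10) < 1 / 6) at_top"
    by (rule order_tendstoD(2)[OF l(2)]) simp
  moreover have "eventually (\<lambda>x::real. ln x ^ 3 / x < ln 2 / 180) at_top"
    by (rule order_tendstoD(2)[OF l(3)]) simp
  moreover have "eventually (\<lambda>x::real. 0 < x) at_top" by (rule eventually_gt_at_top)
  ultimately show ?thesis
  proof eventually_elim
    case (elim x)
    have ln: "0 < ln x" using elim(1) by (rule less_le_trans[rotated]) simp
    have "3 * ln x \<le> ln 2 * (x / (60 * (ln x)\<^sup>2))"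
      using elim(4,5) ln by (simp add: field_simps eval_nat_numeral)
    then have "exp (3 * ln x) \<le> exp (ln 2 * (x / (60 * (ln x)\<^sup>2)))" by (simp only: exp_le_cancel_iff)
    moreover have "exp (3 * ln x) = x ^ 3" using exp_of_nat_mult[of 3 "ln x"] elim(5) by simp
    moreover have "exp (ln 2 * (x / (60 * (ln x)\<^sup>2))) = 2 powr (x / (60 * (ln x)\<^sup>2))"
      by (simp add: powr_def)
    ultimately have "x ^ 3 \<le> 2 powr (x / (60 * (ln x)\<^sup>2))" by (simp only:)
    then show ?case using elim by (simp add: field_simps)
  qed
qed

theorem theoremA:
  shows "\<exists>c C :: real. c > 0 \<and> C > 0 \<and>
    (\<forall>n d :: nat. 1 \<le> d \<and> d \<le> n \<and> C \<le> real d \<and> real d \<le> c * real n / (ln (real n))\<^sup>2 \<longrightarrow>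
      singular_prob n d \<le> C * (ln (real d)) ^ 3 / sqrt (real d))"
proof -
  obtain D :: real where D: "\<And>x. D \<le> x \<Longrightarrow> 10 ^ 6 \<le> ln x \<and> 6 * x ^ 3 \<le> exp (x / 10)
    \<and> x ^ 3 \<le> 2 powr (x / (60 * (ln x)\<^sup>2)) \<and> 2000 * ln x ^ 4 \<le> x"
    using eventually_regime unfolding eventually_at_top_linorder by blast
  \<comment> \<open>\<open>C\<close> is both the least admissible d and the factor of the bound,
    hence the maximum.\<close>
  define C where "C = max D 60"
  have "singular_prob n d \<le> C * (ln (real d)) ^ 3 / sqrt (real d)"
    if h: "1 \<le> d" "d \<le> n" "C \<le> real d" "real d \<le> 1 / 1500 * real n / (ln (real n))\<^sup>2" for n d
  proof -
    define L where "L = ln (real d)"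
    have "D \<le> real d" using h(3) by (simp add: C_def)
    note D' = D[OF this, folded L_def]
    have L: "0 < L" "L \<le> ln (real n)" using D' h(1,2) by (simp, simp add: L_def)
    \<comment> \<open>The hypothesis involves ln n, while \<open>sparse\<close> involves ln d, which
      is at most ln n since d <= n.\<close>
    have "L\<^sup>2 \<le> (ln (real n))\<^sup>2" using L by (intro power_mono) auto
    then have "real d * L\<^sup>2 \<le> real d * (ln (real n))\<^sup>2" by (rule mult_left_mono) simp
    also have "\<dots> \<le> 1 / 1500 * real n" using h(4) L by (simp add: field_simps)
    finally have "1500 * (real d * L\<^sup>2) \<le> real n" by simp
    then interpret regime n d L by unfold_locales (use D' L_def in auto)
    have "singular_prob n d \<le> 60 * L ^ 3 / sqrt (real d)" by (rule singular_prob_le)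
    also have "\<dots> \<le> C * L ^ 3 / sqrt (real d)"
      using L by (intro divide_right_mono mult_right_mono) (auto simp: C_def)
    finally show ?thesis by (simp add: L_def)
  qed
  moreover have "0 < C" by (simp add: C_def)
  ultimately show ?thesis by (intro exI[of _ "1 / 1500"] exI[of _ C]) auto
qed

end
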